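(* Every simple planar $2$-connected cubic graph on $n > 4$ vertices has a cycle double cover of size at most $n/2$.
   Context: A cycle is a connected $2$-regular graph. A cycle double cover of a graph $G$ is a multiset of cycles of $G$ such that every edge of $G$ lies in exactly two members, counted with multiplicity; its size is the number of cycles counted with multiplicity. *)

theory Defs
  imports
    "HOL-Analysis.Analysis"
    "HOL-Library.Multiset"
    "Graph_Theory.Graph_Theory"
begin

text \<open>
  A finite simple undirected graph is a \<open>pair_graph\<close>: each undirected edge \<open>uv\<close> is the
  pair of arcs \<open>(u, v)\<close>, \<open>(v, u)\<close>, so the degree of a vertex is its out-degree.
  The unqualified \<open>connected\<close> could also denote the topological notion.
\<close>

definition regular_graph :: "nat \<Rightarrow> 'a pair_pre_digraph \<Rightarrow> bool" where
  "regular_graph k G \<longleftrightarrow> (\<forall>v \<in> pverts G. out_degree (with_proj G) v = k)"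

definition vertex_connected :: "nat \<Rightarrow> 'a pair_pre_digraph \<Rightarrow> bool" where
  "vertex_connected k G \<longleftrightarrow> k < card (pverts G) \<and>
     (\<forall>X \<subseteq> pverts G. card X < k \<longrightarrow>
        Digraph_Component.connected (induce_subgraph (with_proj G) (pverts G - X)))"

text \<open>
  The curve of \<open>(v, u)\<close> is the reversed curve of \<open>(u, v)\<close>, so that every undirected edge
  is drawn as a single arc. The last two conditions together say that the curves of two
  distinct edges meet at most in common end vertices.
\<close>

definition plane_drawing ::
    "'a pair_pre_digraph \<Rightarrow> ('a \<Rightarrow> complex) \<Rightarrow> ('a \<times> 'a \<Rightarrow> real \<Rightarrow> complex) \<Rightarrow> bool" where
  "plane_drawing G p \<gamma> \<longleftrightarrow>
     inj_on p (pverts G) \<and>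
     (\<forall>(u, v) \<in> parcs G.
        arc (\<gamma> (u, v)) \<and>
        pathstart (\<gamma> (u, v)) = p u \<and> pathfinish (\<gamma> (u, v)) = p v \<and>
        \<gamma> (v, u) = reversepath (\<gamma> (u, v))) \<and>
     (\<forall>(u, v) \<in> parcs G. path_image (\<gamma> (u, v)) \<inter> p ` pverts G = {p u, p v}) \<and>
     (\<forall>(u, v) \<in> parcs G. \<forall>(x, y) \<in> parcs G. {u, v} \<noteq> {x, y} \<longrightarrow>
        path_image (\<gamma> (u, v)) \<inter> path_image (\<gamma> (x, y)) \<subseteq> p ` pverts G)"

definition planar :: "'a pair_pre_digraph \<Rightarrow> bool" where
  "planar G \<longleftrightarrow> (\<exists>p \<gamma>. plane_drawing G p \<gamma>)"

definition cycle_graph :: "'a pair_pre_digraph \<Rightarrow> bool" where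
  "cycle_graph C \<longleftrightarrow>
     pair_graph C \<and> Digraph_Component.connected (with_proj C) \<and> regular_graph 2 C"

definition cycle_double_cover ::
    "'a pair_pre_digraph \<Rightarrow> 'a pair_pre_digraph multiset \<Rightarrow> bool" where
  "cycle_double_cover G M \<longleftrightarrow>
     (\<forall>C \<in># M. cycle_graph C \<and> subgraph (with_proj C) (with_proj G)) \<and>
     (\<forall>e \<in> parcs G. size {#C \<in># M. e \<in> parcs C#} = 2)"

end

theory Submission
  imports Defs
begin

text \<open>
  The faces of a drawing are the components of its complement. Splitting a side of a cycle by ears
  (2-connectedness and the theta curve lemma) shows that faces are bounded by cycles, that every edge
  lies on exactly two of them, that there are \<open>n/2 + 2\<close> faces, and that every cycle is the sum modulo 2
  of the faces on one of its sides. It remains to save two cycles.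

  Call a face good if it shares at most one edge with every other face. By planarity, the adjacency
  graph of the neighbours of a good face \<open>f\<close> is outerplanar, hence 3-colourable. Replacing \<open>f\<close> and its
  neighbours by the three sums of \<open>f\<close> with one colour class saves \<open>k - 2\<close> cycles, where \<open>k\<close> is the
  length of \<open>f\<close>. So one good face of length at least 4 suffices, and so do two disjoint triangles. If
  all faces are good, one of them has length at least 4 because the graph is not \<open>K\<^sub>4\<close>. Otherwise two
  faces share two edges, these form a 2-edge-cut, and each of its two sides contains a good face.
\<close>

section \<open>Paths and cycles as edge sets\<close>

text \<open>Cubicity turns sums of faces into cycles: two cycles through a common vertex of degree 3
  must share an edge there, so two cycles with exactly one common edge meet only in that edge, and
  their sum modulo 2 is again a single cycle. This is why a good face may absorb neighbours, and why
  the obstacle is a pair of faces with two common edges. A good face of length k has k different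
  neighbours; k + 1 cycles give way to 3, hence the saving k - 2. A triangle therefore saves only
  one, and disjointness keeps the second triangle a triangle when the first is removed. The
  2-edge-cut comes from parity: a cycle uses an edge iff the two faces at the edge lie on different
  sides of the cycle, so edges with the same pair of faces lie on the same cycles. As the two sides
  of the cut share no vertex, short good faces found in them are disjoint triangles.\<close>

fun path_edges :: "'a list \<Rightarrow> 'a set set" where
  "path_edges (x # y # xs) = insert {x, y} (path_edges (y # xs))"
| "path_edges _ = {}"

definition path_betw :: "'a \<Rightarrow> 'a list \<Rightarrow> 'a \<Rightarrow> bool" where
  "path_betw a p b \<longleftrightarrow> distinct p \<and> p \<noteq> [] \<and> hd p = a \<and> last p = b"

text \<open>The bound 3 excludes two-vertex lists, whose closed walk would run through a single edge
  back and forth.\<close>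

definition cycle_edges :: "'a set set \<Rightarrow> bool" where
  "cycle_edges K \<longleftrightarrow> (\<exists>p. distinct p \<and> 3 \<le> length p \<and> K = path_edges (p @ [hd p]))"

lemma path_edges_append:
  "path_edges (xs @ y # ys) = path_edges (xs @ [y]) \<union> path_edges (y # ys)"
  by (induction xs rule: path_edges.induct) (auto simp: neq_Nil_conv)

lemma path_edges_snoc: "path_edges (xs @ [x, y]) = insert {x, y} (path_edges (xs @ [x]))"
  using path_edges_append[of xs x "[y]"] by simp

lemma path_edges_rev [simp]: "path_edges (rev p) = path_edges p"
  by (induction p rule: path_edges.induct) (auto simp: path_edges_snoc insert_commute)

lemma finite_path_edges [simp]: "finite (path_edges p)"
  by (induction p rule: path_edges.induct) auto

lemma path_edges_subset: "e \<in> path_edges p \<Longrightarrow> e \<subseteq> set p"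
  by (induction p rule: path_edges.induct) auto

lemma Union_path_edges: "2 \<le> length p \<Longrightarrow> \<Union> (path_edges p) = set p"
proof (induction p rule: path_edges.induct)
  case (1 x y xs)
  then show ?case by (cases xs) auto
qed auto

lemma card_path_edges: "distinct p \<Longrightarrow> card (path_edges p) = length p - 1"
proof (induction p rule: path_edges.induct)
  case (1 x y xs)
  have "{x, y} \<notin> path_edges (y # xs)"
    using path_edges_subset[of "{x, y}" "y # xs"] 1 by auto
  then show ?case using 1 by simp
qed auto

lemma path_edges_pair:
  assumes "distinct p" "e \<in> path_edges p"
  obtains x y where "e = {x, y}" "x \<noteq> y" "x \<in> set p" "y \<in> set p"
proof -
  have "\<exists>x y. e = {x, y} \<and> x \<noteq> y \<and> x \<in> set p \<and> y \<in> set p"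
    using assms by (induction p rule: path_edges.induct) auto
  with that show thesis by blast
qed

lemma path_betw_length2: "path_betw a p b \<Longrightarrow> a \<noteq> b \<Longrightarrow> 2 \<le> length p"
  by (cases p rule: path_edges.cases) (auto simp: path_betw_def)

lemma path_betw_ends: "path_betw a p b \<Longrightarrow> a \<in> set p \<and> b \<in> set p"
  by (auto simp: path_betw_def)

lemma path_betw_snoc_form:
  assumes "path_betw a p b" "a \<noteq> b"
  obtains m where "p = a # m @ [b]" "a \<notin> set m" "b \<notin> set m" "distinct m"
proof -
  obtain q where q: "p = a # q" using assms by (auto simp: path_betw_def neq_Nil_conv)
  with assms have "q \<noteq> []" by (auto simp: path_betw_def)
  then obtain m c where "q = m @ [c]" by (metis rev_exhaust)
  with q assms that show thesis by (auto simp: path_betw_def)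
qed

text \<open>After the first step a path does not return to \<open>a\<close>, so an edge joining both
  ends can only be the first one; its other end is then already \<open>b\<close>.\<close>

lemma path_betw_edge:
  assumes "path_betw a p b" "a \<noteq> b" "{a, b} \<in> path_edges p"
  shows "p = [a, b]"
proof -
  obtain m where m: "p = a # m @ [b]" "a \<notin> set m" "b \<notin> set m"
    using path_betw_snoc_form[OF assms(1,2)] by blast
  show ?thesis
  proof (cases m)
    case (Cons y ys)
    then have "{a, b} \<in> path_edges (y # ys @ [b])"
      using assms(3) m assms(2) by (auto simp: doubleton_eq_iff)
    then have "a \<in> set (y # ys @ [b])" using path_edges_subset by blast
    with m Cons assms(2) show ?thesis by auto
  qed (use m in auto)
qed

text \<open>Run along \<open>p\<close> and return along \<open>q\<close> reversed. The length bound
  rules out that both paths are the same single edge.\<close>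

lemma cycle_edges_betwI:
  assumes p: "path_betw a p b" and q: "path_betw a q b" and ne: "a \<noteq> b"
    and int: "set p \<inter> set q = {a, b}" and l: "3 \<le> length p"
  shows "cycle_edges (path_edges p \<union> path_edges q)"
proof -
  obtain m where m: "p = a # m @ [b]" "a \<notin> set m" "b \<notin> set m" "distinct m"
    using path_betw_snoc_form[OF p ne] by blast
  obtain k where k: "q = a # k @ [b]" "a \<notin> set k" "b \<notin> set k" "distinct k"
    using path_betw_snoc_form[OF q ne] by blast
  define r where "r = a # m @ b # rev k"
  have "set m \<inter> set k = {}" using int m k by auto
  then have "distinct r" using m k ne by (auto simp: r_def)
  moreover have "3 \<le> length r" using l m by (simp add: r_def)
  moreover have "path_edges (r @ [hd r]) = path_edges p \<union> path_edges (rev q)"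
    using path_edges_append[of "a # m" b "rev k @ [a]"] m k by (simp add: r_def)
  ultimately show ?thesis unfolding cycle_edges_def
    by (metis path_edges_rev)
qed

text \<open>A common edge has both ends among the common vertices \<open>a\<close> and
  \<open>b\<close>, so it joins them; then \<open>p\<close> would be that single edge.\<close>

lemma path_edges_disjoint:
  assumes p: "path_betw a p b" and q: "path_betw a q b" and ne: "a \<noteq> b"
    and int: "set p \<inter> set q = {a, b}" and l: "3 \<le> length p"
  shows "path_edges p \<inter> path_edges q = {}"
proof (rule ccontr)
  assume "path_edges p \<inter> path_edges q \<noteq> {}"
  then obtain e where e: "e \<in> path_edges p" "e \<in> path_edges q" by auto
  then have "e \<subseteq> {a, b}" using path_edges_subset int by fastforce
  moreover obtain x y where "e = {x, y}" "x \<noteq> y"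
    using path_edges_pair[OF _ e(1)] p by (metis path_betw_def)
  ultimately have "e = {a, b}" by auto
  then have "p = [a, b]" using path_betw_edge[OF p ne] e by simp
  with l show False by simp
qed

lemma cycle_edges_split:
  assumes K: "cycle_edges K" and a: "a \<in> \<Union>K" and b: "b \<in> \<Union>K" and ne: "a \<noteq> b"
  obtains p q where "path_betw a p b" "path_betw a q b" "set p \<inter> set q = {a, b}"
    "K = path_edges p \<union> path_edges q" "path_edges p \<inter> path_edges q = {}"
proof -
  obtain c where c: "distinct c" "3 \<le> length c" "K = path_edges (c @ [hd c])"
    using K by (auto simp: cycle_edges_def)
  have "\<Union>K = set (c @ [hd c])" using c(2) unfolding c(3) by (intro Union_path_edges) simp
  also have "\<dots> = set c" using c(2) by (cases c) auto
  finally have UK: "\<Union>K = set c" .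
  then obtain c1 c2 where c12: "c = c1 @ a # c2" using a by (metis split_list)
  \<comment> \<open>The cyclic list rotated to start at \<open>a\<close>. Cutting it at
    \<open>b\<close> gives one path; the other piece is read backwards so that it also starts at
    \<open>a\<close>.\<close>
  define d where "d = a # c2 @ c1"
  have d: "distinct d" "set d = set c" "length d = length c" using c(1) c12 by (auto simp: d_def)
  have Kd: "K = path_edges (d @ [a])"
  proof (cases c1)
    case Nil
    then show ?thesis using c(3) c12 by (simp add: d_def)
  next
    case (Cons x xs)
    have "K = path_edges (c1 @ [a]) \<union> path_edges (a # c2 @ [x])"
      using path_edges_append[of c1 a "c2 @ [x]"] c(3) c12 Cons by simp
    moreover have "path_edges (d @ [a]) = path_edges (a # c2 @ [x]) \<union> path_edges (c1 @ [a])"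
      using path_edges_append[of "a # c2" x "xs @ [a]"] Cons by (simp add: d_def)
    ultimately show ?thesis by auto
  qed
  have "b \<in> set (c2 @ c1)" using b UK d ne by (auto simp: d_def)
  then obtain xs ys where xy: "c2 @ c1 = xs @ b # ys" by (metis split_list)
  define p where "p = a # xs @ [b]"
  define q where "q = a # rev ys @ [b]"
  have dd: "d = a # xs @ b # ys" by (simp add: d_def xy)
  have pb: "path_betw a p b" and qb: "path_betw a q b"
    using d(1) ne by (auto simp: dd p_def q_def path_betw_def)
  have int: "set p \<inter> set q = {a, b}" using d(1) by (auto simp: dd p_def q_def)
  have "path_edges (rev q) = path_edges (b # ys @ [a])" by (simp add: q_def)
  then have KK: "K = path_edges p \<union> path_edges q"
    using path_edges_append[of "a # xs" b "ys @ [a]"] Kd by (simp add: dd p_def)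
  have "3 \<le> length p \<or> 3 \<le> length q" using d(3) c(2) by (cases xs) (auto simp: dd p_def q_def)
  then have "path_edges p \<inter> path_edges q = {}"
    using path_edges_disjoint[OF pb qb ne int] path_edges_disjoint[OF qb pb ne] int by blast
  with that pb qb int KK show thesis by blast
qed

text \<open>Of the two paths into which \<open>u\<close> and \<open>v\<close> divide the cycle, the
  one that contains the edge is nothing but the edge; the other is what remains.\<close>

lemma cycle_edges_remove:
  assumes K: "cycle_edges K" and e: "{u, v} \<in> K" and ne: "u \<noteq> v"
  obtains p where "path_betw u p v" "3 \<le> length p" "K = insert {u, v} (path_edges p)"
    "{u, v} \<notin> path_edges p"
proof -
  obtain p q where pq: "path_betw u p v" "path_betw u q v"
    "K = path_edges p \<union> path_edges q" "path_edges p \<inter> path_edges q = {}"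
    using cycle_edges_split[OF K _ _ ne] e by (metis UnionI insertI1 insertI2)
  have *: "\<exists>p. path_betw u p v \<and> 3 \<le> length p \<and> K = insert {u, v} (path_edges p) \<and>
      {u, v} \<notin> path_edges p"
    if h: "path_betw u p v" "path_betw u q v"
    "K = path_edges p \<union> path_edges q" "path_edges p \<inter> path_edges q = {}" "{u, v} \<in> path_edges p"
    for p q
  proof -
    have p: "p = [u, v]" using path_betw_edge[OF h(1) ne h(5)] .
    have "q \<noteq> [u, v]" using h p by auto
    moreover obtain m where "q = u # m @ [v]" using path_betw_snoc_form[OF h(2) ne] by blast
    ultimately have "3 \<le> length q" by (cases m) auto
    with h p show ?thesis by (intro exI[of _ q]) auto
  qed
  have "{u, v} \<in> path_edges p \<or> {u, v} \<in> path_edges q" using pq e by blast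
  then show thesis using *[of p q] *[of q p] pq that by (metis Int_commute Un_commute)
qed

lemma cycle_edges_pair:
  assumes "cycle_edges K" "e \<in> K"
  obtains x y where "e = {x, y}" "x \<noteq> y"
proof -
  obtain c where c: "distinct c" "3 \<le> length c" "K = path_edges (c @ [hd c])"
    using assms by (auto simp: cycle_edges_def)
  obtain x xs where "c = x # xs" using c(2) by (cases c) auto
  moreover obtain ys y where "xs = ys @ [y]" using c(2) calculation by (cases xs rule: rev_exhaust) auto
  ultimately have K: "K = insert {y, x} (path_edges c)" "y \<noteq> x"
    using c path_edges_snoc[of "x # ys" y x] by auto
  show thesis
  proof (cases "e = {y, x}")
    case False
    then have "e \<in> path_edges c" using K assms(2) by simp
    then show thesis using path_edges_pair[OF c(1)] that by metis
  qed (use K that in simp)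
qed

lemma cycle_edges_finite: "cycle_edges K \<Longrightarrow> finite K"
  by (auto simp: cycle_edges_def)

lemma cycle_edges_nonempty: "cycle_edges K \<Longrightarrow> K \<noteq> {}"
  unfolding cycle_edges_def by (auto simp: Suc_le_length_iff numeral_3_eq_3)

lemma cycle_edges_star:
  assumes K: "cycle_edges K" and v: "v \<in> \<Union>K"
  obtains x y where "{e \<in> K. v \<in> e} = {{v, x}, {v, y}}" "x \<noteq> y" "x \<noteq> v" "y \<noteq> v"
proof -
  obtain e where e: "e \<in> K" "v \<in> e" using v by auto
  obtain u where u: "e = {v, u}" "u \<noteq> v"
    using cycle_edges_pair[OF K e(1)] e(2) by (metis insertE insert_commute singletonD)
  obtain p where p: "path_betw v p u" "3 \<le> length p" "K = insert {v, u} (path_edges p)"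
    using cycle_edges_remove[OF K] e(1) u by metis
  obtain m where m: "p = v # m @ [u]" "v \<notin> set m" "u \<notin> set m"
    using path_betw_snoc_form[OF p(1)] u(2) by metis
  obtain y ys where m': "m = y # ys" using p(2) m(1) by (cases m) auto
  have "{e \<in> path_edges (y # ys @ [u]). v \<in> e} = {}"
    using path_edges_subset m m' u(2) by fastforce
  then have "{e \<in> K. v \<in> e} = {{v, u}, {v, y}}"
    unfolding p(3) m(1) m' by auto
  with that[of u y] m m' u(2) show thesis by auto
qed

lemma cycle_edges_degree:
  assumes K: "cycle_edges K" and v: "v \<in> \<Union>K"
  shows "card {e \<in> K. v \<in> e} = 2"
proof -
  obtain x y where "{e \<in> K. v \<in> e} = {{v, x}, {v, y}}" "x \<noteq> y" "x \<noteq> v" "y \<noteq> v"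
    using cycle_edges_star[OF assms] by metis
  then show ?thesis by (simp add: doubleton_eq_iff)
qed

text \<open>Deleting one edge leaves a path on all vertices of the cycle, and a path has one vertex
  more than edges.\<close>

lemma cycle_edges_card_Union:
  assumes K: "cycle_edges K"
  shows "card (\<Union>K) = card K" "finite (\<Union>K)" "3 \<le> card K"
proof -
  obtain e where "e \<in> K" using cycle_edges_nonempty[OF K] by auto
  then obtain u v where uv: "{u, v} \<in> K" "u \<noteq> v" using cycle_edges_pair[OF K] by metis
  then obtain p where p: "path_betw u p v" "3 \<le> length p" "K = insert {u, v} (path_edges p)"
    "{u, v} \<notin> path_edges p"
    using cycle_edges_remove[OF K] by metis
  have "\<Union>K = set p" using Union_path_edges[of p] p path_betw_ends[OF p(1)] by auto
  then show "card (\<Union>K) = card K" "finite (\<Union>K)" "3 \<le> card K"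
    using p card_path_edges[of p] by (auto simp: path_betw_def distinct_card)
qed

text \<open>A new first vertex that already occurs on the path is not prepended; the path is started
  at that occurrence instead, which keeps it free of repetitions.\<close>

lemma rtrancl_path_betw:
  assumes "(x, y) \<in> {(u, v). {u, v} \<in> F}\<^sup>*"
  obtains p where "path_betw x p y" "path_edges p \<subseteq> F"
proof -
  have "\<exists>p. path_betw x p y \<and> path_edges p \<subseteq> F"
    using assms
  proof (induction rule: converse_rtrancl_induct)
    case base
    show ?case by (intro exI[of _ "[y]"]) (simp add: path_betw_def)
  next
    case (step x z)
    then obtain p where p: "path_betw z p y" "path_edges p \<subseteq> F" by blast
    show ?case
    proof (cases "x \<in> set p")
      case True
      then obtain ps qs where "p = ps @ x # qs" by (metis split_list)
      then have "path_betw x (x # qs) y \<and> path_edges (x # qs) \<subseteq> F"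
        using p path_edges_append[of ps x qs] by (auto simp: path_betw_def)
      then show ?thesis by blast
    next
      case False
      obtain qs where "p = z # qs" using p by (auto simp: path_betw_def neq_Nil_conv)
      then have "path_betw x (x # p) y \<and> path_edges (x # p) \<subseteq> F"
        using p False step by (auto simp: path_betw_def)
      then show ?thesis by blast
    qed
  qed
  with that show thesis by blast
qed

text \<open>Disjointness of the edge sets forces one of the paths to have an inner vertex. Being
  symmetric in \<open>p\<close> and \<open>q\<close>, this form suits ears and sums of
  cycles.\<close>

lemma cycle_edges_disjoint_betwI:
  assumes p: "path_betw a p b" and q: "path_betw a q b" and ne: "a \<noteq> b"
    and int: "set p \<inter> set q = {a, b}" and dj: "path_edges p \<inter> path_edges q = {}"
  shows "cycle_edges (path_edges p \<union> path_edges q)"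
proof -
  obtain m where m: "p = a # m @ [b]" using path_betw_snoc_form[OF p ne] by blast
  obtain k where k: "q = a # k @ [b]" using path_betw_snoc_form[OF q ne] by blast
  have "m \<noteq> [] \<or> k \<noteq> []" using m k dj by auto
  then have "3 \<le> length p \<or> 3 \<le> length q" using m k by (cases m; cases k) auto
  then show ?thesis
    using cycle_edges_betwI[OF p q ne int] cycle_edges_betwI[OF q p ne] int
    by (metis Int_commute Un_commute)
qed

text \<open>The start \<open>x\<close> has its own assumption because a one-vertex path has no
  edges.\<close>

lemma path_set_avoid:
  assumes "path_betw x q y" "path_edges q \<subseteq> F" "x \<notin> A" "\<And>e. e \<in> F \<Longrightarrow> e \<inter> A = {}"
  shows "set q \<inter> A = {}"
proof (cases "2 \<le> length q")
  case True
  then show ?thesis using Union_path_edges[OF True] assms(2,4) by blast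
next
  case False
  then have "q = [x]" using assms(1) by (cases q rule: path_edges.cases) (auto simp: path_betw_def)
  then show ?thesis using assms(3) by simp
qed

section \<open>Sides of Jordan curves\<close>

text \<open>The unqualified name would denote connectedness of digraphs.\<close>

abbreviation conn :: "'a::topological_space set \<Rightarrow> bool" where
  "conn \<equiv> Topological_Spaces.connected"

definition Jordan_set :: "complex set \<Rightarrow> bool" where
  "Jordan_set J \<longleftrightarrow> (\<exists>c. simple_path c \<and> pathfinish c = pathstart c \<and> path_image c = J)"

lemma conn_subset_open:
  assumes "conn T" "T \<subseteq> A \<union> B" "open A" "open B" "A \<inter> B = {}" "T \<inter> A \<noteq> {}"
  shows "T \<subseteq> A"
proof -
  have "A \<inter> B \<inter> T = {}" using assms(5) by blast
  then have "A \<inter> T = {} \<or> B \<inter> T = {}" using connectedD[OF assms(1,3,4) _ assms(2)] by blast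
  with assms(2,6) show ?thesis by blast
qed

text \<open>The Jordan curve theorem, with its two regions recognised as all the components: they
  are disjoint and open, so a connected set off \<open>J\<close> that meets one of them lies inside
  it.\<close>

lemma Jordan_set_components:
  assumes "Jordan_set J"
  obtains S S' where "components (- J) = {S, S'}" "S \<inter> S' = {}" "S \<union> S' = - J"
    "open S" "open S'" "frontier S = J" "frontier S' = J"
proof -
  obtain c where c: "simple_path c" "pathfinish c = pathstart c" "path_image c = J"
    using assms by (auto simp: Jordan_set_def)
  obtain A B where AB: "A \<noteq> {}" "open A" "conn A" "B \<noteq> {}" "open B" "conn B"
    "A \<inter> B = {}" "A \<union> B = - J" "frontier A = J" "frontier B = J"
    using Jordan_curve[OF c(1,2)] c(3) by metis
  have A: "A \<in> components (- J)"
    unfolding in_components_maximal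
  proof (intro conjI allI impI)
    show "A \<noteq> {}" "A \<subseteq> - J" "conn A" using AB by auto
    show "d = A" if "d \<noteq> {} \<and> A \<subseteq> d \<and> d \<subseteq> - J \<and> conn d" for d
      using conn_subset_open[of d A B] that AB by blast
  qed
  have B: "B \<in> components (- J)"
    unfolding in_components_maximal
  proof (intro conjI allI impI)
    show "B \<noteq> {}" "B \<subseteq> - J" "conn B" using AB by auto
    show "d = B" if "d \<noteq> {} \<and> B \<subseteq> d \<and> d \<subseteq> - J \<and> conn d" for d
      using conn_subset_open[of d B A] that AB by blast
  qed
  have "R = A \<or> R = B" if R: "R \<in> components (- J)" for R
  proof -
    have "R \<noteq> {}" "R \<subseteq> A \<union> B" using in_components_nonempty[OF R] in_components_subset[OF R] AB(8) by simp_all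
    then have "R \<inter> A \<noteq> {} \<or> R \<inter> B \<noteq> {}" by blast
    then show ?thesis using components_nonoverlap[OF R A] components_nonoverlap[OF R B] by blast
  qed
  then have "components (- J) = {A, B}" using A B by blast
  with that AB show thesis by blast
qed

lemma Jordan_set_side:
  assumes "Jordan_set J" "S \<in> components (- J)"
  shows "open S" "conn S" "frontier S = J" "S \<noteq> {}" "S \<inter> J = {}"
    "- J - S \<in> components (- J)" "components (- J) = {S, - J - S}"
proof -
  obtain A B where AB: "components (- J) = {A, B}" "A \<inter> B = {}" "A \<union> B = - J"
    "open A" "open B" "frontier A = J" "frontier B = J"
    using Jordan_set_components[OF assms(1)] by metis
  have *: "S = A \<and> - J - S = B \<or> S = B \<and> - J - S = A" using assms(2) AB(1-3) by blast
  then show "open S" "frontier S = J" "components (- J) = {S, - J - S}"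
    "- J - S \<in> components (- J)" using AB by auto
  show "conn S" "S \<noteq> {}" using assms(2) in_components_connected in_components_nonempty by auto
  show "S \<inter> J = {}" using assms(2) in_components_subset by blast
qed

lemma conn_in_component:
  assumes "conn T" "T \<subseteq> U" "S \<in> components U" "T \<inter> S \<noteq> {}"
  shows "T \<subseteq> S"
  using components_maximal[OF assms(3,1,2)] assms(4) by blast

text \<open>
  Stated for components of the complement rather than for inside and outside, so that bounded and
  unbounded regions need no separate treatment. Janiszewski's theorem shows that \<open>B\<close> leaves no
  third region.
\<close>

lemma theta_sides:
  assumes J: "Jordan_set (A1 \<union> A2)" "Jordan_set (A1 \<union> B)" "Jordan_set (A2 \<union> B)"
    and cpt: "compact A1" "compact A2" "compact B" and cB: "conn B"
    and i12: "A1 \<inter> A2 = {a, b}" and i1: "A1 \<inter> B = {a, b}" and i2: "A2 \<inter> B = {a, b}"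
    and ne: "A1 - {a, b} \<noteq> {}" 
    and S: "S \<in> components (- (A1 \<union> A2))" and BS: "B - {a, b} \<subseteq> S"
  obtains D1 D2 where "D1 \<in> components (- (A1 \<union> B))" "D2 \<in> components (- (A2 \<union> B))"
    "D1 \<inter> D2 = {}" "S = D1 \<union> D2 \<union> (B - {a, b})"
proof -
  define S' where "S' = - (A1 \<union> A2) - S"
  note SS = Jordan_set_side[OF J(1) S]
  have S'c: "S' \<in> components (- (A1 \<union> A2))" using SS by (simp add: S'_def)
  note SS' = Jordan_set_side[OF J(1) S'c]
  \<comment> \<open>Adding part of its frontier keeps \<open>S'\<close> connected, so
    \<open>S'\<close> and one open arc of its boundary lie on a single side of the curve formed by
    the other arc and \<open>B\<close>.\<close>
  have ex: "\<exists>C. C \<in> components (- (X \<union> B)) \<and> S' \<union> (Y - {a, b}) \<subseteq> C"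
    if "X \<inter> Y = {a, b}" "X \<union> Y = A1 \<union> A2" "X \<inter> B = {a, b}" "Y \<inter> B = {a, b}" for X Y
  proof (rule exists_component_superset)
    have "B \<subseteq> S \<union> {a, b}" using BS by blast
    then show sub: "S' \<union> (Y - {a, b}) \<subseteq> - (X \<union> B)" using that by (auto simp: S'_def)
    show "- (X \<union> B) \<noteq> {}" using sub SS'(4) by blast
    have "closure S' = S' \<union> (A1 \<union> A2)"
      using SS'(3) by (metis closure_Un_frontier)
    then have "S' \<union> (Y - {a, b}) \<subseteq> closure S'" using that by blast
    then show "conn (S' \<union> (Y - {a, b}))"
      using connected_intermediate_closure[OF SS'(2)] by blast
  qed
  obtain C1 where C1: "C1 \<in> components (- (A1 \<union> B))" "S' \<union> (A2 - {a, b}) \<subseteq> C1"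
    using ex[of A1 A2] i12 i1 i2 by blast
  obtain C2 where C2: "C2 \<in> components (- (A2 \<union> B))" "S' \<union> (A1 - {a, b}) \<subseteq> C2"
    using ex[of A2 A1] i12 i1 i2 by (metis Int_commute Un_commute)
  \<comment> \<open>\<open>D1\<close> and \<open>D2\<close> are the sides away from
    \<open>S'\<close>, so both end up inside \<open>S\<close>.\<close>
  define D1 where "D1 = - (A1 \<union> B) - C1"
  define D2 where "D2 = - (A2 \<union> B) - C2"
  have D1: "D1 \<in> components (- (A1 \<union> B))" and D2: "D2 \<in> components (- (A2 \<union> B))"
    using Jordan_set_side[OF J(2) C1(1)] Jordan_set_side[OF J(3) C2(1)] by (auto simp: D1_def D2_def)
  note DD1 = Jordan_set_side[OF J(2) D1] and DD2 = Jordan_set_side[OF J(3) D2]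
  have D1S: "D1 \<subseteq> S"
    using C1(2) i12 unfolding D1_def S'_def by blast
  have D2S: "D2 \<subseteq> S"
    using C2(2) i12 unfolding D2_def S'_def by blast
  \<comment> \<open>If they overlapped, they would be equal and have the same frontier, although
    \<open>A1\<close> has points outside \<open>A2\<close> and \<open>B\<close>.\<close>
  have disj: "D1 \<inter> D2 = {}"
  proof (rule ccontr)
    assume h: "D1 \<inter> D2 \<noteq> {}"
    have "D1 \<subseteq> - (A2 \<union> B)" "D2 \<subseteq> - (A1 \<union> B)" using D1S D2S DD1(5) DD2(5) SS(5) by blast+
    then have "D1 = D2" using conn_in_component[OF DD1(2) _ D2] conn_in_component[OF DD2(2) _ D1] h by blast
    then have "A1 \<union> B = A2 \<union> B" using DD1(3) DD2(3) by simp
    then show False using ne i12 i1 by blast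
  qed
  \<comment> \<open>Otherwise \<open>x\<close> can be joined to a point of \<open>S'\<close> off
    each of the two curves separately. The curves meet in the connected set \<open>B\<close>, so
    Janiszewski joins the points off both at once, which would lead from \<open>S\<close> into
    \<open>S'\<close>.\<close>
  have "x \<in> D1 \<union> D2" if x: "x \<in> S" "x \<notin> B" for x
  proof (rule ccontr)
    assume h: "x \<notin> D1 \<union> D2"
    then have xC: "x \<in> C1" "x \<in> C2" using x SS(5) by (auto simp: D1_def D2_def)
    obtain y where y: "y \<in> S'" using SS'(4) by auto
    have c1: "connected_component (- (A1 \<union> B)) x y"
      unfolding connected_component_def using C1 xC y in_components_connected in_components_subset by blast
    have c2: "connected_component (- (A2 \<union> B)) x y"
      unfolding connected_component_def using C2 xC y in_components_connected in_components_subset by blast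
    have "(A1 \<union> B) \<inter> (A2 \<union> B) = B" using i12 i1 by blast
    then have "connected_component (- ((A1 \<union> B) \<union> (A2 \<union> B))) x y"
      using Janiszewski[OF _ _ _ c1 c2] cpt cB by (simp add: compact_Un compact_imp_closed)
    then obtain T where T: "conn T" "T \<subseteq> - ((A1 \<union> B) \<union> (A2 \<union> B))" "x \<in> T" "y \<in> T"
      by (auto simp: connected_component_def)
    then have "T \<subseteq> S" using conn_in_component[OF T(1) _ S] x by blast
    then show False using T y by (auto simp: S'_def)
  qed
  then have "S \<subseteq> D1 \<union> D2 \<union> B" by blast
  moreover have "a \<notin> S" "b \<notin> S" using SS(5) i12 by auto
  ultimately have "S = D1 \<union> D2 \<union> (B - {a, b})" using D1S D2S BS by auto
  with that D1 D2 disj show thesis by blast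
qed

lemma Jordan_set_arcs:
  assumes "arc g" "arc h" "pathstart g = a" "pathstart h = a" "pathfinish g = b" "pathfinish h = b"
    "path_image g \<inter> path_image h = {a, b}"
  shows "Jordan_set (path_image g \<union> path_image h)"
proof -
  have "simple_path (g +++ reversepath h)"
    using assms by (intro simple_path_join_loop) (auto simp: arc_reversepath)
  moreover have "path_image (g +++ reversepath h) = path_image g \<union> path_image h"
    using assms by (simp add: path_image_join)
  ultimately show ?thesis unfolding Jordan_set_def using assms
    by (intro exI[of _ "g +++ reversepath h"]) simp
qed

text \<open>The closed unit interval is the closure of the open one. This is how an open region
  containing a vertex is seen to meet the interior of each incident edge.\<close>

lemma arc_subset_closure_endless:
  fixes g :: "real \<Rightarrow> 'a::real_normed_vector"
  assumes "arc g"
  shows "path_image g \<subseteq> closure (path_image g - {pathstart g, pathfinish g})"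
proof -
  have "path_image g - {pathstart g, pathfinish g} = g ` {0<..<1}"
    using simple_path_endless assms arc_imp_simple_path by blast
  moreover have "g ` closure {0<..<1} \<subseteq> closure (g ` {0<..<1})"
    using assms by (intro image_closure_subset[OF _ closed_closure closure_subset])
      (auto simp: arc_def path_def)
  ultimately show ?thesis by (simp add: path_image_def)
qed

section \<open>Cubic graphs and ears\<close>

text \<open>2-connectedness enters in cut form: deleting \<open>a\<close> does not separate
  \<open>W\<close> from a remaining vertex \<open>z\<close>. This is the form that yields
  ears.\<close>

locale cubic_graph =
  fixes V :: "'a set" and E :: "'a set set"
  assumes finite_V: "finite V"
    and V_nonempty: "V \<noteq> {}"
    and edge_pair: "e \<in> E \<Longrightarrow> \<exists>u v. e = {u, v} \<and> u \<noteq> v \<and> u \<in> V \<and> v \<in> V"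
    and degree3: "v \<in> V \<Longrightarrow> card {e \<in> E. v \<in> e} = 3"
    and nonseparating: "\<lbrakk>W \<subseteq> V; W \<noteq> {}; a \<notin> W; z \<in> V - W; z \<noteq> a\<rbrakk>
      \<Longrightarrow> \<exists>w\<in>W. \<exists>x\<in>V - W. x \<noteq> a \<and> {w, x} \<in> E"
begin

lemma finite_E: "finite E"
proof (rule finite_subset)
  show "E \<subseteq> Pow V" using edge_pair by blast
qed (simp add: finite_V)

lemma edge_subset: "e \<in> E \<Longrightarrow> e \<subseteq> V"
  using edge_pair by blast

lemma edge_other:
  assumes "e \<in> E" "v \<in> e"
  obtains u where "e = {v, u}" "u \<noteq> v" "u \<in> V"
  using edge_pair[OF assms(1)] assms(2) by auto

lemma card_E: "2 * card E = 3 * card V"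
proof -
  have "(\<Sum>v\<in>V. card {e \<in> E. v \<in> e}) = (\<Sum>e\<in>E. card {v \<in> V. v \<in> e})"
    by (rule sum_multicount_gen) (auto simp: finite_V finite_E)
  moreover have "card {v \<in> V. v \<in> e} = 2" if "e \<in> E" for e
  proof -
    have "{v \<in> V. v \<in> e} = e" using edge_subset[OF that] by blast
    moreover have "card e = 2" using edge_pair[OF that] by auto
    ultimately show ?thesis by simp
  qed
  ultimately show ?thesis using degree3 by simp
qed

text \<open>The set reached from \<open>x\<close> without using \<open>v\<close> would otherwise be
  cut off from \<open>y\<close> by \<open>v\<close> alone.\<close>

lemma reachable_avoiding:
  assumes "x \<in> V" "y \<in> V" "x \<noteq> v" "y \<noteq> v"
  shows "(x, y) \<in> {(u, w). {u, w} \<in> {e \<in> E. v \<notin> e}}\<^sup>*"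
proof (rule ccontr)
  let ?R = "{(u, w). {u, w} \<in> {e \<in> E. v \<notin> e}}"
  assume h: "(x, y) \<notin> ?R\<^sup>*"
  define W where "W = {w. (x, w) \<in> ?R\<^sup>*}"
  have "w \<in> V \<and> w \<noteq> v" if "(x, w) \<in> ?R\<^sup>*" for w
    using that by (induction rule: rtrancl_induct) (use assms edge_subset in auto)
  then have "W \<subseteq> V" "v \<notin> W" by (auto simp: W_def)
  moreover have "W \<noteq> {}" "y \<in> V - W" using h assms by (auto simp: W_def)
  ultimately obtain w z where "w \<in> W" "z \<notin> W" "z \<noteq> v" "{w, z} \<in> E"
    using nonseparating[of W v y] assms by blast
  moreover have "w \<noteq> v" using calculation \<open>v \<notin> W\<close> by auto
  ultimately show False unfolding W_def
    by (auto intro: rtrancl_into_rtrancl)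
qed

text \<open>Two neighbours of a vertex are joined by a path that avoids it. This cycle is where the
  splitting into faces starts.\<close>

lemma ex_cycle: "\<exists>K \<subseteq> E. cycle_edges K"
proof -
  obtain v where v: "v \<in> V" using V_nonempty by auto
  have "2 \<le> card {e \<in> E. v \<in> e}" using degree3[OF v] by simp
  then obtain e f where ef: "e \<in> E" "v \<in> e" "f \<in> E" "v \<in> f" "e \<noteq> f"
    by (auto simp: card_le_Suc_iff numeral_2_eq_2)
  obtain x where x: "e = {v, x}" "x \<noteq> v" "x \<in> V" using edge_other ef by metis
  obtain y where y: "f = {v, y}" "y \<noteq> v" "y \<in> V" using edge_other ef by metis
  have xy: "x \<noteq> y" using ef x y by auto
  obtain q where q: "path_betw x q y" "path_edges q \<subseteq> {e \<in> E. v \<notin> e}"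
    using rtrancl_path_betw[OF reachable_avoiding[OF x(3) y(3) x(2) y(2)]] by blast
  have vq: "v \<notin> set q" using path_set_avoid[OF q, of "{v}"] x(2) by auto
  obtain m where m: "q = x # m @ [y]" using path_betw_snoc_form[OF q(1) xy] by blast
  have "path_betw v (v # q) y" "path_betw v [v, y] y"
    using q(1) vq y(2) by (auto simp: path_betw_def)
  moreover have "set (v # q) \<inter> set [v, y] = {v, y}" "3 \<le> length (v # q)" using m by auto
  ultimately have "cycle_edges (path_edges (v # q) \<union> path_edges [v, y])"
    using cycle_edges_betwI y(2) by metis
  moreover have "path_edges (v # q) \<union> path_edges [v, y] \<subseteq> E"
    using q(2) m x(1) y(1) ef by auto
  ultimately show ?thesis by blast
qed

text \<open>The component \<open>W\<close> of \<open>y\<close> off the cycle attaches to it in two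
  different vertices, as a single attachment would be a cut vertex; a path through \<open>W\<close>
  between them is an ear. The last conclusion says that each edge of the ear touches
  \<open>W\<close>, which later keeps the ear on the side where \<open>y\<close> is drawn.\<close>

lemma ear_exists:
  assumes K: "cycle_edges K" "K \<subseteq> E" and y: "y \<in> V - \<Union>K"
  obtains a P b where "path_betw a P b" "a \<noteq> b" "a \<in> \<Union>K" "b \<in> \<Union>K" "path_edges P \<subseteq> E"
    "set P \<inter> \<Union>K = {a, b}" "path_edges P \<inter> K = {}"
    "\<And>e. e \<in> path_edges P \<Longrightarrow>
       \<exists>w\<in>e. (y, w) \<in> {(u, v). {u, v} \<in> {e \<in> E. e \<inter> \<Union>K = {}}}\<^sup>*"
proof -
  define F where "F = {e \<in> E. e \<inter> \<Union>K = {}}"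
  define R where "R = {(u, v). {u, v} \<in> F}"
  define W where "W = {w. (y, w) \<in> R\<^sup>*}"
  have "w \<in> V - \<Union>K" if "(y, w) \<in> R\<^sup>*" for w
    using that by (induction rule: rtrancl_induct) (use y edge_subset in \<open>auto simp: R_def F_def\<close>)
  then have WV: "W \<subseteq> V" "W \<inter> \<Union>K = {}" by (auto simp: W_def)
  have W0: "W \<noteq> {}" by (auto simp: W_def)
  have KV: "\<Union>K \<subseteq> V" using K(2) edge_subset by blast
  \<comment> \<open>Forbidding the attachment already found gives a second one. An edge leaving
    \<open>W\<close> ends on the cycle, since any other end would itself belong to
    \<open>W\<close>.\<close>
  have exit: "\<exists>w\<in>W. \<exists>c\<in>\<Union>K. c \<noteq> a \<and> {w, c} \<in> E" if a: "a \<in> \<Union>K" for a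
  proof -
    have "\<exists>z. z \<in> \<Union>K \<and> z \<noteq> a"
    proof (rule ccontr)
      assume "\<not> ?thesis"
      then have "\<Union>K \<subseteq> {a}" by blast
      then have "card (\<Union>K) \<le> 1" using card_mono[of "{a}" "\<Union>K"] by simp
      then show False using cycle_edges_card_Union[OF K(1)] by simp
    qed
    then obtain z where z: "z \<in> \<Union>K" "z \<noteq> a" by blast
    obtain w c where wc: "w \<in> W" "c \<in> V - W" "c \<noteq> a" "{w, c} \<in> E"
      using nonseparating[OF WV(1) W0, of a z] a z WV KV by blast
    have "c \<in> \<Union>K"
    proof (rule ccontr)
      assume "c \<notin> \<Union>K"
      then have "(w, c) \<in> R" using wc WV by (auto simp: R_def F_def)
      then have "c \<in> W" using wc(1) by (auto simp: W_def intro: rtrancl_into_rtrancl)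
      then show False using wc by simp
    qed
    with wc show ?thesis by blast
  qed
  obtain a0 where "a0 \<in> \<Union>K"
    using cycle_edges_card_Union[OF K(1)] by (metis card.empty equals0I not_numeral_le_zero)
  then obtain w1 a where a: "w1 \<in> W" "a \<in> \<Union>K" "{w1, a} \<in> E" using exit by blast
  then obtain w2 b where b: "w2 \<in> W" "b \<in> \<Union>K" "b \<noteq> a" "{w2, b} \<in> E" using exit[of a] by blast
  have "sym R" unfolding R_def sym_def by (auto simp: insert_commute)
  then have "(w1, y) \<in> R\<^sup>*" using a(1) symD[OF sym_rtrancl] by (simp add: W_def)
  then have "(w1, w2) \<in> R\<^sup>*" using b(1) by (auto simp: W_def)
  then obtain q where q: "path_betw w1 q w2" "path_edges q \<subseteq> F"
    unfolding R_def by (rule rtrancl_path_betw)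
  have qK: "set q \<inter> \<Union>K = {}"
    by (rule path_set_avoid[OF q]) (use a WV in \<open>auto simp: F_def\<close>)
  have qW: "e \<subseteq> W" if "e \<in> path_edges q" for e
  proof -
    have "\<forall>x\<in>set q. x \<in> W" if "path_edges q \<subseteq> F" "q \<noteq> []" "hd q \<in> W" for q
      using that
    proof (induction q rule: path_edges.induct)
      case (1 c d xs)
      have "(c, d) \<in> R" using "1.prems"(1) by (simp add: R_def)
      moreover have "(y, c) \<in> R\<^sup>*" using "1.prems"(3) by (simp add: W_def)
      ultimately have dW: "d \<in> W" unfolding W_def by (simp add: rtrancl_into_rtrancl)
      have "\<forall>x\<in>set (d # xs). x \<in> W"
        by (rule "1.IH") (use "1.prems" dW in simp_all)
      then show ?case using "1.prems"(3) by simp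
    qed auto
    then have "set q \<subseteq> W" using q a(1) by (auto simp: path_betw_def)
    then show ?thesis using path_edges_subset[OF that] by blast
  qed
  define P where "P = a # q @ [b]"
  obtain qs where qs: "q = w1 # qs" using q(1) by (auto simp: path_betw_def neq_Nil_conv)
  obtain rs where rs: "q = rs @ [w2]"
    using q(1) by (metis append_butlast_last_id path_betw_def)
  have PE: "path_edges P = insert {w1, a} (insert {w2, b} (path_edges q))"
  proof -
    have "path_edges P = insert {a, w1} (path_edges (q @ [b]))" by (simp add: P_def qs)
    also have "path_edges (q @ [b]) = insert {w2, b} (path_edges q)"
      using path_edges_snoc[of rs w2 b] by (simp add: rs)
    finally show ?thesis by (simp add: insert_commute)
  qed
  have qE: "path_edges q \<subseteq> E" using q(2) by (auto simp: F_def)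
  show thesis
  proof (rule that)
    show "path_betw a P b" using q(1) qK a b by (auto simp: P_def path_betw_def)
    show "a \<noteq> b" "a \<in> \<Union>K" "b \<in> \<Union>K" using a b by auto
    show "path_edges P \<subseteq> E" using PE qE a b by simp
    show "set P \<inter> \<Union>K = {a, b}" using qK a b by (auto simp: P_def)
    have touch: "\<exists>w\<in>e. w \<in> W" if eP: "e \<in> path_edges P" for e
    proof -
      consider "e = {w1, a}" | "e = {w2, b}" | "e \<in> path_edges q" using PE eP by auto
      then show ?thesis
      proof cases
        case 3
        then obtain x y where "e = {x, y}" using path_edges_pair q(1) by (metis path_betw_def)
        then show ?thesis using qW[OF 3] by auto
      qed (use a b in auto)
    qed
    then show "path_edges P \<inter> K = {}" using WV(2) by blast
    show "\<exists>w\<in>e. (y, w) \<in> {(u, v). {u, v} \<in> {e \<in> E. e \<inter> \<Union>K = {}}}\<^sup>*" if "e \<in> path_edges P" for e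
      using touch[OF that] by (auto simp: W_def R_def F_def)
  qed
qed

end

section \<open>Faces of a plane cubic graph\<close>

locale plane_cubic_graph = cubic_graph V E for V :: "'a set" and E +
  fixes pos :: "'a \<Rightarrow> complex" and img :: "'a set \<Rightarrow> complex set"
  assumes inj_pos: "inj_on pos V"
    and edge_arc: "{u, v} \<in> E \<Longrightarrow>
      \<exists>g. arc g \<and> path_image g = img {u, v} \<and> pathstart g = pos u \<and> pathfinish g = pos v"
    and img_vertices: "e \<in> E \<Longrightarrow> img e \<inter> pos ` V = pos ` e"
    and img_inter: "\<lbrakk>e \<in> E; e' \<in> E; e \<noteq> e'\<rbrakk> \<Longrightarrow> img e \<inter> img e' \<subseteq> pos ` V"
begin

definition drawing :: "'a set set \<Rightarrow> complex set" where
  "drawing K = \<Union> (img ` K)"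

definition open_edge :: "'a set \<Rightarrow> complex set" where
  "open_edge e = img e - pos ` e"

text \<open>Open edges, because an edge drawn inside a side may have its ends on the bounding
  cycle.\<close>

definition edges_in :: "complex set \<Rightarrow> 'a set set" where
  "edges_in S = {e \<in> E. open_edge e \<subseteq> S}"

definition verts_in :: "complex set \<Rightarrow> 'a set" where
  "verts_in S = {v \<in> V. pos v \<in> S}"

definition faces_in :: "complex set \<Rightarrow> complex set set" where
  "faces_in S = {R \<in> components (- drawing E). R \<subseteq> S}"

definition bdry :: "complex set \<Rightarrow> 'a set set" where
  "bdry R = {e \<in> E. img e \<subseteq> frontier R}"

section \<open>Intersections of drawn subgraphs, and Jordan curves from cycles\<close>

lemma drawing_inter:
  assumes "K \<subseteq> E" "L \<subseteq> E" "K \<inter> L = {}"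
  shows "drawing K \<inter> drawing L \<subseteq> pos ` (\<Union>K \<inter> \<Union>L)"
proof
  fix z assume "z \<in> drawing K \<inter> drawing L"
  then obtain e f where ef: "e \<in> K" "f \<in> L" "z \<in> img e" "z \<in> img f" by (auto simp: drawing_def)
  then have E: "e \<in> E" "f \<in> E" "e \<noteq> f" using assms by auto
  then have "z \<in> pos ` V" using img_inter ef by blast
  then have "z \<in> pos ` e" "z \<in> pos ` f" using img_vertices E ef by blast+
  then obtain x y where "x \<in> e" "y \<in> f" "z = pos x" "z = pos y" by blast
  moreover have "x = y" using inj_onD[OF inj_pos, of x y] calculation edge_subset E by auto
  ultimately show "z \<in> pos ` (\<Union>K \<inter> \<Union>L)" using ef by blast
qed

lemma drawing_vertex:
  assumes "K \<subseteq> E" "v \<in> V"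
  shows "pos v \<in> drawing K \<longleftrightarrow> v \<in> \<Union>K"
proof
  assume "pos v \<in> drawing K"
  then obtain e where e: "e \<in> K" "pos v \<in> img e" by (auto simp: drawing_def)
  then have "pos v \<in> pos ` e" using img_vertices assms by blast
  then obtain x where "x \<in> e" "pos v = pos x" by blast
  then have "v = x" using inj_onD[OF inj_pos, of v x] edge_subset assms e by auto
  with \<open>x \<in> e\<close> e show "v \<in> \<Union>K" by blast
next
  assume "v \<in> \<Union>K"
  then obtain e where e: "e \<in> K" "v \<in> e" by blast
  then have "pos v \<in> img e" using img_vertices[of e] assms by blast
  with e show "pos v \<in> drawing K" by (auto simp: drawing_def)
qed

lemma open_edge_props:
  assumes e: "e \<in> E"
  shows "conn (open_edge e)" "open_edge e \<noteq> {}" "img e \<subseteq> closure (open_edge e)"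
proof -
  obtain u v where uv: "e = {u, v}" using edge_pair[OF e] by blast
  obtain g where g: "arc g" "path_image g = img e" "pathstart g = pos u" "pathfinish g = pos v"
    using edge_arc e uv by blast
  have "open_edge e = path_image g - {pathstart g, pathfinish g}"
    by (simp add: open_edge_def uv g)
  then show "conn (open_edge e)" "open_edge e \<noteq> {}" "img e \<subseteq> closure (open_edge e)"
    using connected_simple_path_endless[of g] nonempty_simple_path_endless[of g]
      arc_imp_simple_path[OF g(1)] arc_subset_closure_endless[OF g(1)] g(2) by auto
qed

lemma open_edge_disjoint:
  assumes "e \<in> E" "K \<subseteq> E" "e \<notin> K"
  shows "open_edge e \<inter> drawing K = {}"
proof -
  have "drawing {e} \<inter> drawing K \<subseteq> pos ` (\<Union>{e} \<inter> \<Union>K)"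
    using assms by (intro drawing_inter) auto
  then show ?thesis by (auto simp: open_edge_def drawing_def)
qed

lemma path_arc:
  assumes "path_betw a q b" "a \<noteq> b" "path_edges q \<subseteq> E"
  shows "\<exists>g. arc g \<and> path_image g = drawing (path_edges q) \<and> pathstart g = pos a \<and> pathfinish g = pos b"
  using assms
proof (induction q arbitrary: a rule: path_edges.induct)
  case (1 x y xs)
  have a: "a = x" and xE: "{x, y} \<in> E" using 1 by (auto simp: path_betw_def)
  obtain g where g: "arc g" "path_image g = img {x, y}" "pathstart g = pos x" "pathfinish g = pos y"
    using edge_arc[OF xE] by blast
  show ?case
  proof (cases xs)
    case Nil
    then have "b = y" using 1 by (auto simp: path_betw_def)
    then show ?thesis using g a Nil by (intro exI[of _ g]) (auto simp: drawing_def)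
  next
    case (Cons z zs)
    have "b \<in> set xs" using "1.prems"(1) Cons by (auto simp: path_betw_def)
    then have pb: "path_betw y (y # xs) b" "y \<noteq> b" "path_edges (y # xs) \<subseteq> E"
      using "1.prems" by (auto simp: path_betw_def)
    then obtain h where h: "arc h" "path_image h = drawing (path_edges (y # xs))"
      "pathstart h = pos y" "pathfinish h = pos b" using 1(1) by blast
    have xn: "x \<notin> set (y # xs)" using 1 by (auto simp: path_betw_def)
    then have "{x, y} \<notin> path_edges (y # xs)" using path_edges_subset by blast
    then have "drawing {{x, y}} \<inter> drawing (path_edges (y # xs))
        \<subseteq> pos ` (\<Union>{{x, y}} \<inter> \<Union>(path_edges (y # xs)))"
      using xE pb by (intro drawing_inter) auto
    also have "\<Union>(path_edges (y # xs)) = set (y # xs)" using Cons by (intro Union_path_edges) simp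
    also have "\<Union>{{x, y}} \<inter> set (y # xs) = {y}" using xn by auto
    finally have "path_image g \<inter> path_image h \<subseteq> {pathstart h}"
      using g h by (auto simp: drawing_def)
    then have "arc (g +++ h)" using g h by (intro arc_join) auto
    moreover have "path_image (g +++ h) = drawing (path_edges (x # y # xs))"
      using g h by (simp add: path_image_join drawing_def)
    ultimately show ?thesis using g h a by (intro exI[of _ "g +++ h"]) auto
  qed
qed (auto simp: path_betw_def)

lemma path_drawing_inter:
  assumes q: "path_betw a q b" and r: "path_betw a r b" and ne: "a \<noteq> b"
    and E: "path_edges q \<subseteq> E" "path_edges r \<subseteq> E"
    and dj: "path_edges q \<inter> path_edges r = {}" and int: "set q \<inter> set r = {a, b}"
  shows "drawing (path_edges q) \<inter> drawing (path_edges r) = {pos a, pos b}"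
proof
  note U = Union_path_edges[OF path_betw_length2[OF q ne]] Union_path_edges[OF path_betw_length2[OF r ne]]
  show "drawing (path_edges q) \<inter> drawing (path_edges r) \<subseteq> {pos a, pos b}"
    using drawing_inter[OF E dj] unfolding U int by simp
  have ab: "a \<in> V" "b \<in> V" using path_betw_ends[OF q] U(1) E edge_subset by blast+
  then show "{pos a, pos b} \<subseteq> drawing (path_edges q) \<inter> drawing (path_edges r)"
    using drawing_vertex[OF E(1)] drawing_vertex[OF E(2)] U path_betw_ends[OF q] path_betw_ends[OF r]
    by simp
qed

lemma drawing_Un: "drawing (K \<union> L) = drawing K \<union> drawing L"
  by (auto simp: drawing_def)

lemma Jordan_paths:
  assumes q: "path_betw a q b" and r: "path_betw a r b" and ne: "a \<noteq> b"
    and E: "path_edges q \<subseteq> E" "path_edges r \<subseteq> E"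
    and dj: "path_edges q \<inter> path_edges r = {}" and int: "set q \<inter> set r = {a, b}"
  shows "Jordan_set (drawing (path_edges q) \<union> drawing (path_edges r))"
proof -
  obtain g where g: "arc g" "path_image g = drawing (path_edges q)" "pathstart g = pos a" "pathfinish g = pos b"
    using path_arc[OF q ne E(1)] by blast
  obtain h where h: "arc h" "path_image h = drawing (path_edges r)" "pathstart h = pos a" "pathfinish h = pos b"
    using path_arc[OF r ne E(2)] by blast
  show ?thesis using Jordan_set_arcs[OF g(1) h(1) g(3) h(3) g(4) h(4)] path_drawing_inter[OF assms] g(2) h(2)
    by simp
qed

lemma Jordan_cycle:
  assumes K: "cycle_edges K" "K \<subseteq> E"
  shows "Jordan_set (drawing K)"
proof -
  obtain e where "e \<in> K" using cycle_edges_nonempty[OF K(1)] by auto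
  then obtain a b where "{a, b} \<in> K" "a \<noteq> b" using cycle_edges_pair[OF K(1)] by metis
  then obtain p q where "path_betw a p b" "path_betw a q b" "set p \<inter> set q = {a, b}" "a \<noteq> b"
    "K = path_edges p \<union> path_edges q" "path_edges p \<inter> path_edges q = {}"
    using cycle_edges_split[OF K(1)] by (metis UnionI insertI1 insertI2)
  then show ?thesis using Jordan_paths[of a p b q] K(2) by (simp add: drawing_Un)
qed

text \<open>Near \<open>pos v\<close> the open side contains points of the open edge, which is
  connected and avoids the cycle, so it cannot leave the side.\<close>

lemma edge_in_side:
  assumes K: "cycle_edges K" "K \<subseteq> E" and S: "S \<in> components (- drawing K)"
    and e: "e \<in> E" "e \<notin> K" and v: "v \<in> e" "pos v \<in> S"
  shows "e \<in> edges_in S"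
proof -
  note J = Jordan_set_side[OF Jordan_cycle[OF K] S]
  have "pos v \<in> img e" using img_vertices[OF e(1)] v by blast
  then have "pos v \<in> closure (open_edge e)" using open_edge_props(3)[OF e(1)] by blast
  then have "open_edge e \<inter> S \<noteq> {}"
    using J(1) v(2) closure_iff_nhds_not_empty by blast
  then have "open_edge e \<subseteq> S"
    using conn_in_component[OF open_edge_props(1)[OF e(1)] _ S] open_edge_disjoint[OF e(1) K(2) e(2)] by blast
  then show ?thesis using e by (simp add: edges_in_def)
qed

lemma edges_in_disjoint:
  assumes K: "K \<subseteq> E" and S: "S \<inter> drawing K = {}"
  shows "edges_in S \<inter> K = {}"
proof -
  have "False" if "e \<in> K" "open_edge e \<subseteq> S" for e
  proof -
    have "open_edge e \<subseteq> drawing K" using that by (auto simp: open_edge_def drawing_def)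
    then have "open_edge e = {}" using that S by blast
    then show False using open_edge_props(2) K that by blast
  qed
  then show ?thesis by (auto simp: edges_in_def)
qed

text \<open>An edge in \<open>S\<close> with both ends on the cycle is itself an ear. Otherwise an
  end off the cycle is drawn in \<open>S\<close>, everything reachable from it off the cycle is
  drawn in \<open>S\<close> as well, and the ear through that component stays there.\<close>

lemma ear_in_side:
  assumes K: "cycle_edges K" "K \<subseteq> E" and S: "S \<in> components (- drawing K)"
    and ne: "edges_in S \<noteq> {}"
  obtains a P b where "path_betw a P b" "a \<noteq> b" "a \<in> \<Union>K" "b \<in> \<Union>K"
    "set P \<inter> \<Union>K = {a, b}" "path_edges P \<inter> K = {}" "path_edges P \<subseteq> edges_in S"
proof -
  note J = Jordan_set_side[OF Jordan_cycle[OF K] S]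
  obtain e where e: "e \<in> edges_in S" using ne by auto
  have eE: "e \<in> E" "open_edge e \<subseteq> S" using e by (auto simp: edges_in_def)
  have eK: "e \<notin> K" using edges_in_disjoint[OF K(2) J(5)] e by blast
  obtain x y where xy: "e = {x, y}" "x \<noteq> y" using edge_pair[OF eE(1)] by blast
  show thesis
  proof (cases "e \<subseteq> \<Union>K")
    case True
    show thesis
    proof (rule that)
      show "path_betw x [x, y] y" using xy by (simp add: path_betw_def)
      show "set [x, y] \<inter> \<Union>K = {x, y}" using True xy by auto
      show "path_edges [x, y] \<inter> K = {}" "path_edges [x, y] \<subseteq> edges_in S" using xy eK e by auto
    qed (use True xy in auto)
  next
    case False
    then obtain v where v: "v \<in> e" "v \<notin> \<Union>K" by blast
    then have vV: "v \<in> V" using edge_subset eE by blast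
    have "pos v \<in> img e" using img_vertices[OF eE(1)] v by blast
    then have "pos v \<in> closure (open_edge e)" using open_edge_props(3)[OF eE(1)] by blast
    then have "pos v \<in> closure S" using eE(2) closure_mono by blast
    then have "pos v \<in> S \<union> drawing K" using J(3) by (metis closure_Un_frontier)
    then have vS: "pos v \<in> S" using drawing_vertex[OF K(2) vV] v by blast
    have reach: "pos w \<in> S \<and> w \<in> V" if "(v, w) \<in> {(u, v). {u, v} \<in> {e \<in> E. e \<inter> \<Union>K = {}}}\<^sup>*" for w
      using that
    proof (induction rule: rtrancl_induct)
      case base
      show ?case using vS vV by simp
    next
      case (step u w)
      then have f: "{u, w} \<in> E" "{u, w} \<inter> \<Union>K = {}" by auto
      then have fK: "{u, w} \<notin> K" by blast
      have "{u, w} \<in> edges_in S" using edge_in_side[OF K S f(1) fK, of u] step by simp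
      then have sub: "open_edge {u, w} \<subseteq> S" by (simp add: edges_in_def)
      have wV: "w \<in> V" using edge_subset[OF f(1)] by simp
      have "pos w \<in> img {u, w}" using img_vertices[OF f(1)] by blast
      then have "pos w \<in> closure S" using open_edge_props(3)[OF f(1)] closure_mono[OF sub] by blast
      then have "pos w \<in> S \<union> drawing K" using J(3) by (metis closure_Un_frontier)
      then show ?case using drawing_vertex[OF K(2) wV] f wV by blast
    qed
    obtain a P b where P: "path_betw a P b" "a \<noteq> b" "a \<in> \<Union>K" "b \<in> \<Union>K" "path_edges P \<subseteq> E"
      "set P \<inter> \<Union>K = {a, b}" "path_edges P \<inter> K = {}"
      "\<And>e. e \<in> path_edges P \<Longrightarrow>
         \<exists>w\<in>e. (v, w) \<in> {(u, v). {u, v} \<in> {e \<in> E. e \<inter> \<Union>K = {}}}\<^sup>*"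
      using ear_exists[OF K, of v] vV v(2) by (metis (no_types, lifting) DiffI)
    have "path_edges P \<subseteq> edges_in S"
    proof
      fix f assume f: "f \<in> path_edges P"
      then obtain w where "w \<in> f" "pos w \<in> S" using P(8) reach by blast
      then show "f \<in> edges_in S" using edge_in_side[OF K S] f P(5,7) by blast
    qed
    with that P show thesis by blast
  qed
qed

text \<open>The cardinality equation is Euler's formula for one side of the cycle \<open>K\<close>.\<close>

definition facial :: "'a set set \<Rightarrow> complex set \<Rightarrow> bool" where
  "facial K S \<longleftrightarrow> finite (faces_in S) \<and>
     card (faces_in S) + card (verts_in S) = 1 + card (edges_in S) \<and>
     (\<forall>R \<in> faces_in S. cycle_edges (bdry R)) \<and>
     (\<forall>e \<in> E. card {R \<in> faces_in S. e \<in> bdry R} =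
        (if e \<in> K then 1 else if e \<in> edges_in S then 2 else 0))"

lemma finite_in [simp]: "finite (edges_in S)" "finite (verts_in S)"
  using finite_E finite_V by (auto simp: edges_in_def verts_in_def)

text \<open>A vertex drawn in \<open>S\<close> would bring an incident edge along, so the side
  contains no part of the drawing and is one single face bounded by \<open>K\<close>.\<close>

lemma facial_empty:
  assumes K: "cycle_edges K" "K \<subseteq> E" and S: "S \<in> components (- drawing K)"
    and empty: "edges_in S = {}"
  shows "facial K S"
proof -
  note J = Jordan_set_side[OF Jordan_cycle[OF K] S]
  have V0: "verts_in S = {}"
  proof (rule ccontr)
    assume "verts_in S \<noteq> {}"
    then obtain v where v: "v \<in> V" "pos v \<in> S" by (auto simp: verts_in_def)
    then have vK: "v \<notin> \<Union>K" using drawing_vertex[OF K(2)] J(5) by blast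
    have "{e \<in> E. v \<in> e} \<noteq> {}" using degree3[OF v(1)] by (metis card.empty zero_neq_numeral)
    then obtain e where e: "e \<in> E" "v \<in> e" by blast
    then have "e \<in> edges_in S" using edge_in_side[OF K S _ _ _ v(2)] vK by blast
    then show False using empty by simp
  qed
  have SD: "S \<subseteq> - drawing E"
  proof
    fix z assume z: "z \<in> S"
    show "z \<in> - drawing E"
    proof
      assume "z \<in> drawing E"
      then obtain e where e: "e \<in> E" "z \<in> img e" by (auto simp: drawing_def)
      have eK: "e \<notin> K" using e z J(5) by (auto simp: drawing_def)
      have "e \<in> edges_in S"
      proof (cases "z \<in> pos ` e")
        case True
        then show ?thesis using edge_in_side[OF K S e(1) eK] z by blast
      next
        case False
        then have "open_edge e \<inter> S \<noteq> {}" using e z by (auto simp: open_edge_def)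
        then have "open_edge e \<subseteq> S"
          using conn_in_component[OF open_edge_props(1)[OF e(1)] _ S] open_edge_disjoint[OF e(1) K(2) eK]
          by blast
        then show ?thesis using e by (simp add: edges_in_def)
      qed
      then show False using empty by simp
    qed
  qed
  have DK: "- drawing E \<subseteq> - drawing K" using K(2) by (auto simp: drawing_def)
  have comp: "S \<in> components (- drawing E)"
    unfolding in_components_maximal
  proof (intro conjI allI impI)
    show "S \<noteq> {}" "S \<subseteq> - drawing E" "conn S" using J SD by auto
    fix d assume d: "d \<noteq> {} \<and> S \<subseteq> d \<and> d \<subseteq> - drawing E \<and> conn d"
    then have "d \<subseteq> S" using conn_in_component[of d "- drawing K" S] S DK J(4) by blast
    then show "d = S" using d by blast
  qed
  have F: "faces_in S = {S}"
  proof -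
    have "R = S" if R: "R \<in> components (- drawing E)" "R \<subseteq> S" for R
      using components_nonoverlap[OF R(1) comp] in_components_nonempty[OF R(1)] R(2) by blast
    then show ?thesis using comp by (auto simp: faces_in_def)
  qed
  have "bdry S = K"
  proof -
    have "e \<in> K" if e: "e \<in> E" "img e \<subseteq> drawing K" for e
    proof (rule ccontr)
      assume "e \<notin> K"
      then have "open_edge e \<inter> drawing K = {}" using open_edge_disjoint e K by blast
      then have "open_edge e = {}" using e by (auto simp: open_edge_def)
      then show False using open_edge_props(2)[OF e(1)] by simp
    qed
    then show ?thesis using K(2) unfolding bdry_def J(3) by (auto simp: drawing_def)
  qed
  moreover have "{R \<in> {S}. e \<in> bdry R} = (if e \<in> bdry S then {S} else {})" for e by auto
  ultimately show ?thesis unfolding facial_def F V0 empty using K(1) by simp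
qed

text \<open>The theta lemma splits \<open>S\<close> along an ear. The ear has one edge more than
  inner vertices, which turns the sum of the two Euler equations, with constant 1 + 1, into one with
  constant 1. The last conclusion is an implication so that the induction can supply its premises
  for the smaller sides.\<close>

lemma facial_split:
  assumes K: "cycle_edges K" "K \<subseteq> E" and S: "S \<in> components (- drawing K)"
    and ne: "edges_in S \<noteq> {}"
  obtains K1 K2 D1 D2 where
    "cycle_edges K1" "K1 \<subseteq> E" "cycle_edges K2" "K2 \<subseteq> E"
    "D1 \<in> components (- drawing K1)" "D2 \<in> components (- drawing K2)"
    "edges_in D1 \<subset> edges_in S" "edges_in D2 \<subset> edges_in S"
    "facial K1 D1 \<Longrightarrow> facial K2 D2 \<Longrightarrow> facial K S"
proof -
  note J = Jordan_set_side[OF Jordan_cycle[OF K] S]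
  obtain a P b where P: "path_betw a P b" "a \<noteq> b" "a \<in> \<Union>K" "b \<in> \<Union>K"
    "set P \<inter> \<Union>K = {a, b}" "path_edges P \<inter> K = {}" "path_edges P \<subseteq> edges_in S"
    using ear_in_side[OF assms] by metis
  obtain p q where pq: "path_betw a p b" "path_betw a q b" "set p \<inter> set q = {a, b}"
    "K = path_edges p \<union> path_edges q" "path_edges p \<inter> path_edges q = {}"
    using cycle_edges_split[OF K(1) P(3,4,2)] by metis
  have PE: "path_edges P \<subseteq> E" and pE: "path_edges p \<subseteq> E" and qE: "path_edges q \<subseteq> E"
    using P(7) pq(4) K(2) by (auto simp: edges_in_def)
  note U = Union_path_edges[OF path_betw_length2[OF pq(1) P(2)]]
    Union_path_edges[OF path_betw_length2[OF pq(2) P(2)]]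
    Union_path_edges[OF path_betw_length2[OF P(1,2)]]
  have UK: "\<Union>K = set p \<union> set q" using pq(4) U by simp
  have ipP: "set p \<inter> set P = {a, b}" and iqP: "set q \<inter> set P = {a, b}"
    using P(5) UK path_betw_ends[OF pq(1)] path_betw_ends[OF pq(2)] path_betw_ends[OF P(1)] by blast+
  have dp: "path_edges p \<inter> path_edges P = {}" and dq: "path_edges q \<inter> path_edges P = {}"
    using P(6) pq(4) by auto
  define K1 where "K1 = path_edges p \<union> path_edges P"
  define K2 where "K2 = path_edges q \<union> path_edges P"
  have K1: "cycle_edges K1" "K1 \<subseteq> E" and K2: "cycle_edges K2" "K2 \<subseteq> E"
    unfolding K1_def K2_def
    using cycle_edges_disjoint_betwI[OF pq(1) P(1,2) ipP dp] cycle_edges_disjoint_betwI[OF pq(2) P(1,2) iqP dq]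
      PE pE qE by auto
  obtain gp where gp: "arc gp" "path_image gp = drawing (path_edges p)" "pathstart gp = pos a" "pathfinish gp = pos b"
    using path_arc[OF pq(1) P(2) pE] by blast
  obtain gq where gq: "arc gq" "path_image gq = drawing (path_edges q)" "pathstart gq = pos a" "pathfinish gq = pos b"
    using path_arc[OF pq(2) P(2) qE] by blast
  obtain gP where gP: "arc gP" "path_image gP = drawing (path_edges P)" "pathstart gP = pos a" "pathfinish gP = pos b"
    using path_arc[OF P(1,2) PE] by blast
  have dKq: "drawing K = drawing (path_edges p) \<union> drawing (path_edges q)"
    using pq(4) by (simp add: drawing_Un)
  \<comment> \<open>The ear without its ends is connected and off \<open>K\<close>; one of its open
    edges lies in \<open>S\<close>, so all of it does.\<close>
  have PS: "drawing (path_edges P) - {pos a, pos b} \<subseteq> S"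
  proof (rule conn_in_component[OF _ _ S])
    show "conn (drawing (path_edges P) - {pos a, pos b})"
      using connected_simple_path_endless[OF arc_imp_simple_path[OF gP(1)]] gP by simp
    have "drawing (path_edges P) \<inter> drawing K \<subseteq> pos ` (\<Union>(path_edges P) \<inter> \<Union>K)"
      by (rule drawing_inter[OF PE K(2) P(6)])
    then show "drawing (path_edges P) - {pos a, pos b} \<subseteq> - drawing K"
      unfolding U(3) P(5) by auto
    obtain e where e: "e \<in> path_edges P"
      using U(3) path_betw_ends[OF P(1)] by blast
    have "open_edge e \<subseteq> S" "e \<in> E" using e P(7) by (auto simp: edges_in_def)
    moreover obtain z where z: "z \<in> open_edge e" using open_edge_props(2) calculation by blast
    moreover have "z \<in> drawing (path_edges P)" using e z by (auto simp: drawing_def open_edge_def)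
    moreover have "z \<noteq> pos a" "z \<noteq> pos b"
    proof -
      have "pos a \<in> drawing K" "pos b \<in> drawing K"
        using drawing_vertex[OF K(2)] P(3,4) K(2) edge_subset by blast+
      then show "z \<noteq> pos a" "z \<noteq> pos b" using z calculation(1) J(5) by auto
    qed
    ultimately show "(drawing (path_edges P) - {pos a, pos b}) \<inter> S \<noteq> {}" by blast
  qed
  obtain D1 D2 where D1: "D1 \<in> components (- (drawing (path_edges p) \<union> drawing (path_edges P)))"
    and D2: "D2 \<in> components (- (drawing (path_edges q) \<union> drawing (path_edges P)))"
    and D12: "D1 \<inter> D2 = {}" "S = D1 \<union> D2 \<union> (drawing (path_edges P) - {pos a, pos b})"
  proof (rule theta_sides)
    show "Jordan_set (drawing (path_edges p) \<union> drawing (path_edges q))"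
      "Jordan_set (drawing (path_edges p) \<union> drawing (path_edges P))"
      "Jordan_set (drawing (path_edges q) \<union> drawing (path_edges P))"
      using Jordan_paths[OF pq(1,2) P(2) pE qE pq(5,3)] Jordan_paths[OF pq(1) P(1,2) pE PE dp ipP]
        Jordan_paths[OF pq(2) P(1,2) qE PE dq iqP] by auto
    show "compact (drawing (path_edges p))" "compact (drawing (path_edges q))" "compact (drawing (path_edges P))"
      "conn (drawing (path_edges P))"
      using gp gq gP by (metis compact_arc_image connected_arc_image)+
    show "drawing (path_edges p) \<inter> drawing (path_edges q) = {pos a, pos b}"
      "drawing (path_edges p) \<inter> drawing (path_edges P) = {pos a, pos b}"
      "drawing (path_edges q) \<inter> drawing (path_edges P) = {pos a, pos b}"
      using path_drawing_inter[OF pq(1,2) P(2) pE qE pq(5,3)] path_drawing_inter[OF pq(1) P(1,2) pE PE dp ipP]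
        path_drawing_inter[OF pq(2) P(1,2) qE PE dq iqP] by auto
    show "drawing (path_edges p) - {pos a, pos b} \<noteq> {}"
      using nonempty_simple_path_endless[OF arc_imp_simple_path[OF gp(1)]] gp by simp
    show "S \<in> components (- (drawing (path_edges p) \<union> drawing (path_edges q)))"
      using S dKq by simp
  qed (use PS in auto)
  have D1': "D1 \<in> components (- drawing K1)" and D2': "D2 \<in> components (- drawing K2)"
    using D1 D2 by (simp_all add: K1_def K2_def drawing_Un)
  note J1 = Jordan_set_side[OF Jordan_cycle[OF K1] D1'] and J2 = Jordan_set_side[OF Jordan_cycle[OF K2] D2']
  have DP: "D1 \<inter> drawing (path_edges P) = {}" "D2 \<inter> drawing (path_edges P) = {}"
    using J1(5) J2(5) by (auto simp: K1_def K2_def drawing_Un)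
  have DS: "D1 \<subseteq> S" "D2 \<subseteq> S" using D12(2) by auto
  have E_ne: "open_edge e \<noteq> {}" if "e \<in> E" for e using open_edge_props(2)[OF that] .
  \<comment> \<open>Removing the ear leaves two disjoint open pieces of \<open>S\<close>; faces, and
    open edges off the ear, therefore fall into one of them as a whole.\<close>
  have conn_split: "T \<subseteq> D1 \<or> T \<subseteq> D2" if "conn T" "T \<subseteq> S" "T \<inter> drawing (path_edges P) = {}" for T
  proof -
    have T: "T \<subseteq> D1 \<union> D2" using that D12(2) by blast
    show ?thesis
    proof (cases "T \<inter> D1 = {}")
      case False
      then show ?thesis using conn_subset_open[OF that(1) T J1(1) J2(1) D12(1)] by blast
    qed (use T in blast)
  qed
  have edges: "edges_in S = path_edges P \<union> edges_in D1 \<union> edges_in D2"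
  proof
    show "edges_in S \<subseteq> path_edges P \<union> edges_in D1 \<union> edges_in D2"
    proof
      fix e assume e: "e \<in> edges_in S"
      then have eE: "e \<in> E" "open_edge e \<subseteq> S" by (auto simp: edges_in_def)
      show "e \<in> path_edges P \<union> edges_in D1 \<union> edges_in D2"
      proof (cases "e \<in> path_edges P")
        case False
        then have "open_edge e \<subseteq> D1 \<or> open_edge e \<subseteq> D2"
          using conn_split[OF open_edge_props(1)[OF eE(1)] eE(2)] open_edge_disjoint[OF eE(1) PE] by blast
        then show ?thesis using eE by (auto simp: edges_in_def)
      qed simp
    qed
    show "path_edges P \<union> edges_in D1 \<union> edges_in D2 \<subseteq> edges_in S"
      using P(7) DS by (auto simp: edges_in_def)
  qed
  have edisj: "path_edges P \<inter> edges_in D1 = {}" "path_edges P \<inter> edges_in D2 = {}"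
    "edges_in D1 \<inter> edges_in D2 = {}" "edges_in S \<inter> K = {}"
    "edges_in D1 \<inter> K1 = {}" "edges_in D2 \<inter> K2 = {}"
  proof -
    show "path_edges P \<inter> edges_in D1 = {}" "path_edges P \<inter> edges_in D2 = {}"
      using edges_in_disjoint[OF PE DP(1)] edges_in_disjoint[OF PE DP(2)] by auto
    show "edges_in D1 \<inter> edges_in D2 = {}" using D12(1) E_ne by (fastforce simp: edges_in_def)
    show "edges_in S \<inter> K = {}" "edges_in D1 \<inter> K1 = {}" "edges_in D2 \<inter> K2 = {}"
      using edges_in_disjoint[OF K(2) J(5)] edges_in_disjoint[OF K1(2) J1(5)]
        edges_in_disjoint[OF K2(2) J2(5)] by auto
  qed
  have cE: "card (edges_in S) = card (path_edges P) + card (edges_in D1) + card (edges_in D2)"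
    unfolding edges using edisj by (subst card_Un_disjoint; simp add: Int_Un_distrib2)+
  have PV: "set P \<subseteq> V" using U(3) PE edge_subset by blast
  have verts: "verts_in S = (set P - {a, b}) \<union> verts_in D1 \<union> verts_in D2"
  proof -
    have "pos v \<in> drawing (path_edges P) \<longleftrightarrow> v \<in> set P" if "v \<in> V" for v
      using drawing_vertex[OF PE that] U(3) by simp
    moreover have "pos v = pos a \<longleftrightarrow> v = a" "pos v = pos b \<longleftrightarrow> v = b" if "v \<in> V" for v
      using inj_onD[OF inj_pos] that PV path_betw_ends[OF P(1)] by blast+
    ultimately show ?thesis using PV unfolding verts_in_def D12(2) by auto
  qed
  have vdisj: "(set P - {a, b}) \<inter> verts_in D1 = {}" "(set P - {a, b}) \<inter> verts_in D2 = {}"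
    "verts_in D1 \<inter> verts_in D2 = {}"
  proof -
    have "pos v \<in> drawing (path_edges P)" if "v \<in> set P" for v
      using drawing_vertex[OF PE, of v] U(3) PV that by blast
    then show "(set P - {a, b}) \<inter> verts_in D1 = {}" "(set P - {a, b}) \<inter> verts_in D2 = {}"
      "verts_in D1 \<inter> verts_in D2 = {}" using DP D12(1) by (auto simp: verts_in_def)
  qed
  have cV: "card (verts_in S) = card (set P - {a, b}) + card (verts_in D1) + card (verts_in D2)"
    unfolding verts using vdisj by (subst card_Un_disjoint; simp add: Int_Un_distrib2)+
  have dP: "distinct P" using P(1) by (simp add: path_betw_def)
  have cP: "card (path_edges P) = card (set P - {a, b}) + 1"
  proof -
    have "card (set P - {a, b}) = length P - 2"
      using card_Diff_subset[of "{a, b}" "set P"] path_betw_ends[OF P(1)] P(2) distinct_card[OF dP] by simp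
    then show ?thesis using card_path_edges[OF dP] path_betw_length2[OF P(1,2)] by simp
  qed
  have faces: "faces_in S = faces_in D1 \<union> faces_in D2"
  proof
    show "faces_in S \<subseteq> faces_in D1 \<union> faces_in D2"
    proof
      fix R assume R: "R \<in> faces_in S"
      then have "R \<inter> drawing E = {}" "conn R" "R \<subseteq> S"
        using in_components_subset in_components_connected by (auto simp: faces_in_def)
      moreover have "drawing (path_edges P) \<subseteq> drawing E" using PE by (auto simp: drawing_def)
      ultimately have "R \<subseteq> D1 \<or> R \<subseteq> D2" using conn_split by blast
      then show "R \<in> faces_in D1 \<union> faces_in D2" using R by (auto simp: faces_in_def)
    qed
    show "faces_in D1 \<union> faces_in D2 \<subseteq> faces_in S" using DS by (auto simp: faces_in_def)
  qed
  have fdisj: "faces_in D1 \<inter> faces_in D2 = {}"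
    using D12(1) in_components_nonempty by (fastforce simp: faces_in_def)
  show thesis
  proof (rule that[OF K1 K2 D1' D2'])
    obtain e where e: "e \<in> path_edges P" using U(3) path_betw_ends[OF P(1)] by blast
    show "edges_in D1 \<subset> edges_in S" "edges_in D2 \<subset> edges_in S"
      using e edges edisj(1,2) by blast+
    assume f1: "facial K1 D1" and f2: "facial K2 D2"
    have fin: "finite (faces_in D1)" "finite (faces_in D2)" using f1 f2 by (auto simp: facial_def)
    have cF: "card (faces_in S) = card (faces_in D1) + card (faces_in D2)"
      unfolding faces using card_Un_disjoint[OF fin fdisj] .
    have "card {R \<in> faces_in S. e \<in> bdry R} = (if e \<in> K then 1 else if e \<in> edges_in S then 2 else 0)"
      if e: "e \<in> E" for e
    proof -
      have "{R \<in> faces_in S. e \<in> bdry R} = {R \<in> faces_in D1. e \<in> bdry R} \<union> {R \<in> faces_in D2. e \<in> bdry R}"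
        using faces by blast
      then have c: "card {R \<in> faces_in S. e \<in> bdry R} =
          card {R \<in> faces_in D1. e \<in> bdry R} + card {R \<in> faces_in D2. e \<in> bdry R}"
        using card_Un_disjoint[of "{R \<in> faces_in D1. e \<in> bdry R}" "{R \<in> faces_in D2. e \<in> bdry R}"]
          fin fdisj by fastforce
      have c1: "card {R \<in> faces_in D1. e \<in> bdry R} = (if e \<in> K1 then 1 else if e \<in> edges_in D1 then 2 else 0)"
        and c2: "card {R \<in> faces_in D2. e \<in> bdry R} = (if e \<in> K2 then 1 else if e \<in> edges_in D2 then 2 else 0)"
        using f1 f2 e by (auto simp: facial_def)
      \<comment> \<open>An edge of \<open>K\<close> lies on just one of the two new cycles, whereas
        an edge of the ear lies on both and gets one face from each side.\<close>
      consider "e \<in> path_edges p" | "e \<in> path_edges q" | "e \<in> path_edges P"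
        | "e \<notin> path_edges p" "e \<notin> path_edges q" "e \<notin> path_edges P" by blast
      then show ?thesis
      proof cases
        case 1
        then have "e \<notin> K2" "e \<notin> edges_in D2" "e \<in> K1" "e \<in> K"
          using pq(4,5) dp edisj(4) edges by (auto simp: K1_def K2_def)
        then show ?thesis using c c1 c2 by simp
      next
        case 2
        then have "e \<notin> K1" "e \<notin> edges_in D1" "e \<in> K2" "e \<in> K"
          using pq(4,5) dq edisj(4) edges by (auto simp: K1_def K2_def)
        then show ?thesis using c c1 c2 by simp
      next
        case 3
        then have "e \<in> K1" "e \<in> K2" "e \<notin> K" "e \<in> edges_in S"
          using P(6) edges by (auto simp: K1_def K2_def)
        then show ?thesis using c c1 c2 by simp
      next
        case 4
        then have "e \<notin> K1" "e \<notin> K2" "e \<notin> K" "e \<in> edges_in S \<longleftrightarrow> e \<in> edges_in D1 \<or> e \<in> edges_in D2"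
          using pq(4) edges by (auto simp: K1_def K2_def)
        moreover have "\<not> (e \<in> edges_in D1 \<and> e \<in> edges_in D2)" using edisj(3) by blast
        ultimately show ?thesis using c c1 c2 by auto
      qed
    qed
    moreover have "card (faces_in S) + card (verts_in S) = 1 + card (edges_in S)"
      using cF cV cE cP f1 f2 by (simp add: facial_def)
    moreover have "\<forall>R \<in> faces_in S. cycle_edges (bdry R)"
      using f1 f2 faces by (auto simp: facial_def)
    ultimately show "facial K S" unfolding facial_def using fin faces by simp
  qed
qed

text \<open>Induction on the number of edges drawn in the side; every split uses up the edges of an
  ear.\<close>

lemma facial:
  assumes "cycle_edges K" "K \<subseteq> E" "S \<in> components (- drawing K)"
  shows "facial K S"
  using assms
proof (induction "card (edges_in S)" arbitrary: K S rule: less_induct)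
  case less
  show ?case
  proof (cases "edges_in S = {}")
    case True
    then show ?thesis using facial_empty less.prems by blast
  next
    case False
    show ?thesis
    proof (rule facial_split[OF less.prems False])
      fix K1 K2 D1 D2
      assume h: "cycle_edges K1" "K1 \<subseteq> E" "cycle_edges K2" "K2 \<subseteq> E"
        "D1 \<in> components (- drawing K1)" "D2 \<in> components (- drawing K2)"
        "edges_in D1 \<subset> edges_in S" "edges_in D2 \<subset> edges_in S"
        "facial K1 D1 \<Longrightarrow> facial K2 D2 \<Longrightarrow> facial K S"
      have "card (edges_in D1) < card (edges_in S)" "card (edges_in D2) < card (edges_in S)"
        using h(7,8) by (auto intro: psubset_card_mono)
      then show "facial K S" using less.hyps h by blast
    qed
  qed
qed

text \<open>Adding the Euler equations of both sides of one cycle, which has as many vertices as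
  edges, gives Euler's formula. For the last claim take the faces on one side of \<open>Z\<close>:
  an edge lies on 1 of them if it is in \<open>Z\<close> and on 0 or 2 otherwise, so the count 1
  expresses membership in the sum modulo 2.\<close>

theorem facial_cycles:
  obtains \<Phi> :: "complex set set" and bd where "finite \<Phi>" "card \<Phi> + card V = card E + 2"
    "\<And>R. R \<in> \<Phi> \<Longrightarrow> cycle_edges (bd R) \<and> bd R \<subseteq> E"
    "\<And>e. e \<in> E \<Longrightarrow> card {R \<in> \<Phi>. e \<in> bd R} = 2"
    "\<And>Z. \<lbrakk>cycle_edges Z; Z \<subseteq> E\<rbrakk> \<Longrightarrow> \<exists>S \<subseteq> \<Phi>. \<forall>e \<in> E. e \<in> Z \<longleftrightarrow> card {R \<in> S. e \<in> bd R} = 1"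
proof -
  define \<Phi> where "\<Phi> = components (- drawing E)"
  have bdE: "bdry R \<subseteq> E" for R by (auto simp: bdry_def)
  \<comment> \<open>Stated for every cycle: one instance yields the counts, the general form yields
    the sums of faces.\<close>
  have split: "\<exists>S S'. facial Z S \<and> facial Z S' \<and> \<Phi> = faces_in S \<union> faces_in S' \<and>
      faces_in S \<inter> faces_in S' = {} \<and> E = Z \<union> edges_in S \<union> edges_in S' \<and>
      (Z \<union> edges_in S) \<inter> edges_in S' = {} \<and> Z \<inter> edges_in S = {} \<and>
      V = \<Union>Z \<union> verts_in S \<union> verts_in S' \<and>
      (\<Union>Z \<union> verts_in S) \<inter> verts_in S' = {} \<and> \<Union>Z \<inter> verts_in S = {}"
    if Z: "cycle_edges Z" "Z \<subseteq> E" for Z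
  proof -
    obtain S S' where S: "components (- drawing Z) = {S, S'}" "S \<inter> S' = {}" "S \<union> S' = - drawing Z"
      "open S" "open S'"
      using Jordan_set_components[OF Jordan_cycle[OF Z]] by metis
    have SS': "S \<in> components (- drawing Z)" "S' \<in> components (- drawing Z)" using S(1) by auto
    have cs: "T \<subseteq> S \<or> T \<subseteq> S'" if "conn T" "T \<inter> drawing Z = {}" for T
    proof (cases "T \<inter> S = {}")
      case True
      then show ?thesis using that S(3) by blast
    next
      case False
      then show ?thesis using conn_subset_open[OF that(1) _ S(4,5,2)] that(2) S(3) by blast
    qed
    have "R \<subseteq> S \<or> R \<subseteq> S'" if R: "R \<in> \<Phi>" for R
    proof (rule cs)
      show "conn R" using R in_components_connected by (auto simp: \<Phi>_def)
      have "R \<subseteq> - drawing E" using R in_components_subset by (auto simp: \<Phi>_def)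
      then show "R \<inter> drawing Z = {}" using Z(2) by (auto simp: drawing_def)
    qed
    then have F: "\<Phi> = faces_in S \<union> faces_in S'" by (auto simp: faces_in_def \<Phi>_def)
    have F0: "faces_in S \<inter> faces_in S' = {}"
      using S(2) in_components_nonempty by (fastforce simp: faces_in_def)
    have "e \<in> Z \<union> edges_in S \<union> edges_in S'" if "e \<in> E" for e
      using cs[OF open_edge_props(1)[OF that]] open_edge_disjoint[OF that Z(2)] that
      by (auto simp: edges_in_def)
    then have EE: "E = Z \<union> edges_in S \<union> edges_in S'" using Z(2) by (auto simp: edges_in_def)
    have SZ: "S \<inter> drawing Z = {}" "S' \<inter> drawing Z = {}" using S(3) by auto
    have "edges_in S \<inter> edges_in S' = {}"
      using S(2) open_edge_props(2) by (fastforce simp: edges_in_def)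
    then have E0: "(Z \<union> edges_in S) \<inter> edges_in S' = {}" "Z \<inter> edges_in S = {}"
      using edges_in_disjoint[OF Z(2) SZ(1)] edges_in_disjoint[OF Z(2) SZ(2)] by auto
    have ZV: "\<Union>Z \<subseteq> V" using Z(2) edge_subset by blast
    have "v \<in> \<Union>Z \<longleftrightarrow> pos v \<notin> S \<union> S'" if "v \<in> V" for v
      unfolding S(3) using drawing_vertex[OF Z(2) that] by simp
    then have VV: "V = \<Union>Z \<union> verts_in S \<union> verts_in S'"
      "(\<Union>Z \<union> verts_in S) \<inter> verts_in S' = {}" "\<Union>Z \<inter> verts_in S = {}"
      using ZV S(2) by (auto simp: verts_in_def)
    show ?thesis
      by (intro exI[of _ S] exI[of _ S'] conjI facial[OF Z SS'(1)] facial[OF Z SS'(2)])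
        (fact F F0 EE E0 VV)+
  qed
  obtain Z where Z: "Z \<subseteq> E" "cycle_edges Z" using ex_cycle by blast
  obtain S S' where S: "facial Z S" "facial Z S'" "\<Phi> = faces_in S \<union> faces_in S'"
      "faces_in S \<inter> faces_in S' = {}" "E = Z \<union> edges_in S \<union> edges_in S'"
      "(Z \<union> edges_in S) \<inter> edges_in S' = {}" "Z \<inter> edges_in S = {}"
      "V = \<Union>Z \<union> verts_in S \<union> verts_in S'"
      "(\<Union>Z \<union> verts_in S) \<inter> verts_in S' = {}" "\<Union>Z \<inter> verts_in S = {}"
    using split[OF Z(2,1)] by (elim exE conjE) (rule that, assumption+)
  have fin: "finite (faces_in S)" "finite (faces_in S')" using S(1,2) by (auto simp: facial_def)
  have fZ: "finite Z" "finite (\<Union>Z)" "card (\<Union>Z) = card Z"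
    using cycle_edges_card_Union[OF Z(2)] cycle_edges_finite[OF Z(2)] by auto
  have "finite \<Phi>" using S(3) fin by simp
  moreover have "card \<Phi> + card V = card E + 2"
  proof -
    have "card \<Phi> = card (faces_in S) + card (faces_in S')"
      unfolding S(3) using card_Un_disjoint[OF fin S(4)] .
    moreover have "card E = card Z + card (edges_in S) + card (edges_in S')"
      unfolding arg_cong[OF S(5), of card]
      using card_Un_disjoint[OF _ _ S(6)] card_Un_disjoint[OF _ _ S(7)] fZ by simp
    moreover have "card V = card Z + card (verts_in S) + card (verts_in S')"
      unfolding arg_cong[OF S(8), of card]
      using card_Un_disjoint[OF _ _ S(9)] card_Un_disjoint[OF _ _ S(10)] fZ by simp
    ultimately show ?thesis using S(1,2) by (simp add: facial_def)
  qed
  moreover have "cycle_edges (bdry R) \<and> bdry R \<subseteq> E" if "R \<in> \<Phi>" for R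
    using that S(1-3) bdE by (auto simp: facial_def)
  moreover have "card {R \<in> \<Phi>. e \<in> bdry R} = 2" if e: "e \<in> E" for e
  proof -
    have "{R \<in> \<Phi>. e \<in> bdry R} = {R \<in> faces_in S. e \<in> bdry R} \<union> {R \<in> faces_in S'. e \<in> bdry R}"
      using S(3) by blast
    then have "card {R \<in> \<Phi>. e \<in> bdry R} =
        card {R \<in> faces_in S. e \<in> bdry R} + card {R \<in> faces_in S'. e \<in> bdry R}"
      using card_Un_disjoint[of "{R \<in> faces_in S. e \<in> bdry R}" "{R \<in> faces_in S'. e \<in> bdry R}"]
        fin S(4) by fastforce
    moreover have "card {R \<in> faces_in S. e \<in> bdry R} = (if e \<in> Z then 1 else if e \<in> edges_in S then 2 else 0)"
      "card {R \<in> faces_in S'. e \<in> bdry R} = (if e \<in> Z then 1 else if e \<in> edges_in S' then 2 else 0)"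
      using S(1,2) e by (auto simp: facial_def)
    moreover have "e \<in> Z \<or> e \<in> edges_in S \<or> e \<in> edges_in S'" using S(5) e by blast
    moreover have "\<not> (e \<in> edges_in S \<and> e \<in> edges_in S')" using S(6) by blast
    ultimately show ?thesis by auto
  qed
  moreover have "\<exists>T \<subseteq> \<Phi>. \<forall>e \<in> E. e \<in> Z \<longleftrightarrow> card {R \<in> T. e \<in> bdry R} = 1"
    if Z: "cycle_edges Z" "Z \<subseteq> E" for Z
  proof -
    obtain S S' where S: "facial Z S" "\<Phi> = faces_in S \<union> faces_in S'"
      using split[OF Z] by (elim exE conjE) (rule that, assumption+)
    have "\<forall>e \<in> E. e \<in> Z \<longleftrightarrow> card {R \<in> faces_in S. e \<in> bdry R} = 1"
      using S(1) by (simp add: facial_def)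
    with S(2) show ?thesis by blast
  qed
  ultimately show thesis using that[of \<Phi> bdry] by blast
qed

end

section \<open>Modifying cycle double covers\<close>

context cubic_graph begin

lemma edges_at:
  assumes "v \<in> V" "e \<in> E" "f \<in> E" "v \<in> e" "v \<in> f" "e \<noteq> f"
  obtains g where "g \<in> E" "v \<in> g" "g \<noteq> e" "g \<noteq> f" "{x \<in> E. v \<in> x} = {e, f, g}"
proof -
  have "card ({x \<in> E. v \<in> x} - {e, f}) = 1"
    using card_Diff_subset[of "{e, f}" "{x \<in> E. v \<in> x}"] degree3[OF assms(1)] assms by simp
  then obtain g where "{x \<in> E. v \<in> x} - {e, f} = {g}" using card_1_singletonE by blast
  then have "{x \<in> E. v \<in> x} = {e, f, g}" "g \<in> E" "v \<in> g" "g \<noteq> e" "g \<noteq> f" using assms by blast+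
  with that show thesis by blast
qed

lemma cycle_at:
  assumes K: "cycle_edges K" "K \<subseteq> E" and v: "v \<in> \<Union>K" and st: "{x \<in> E. v \<in> x} = {e, f, g}"
    and d: "e \<noteq> f" "e \<noteq> g" "f \<noteq> g"
  shows "e \<in> K \<and> f \<in> K \<and> g \<notin> K \<or> e \<in> K \<and> f \<notin> K \<and> g \<in> K \<or> e \<notin> K \<and> f \<in> K \<and> g \<in> K"
proof -
  have sub: "{x \<in> K. v \<in> x} \<subseteq> {e, f, g}" using st K(2) by blast
  have "v \<in> e" "v \<in> f" "v \<in> g" using st by blast+
  then have "{x \<in> K. v \<in> x} = {e, f, g} \<inter> K" using sub by blast
  then have c: "card ({e, f, g} \<inter> K) = 2" using cycle_edges_degree[OF K(1) v] by simp
  show ?thesis using c d by (cases "e \<in> K"; cases "f \<in> K"; cases "g \<in> K") (simp_all add: Int_insert_left)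
qed

text \<open>Each cycle takes two of the three edges at \<open>v\<close>, so they overlap.\<close>

lemma cycles_share_edge:
  assumes K: "cycle_edges K" "K \<subseteq> E" and L: "cycle_edges L" "L \<subseteq> E"
    and v: "v \<in> \<Union>K" "v \<in> \<Union>L"
  shows "\<exists>e \<in> K \<inter> L. v \<in> e"
proof (rule ccontr)
  assume h: "\<not> ?thesis"
  have vV: "v \<in> V" using v K(2) edge_subset by blast
  have "{e \<in> K. v \<in> e} \<union> {e \<in> L. v \<in> e} \<subseteq> {e \<in> E. v \<in> e}" using K(2) L(2) by blast
  then have "card ({e \<in> K. v \<in> e} \<union> {e \<in> L. v \<in> e}) \<le> 3"
    using card_mono[of "{e \<in> E. v \<in> e}"] degree3[OF vV] finite_E by fastforce
  moreover have "card ({e \<in> K. v \<in> e} \<union> {e \<in> L. v \<in> e}) = 2 + 2"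
    using card_Un_disjoint[of "{e \<in> K. v \<in> e}" "{e \<in> L. v \<in> e}"] h
      cycle_edges_finite[OF K(1)] cycle_edges_finite[OF L(1)]
      cycle_edges_degree[OF K(1) v(1)] cycle_edges_degree[OF L(1) v(2)] by fastforce
  ultimately show False by simp
qed

text \<open>Without the common edge both cycles are paths between its ends. A further common vertex
  would bring a second common edge, so the two paths close up to a cycle.\<close>

lemma cycle_sum:
  assumes K: "cycle_edges K" "K \<subseteq> E" and L: "cycle_edges L" "L \<subseteq> E" and e: "K \<inter> L = {e}"
  shows "cycle_edges ((K - L) \<union> (L - K))"
proof -
  obtain u v where uv: "e = {u, v}" "u \<noteq> v" using edge_pair e K(2) by blast
  have eKL: "{u, v} \<in> K" "{u, v} \<in> L" using e uv by auto
  obtain p where p: "path_betw u p v" "3 \<le> length p" "K = insert {u, v} (path_edges p)"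
    "{u, v} \<notin> path_edges p" using cycle_edges_remove[OF K(1) eKL(1) uv(2)] by blast
  obtain q where q: "path_betw u q v" "3 \<le> length q" "L = insert {u, v} (path_edges q)"
    "{u, v} \<notin> path_edges q" using cycle_edges_remove[OF L(1) eKL(2) uv(2)] by blast
  have UU: "\<Union>(path_edges p) = set p" "\<Union>(path_edges q) = set q"
    using p(2) q(2) by (auto intro!: Union_path_edges)
  have "set p \<inter> set q \<subseteq> {u, v}"
  proof
    fix w assume "w \<in> set p \<inter> set q"
    then have "w \<in> \<Union>K" "w \<in> \<Union>L" using UU p(3) q(3) by auto
    then have "\<exists>f \<in> K \<inter> L. w \<in> f" using cycles_share_edge[OF K L] by blast
    then show "w \<in> {u, v}" using e uv by simp
  qed
  then have int: "set p \<inter> set q = {u, v}" using path_betw_ends[OF p(1)] path_betw_ends[OF q(1)] by blast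
  have dj: "path_edges p \<inter> path_edges q = {}"
  proof -
    have "path_edges p \<inter> path_edges q \<subseteq> K \<inter> L" using p(3) q(3) by auto
    then have "path_edges p \<inter> path_edges q \<subseteq> {{u, v}}" using e uv by simp
    then show ?thesis using p(4) by auto
  qed
  have "(K - L) \<union> (L - K) = path_edges p \<union> path_edges q"
    using p(3,4) q(3,4) dj by auto
  then show ?thesis using cycle_edges_disjoint_betwI[OF p(1) q(1) uv(2) int dj] by simp
qed

text \<open>A family indexed by faces, so that different indices may carry the same cycle; in the
  multiset form below this becomes multiplicity.\<close>

definition double_cover :: "'f set \<Rightarrow> ('f \<Rightarrow> 'a set set) \<Rightarrow> bool" where
  "double_cover \<Phi> bd \<longleftrightarrow> finite \<Phi> \<and> (\<forall>\<phi>\<in>\<Phi>. cycle_edges (bd \<phi>) \<and> bd \<phi> \<subseteq> E) \<and>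
     (\<forall>e\<in>E. card {\<phi> \<in> \<Phi>. e \<in> bd \<phi>} = 2)"

definition mset_cover :: "'a set set multiset \<Rightarrow> bool" where
  "mset_cover M \<longleftrightarrow> (\<forall>K \<in># M. cycle_edges K \<and> K \<subseteq> E) \<and> (\<forall>e\<in>E. size {#K \<in># M. e \<in> K#} = 2)"

lemma size_filter_image_mset_set:
  "finite X \<Longrightarrow> size {#K \<in># image_mset bd (mset_set X). e \<in> K#} = card {\<phi> \<in> X. e \<in> bd \<phi>}"
  by (simp add: filter_mset_image_mset filter_mset_mset_set)

lemma double_cover_mset:
  assumes "double_cover \<Phi> bd"
  shows "mset_cover (image_mset bd (mset_set \<Phi>))" "size (image_mset bd (mset_set \<Phi>)) = card \<Phi>"
  using assms by (auto simp: double_cover_def mset_cover_def size_filter_image_mset_set)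

end

locale covered_cubic_graph = cubic_graph V E for V :: "'a set" and E +
  fixes \<Phi> :: "'f set" and bd :: "'f \<Rightarrow> 'a set set"
  assumes dc: "double_cover \<Phi> bd"
begin

lemma finite_faces: "finite \<Phi>"
  using dc by (simp add: double_cover_def)

lemma face_cycle: "\<phi> \<in> \<Phi> \<Longrightarrow> cycle_edges (bd \<phi>)" "\<phi> \<in> \<Phi> \<Longrightarrow> bd \<phi> \<subseteq> E"
  using dc by (auto simp: double_cover_def)

lemma two_faces:
  assumes "\<phi> \<in> \<Phi>" "\<psi> \<in> \<Phi>" "\<phi> \<noteq> \<psi>" "e \<in> bd \<phi>" "e \<in> bd \<psi>"
  shows "{\<theta> \<in> \<Phi>. e \<in> bd \<theta>} = {\<phi>, \<psi>}"
proof -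
  have "e \<in> E" using face_cycle assms by blast
  then have "card {\<theta> \<in> \<Phi>. e \<in> bd \<theta>} = 2" using dc by (simp add: double_cover_def)
  then have "card {\<phi>, \<psi>} = card {\<theta> \<in> \<Phi>. e \<in> bd \<theta>}" using assms by simp
  moreover have "{\<phi>, \<psi>} \<subseteq> {\<theta> \<in> \<Phi>. e \<in> bd \<theta>}" using assms by blast
  ultimately show ?thesis using finite_faces card_subset_eq[of "{\<theta> \<in> \<Phi>. e \<in> bd \<theta>}" "{\<phi>, \<psi>}"] by simp
qed

lemma other_face:
  assumes "\<phi> \<in> \<Phi>" "e \<in> bd \<phi>"
  obtains \<psi> where "\<psi> \<in> \<Phi>" "\<psi> \<noteq> \<phi>" "e \<in> bd \<psi>" "{\<theta> \<in> \<Phi>. e \<in> bd \<theta>} = {\<phi>, \<psi>}"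
proof -
  have "e \<in> E" using face_cycle assms by blast
  then have "card {\<theta> \<in> \<Phi>. e \<in> bd \<theta>} = 2" using dc by (simp add: double_cover_def)
  then have "\<exists>\<psi> \<in> {\<theta> \<in> \<Phi>. e \<in> bd \<theta>}. \<psi> \<noteq> \<phi>"
    by (metis (no_types, lifting) card_2_iff insertI1 insert_iff singletonD)
  then obtain \<psi> where "\<psi> \<in> \<Phi>" "\<psi> \<noteq> \<phi>" "e \<in> bd \<psi>" by blast
  with that two_faces[of \<phi> \<psi> e] assms show thesis by blast
qed

text \<open>A face through one of the three edges at \<open>v\<close> continues along exactly one of
  the other two. With \<open>N a b\<close> faces in the corner of \<open>a\<close> and
  \<open>b\<close>, this gives three equations \<open>N a b + N a c = 2\<close>, whose only solution
  is 1 everywhere.\<close>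

lemma corner_face:
  assumes "v \<in> V" "e \<in> E" "f \<in> E" "v \<in> e" "v \<in> f" "e \<noteq> f"
  shows "card {\<phi> \<in> \<Phi>. e \<in> bd \<phi> \<and> f \<in> bd \<phi>} = 1"
proof -
  obtain g where g: "g \<in> E" "v \<in> g" "g \<noteq> e" "g \<noteq> f" "{x \<in> E. v \<in> x} = {e, f, g}"
    using edges_at[OF assms] by blast
  define N where "N a b = card {\<phi> \<in> \<Phi>. a \<in> bd \<phi> \<and> b \<in> bd \<phi>}" for a b
  have *: "N a b + N a c = 2"
    if "{x \<in> E. v \<in> x} = {a, b, c}" "a \<noteq> b" "a \<noteq> c" "b \<noteq> c" for a b c
  proof -
    have aE: "a \<in> E" "v \<in> a" using that(1) by blast+
    have ex: "b \<in> bd \<phi> \<and> c \<notin> bd \<phi> \<or> b \<notin> bd \<phi> \<and> c \<in> bd \<phi>" if \<phi>: "\<phi> \<in> \<Phi>" "a \<in> bd \<phi>" for \<phi>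
      using cycle_at[OF face_cycle(1)[OF \<phi>(1)] face_cycle(2)[OF \<phi>(1)] _ \<open>{x \<in> E. v \<in> x} = {a, b, c}\<close> \<open>a \<noteq> b\<close> \<open>a \<noteq> c\<close> \<open>b \<noteq> c\<close>]
        \<phi>(2) aE(2) by blast
    have "{\<phi> \<in> \<Phi>. a \<in> bd \<phi>} = {\<phi> \<in> \<Phi>. a \<in> bd \<phi> \<and> b \<in> bd \<phi>} \<union> {\<phi> \<in> \<Phi>. a \<in> bd \<phi> \<and> c \<in> bd \<phi>}"
      using ex by blast
    moreover have "{\<phi> \<in> \<Phi>. a \<in> bd \<phi> \<and> b \<in> bd \<phi>} \<inter> {\<phi> \<in> \<Phi>. a \<in> bd \<phi> \<and> c \<in> bd \<phi>} = {}"
      using ex by blast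
    moreover have "card {\<phi> \<in> \<Phi>. a \<in> bd \<phi>} = 2" using dc aE by (simp add: double_cover_def)
    ultimately show ?thesis unfolding N_def
      using card_Un_disjoint[of "{\<phi> \<in> \<Phi>. a \<in> bd \<phi> \<and> b \<in> bd \<phi>}" "{\<phi> \<in> \<Phi>. a \<in> bd \<phi> \<and> c \<in> bd \<phi>}"]
        finite_faces by simp
  qed
  have "N e f + N e g = 2" using * g assms(6) by metis
  moreover have "N f e + N f g = 2" using *[of f e g] g assms(6) by (metis insert_commute)
  moreover have "N g e + N g f = 2" using *[of g e f] g assms(6) by (metis insert_commute)
  moreover have sym: "N a b = N b a" for a b unfolding N_def by (metis conj_commute)
  ultimately have "N e f = 1" using sym[of e f] sym[of e g] sym[of f g] by linarith
  then show ?thesis by (simp add: N_def)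
qed

text \<open>Two edges of a triangle meet in a vertex, and the corner there belongs to one face only,
  namely \<open>f\<close>.\<close>

lemma triangle_shares:
  assumes f: "f \<in> \<Phi>" "card (bd f) = 3" and \<phi>: "\<phi> \<in> \<Phi>" "\<phi> \<noteq> f" and e: "e \<in> bd f" "e' \<in> bd f" "e \<in> bd \<phi>" "e' \<in> bd \<phi>"
  shows "e = e'"
proof (rule ccontr)
  assume ne: "e \<noteq> e'"
  note C = face_cycle[OF f(1)]
  have E: "e \<in> E" "e' \<in> E" using C e by auto
  have "card e = 2" "card e' = 2" using edge_pair[OF E(1)] edge_pair[OF E(2)] by auto
  moreover have "card (e \<union> e') \<le> 3"
    using card_mono[of "\<Union>(bd f)" "e \<union> e'"] cycle_edges_card_Union[OF C(1)] f(2) e by auto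
  moreover have "finite e" "finite e'" using calculation card.infinite by force+
  ultimately have "e \<inter> e' \<noteq> {}" using card_Un_disjoint[of e e'] by fastforce
  then obtain v where v: "v \<in> e" "v \<in> e'" by blast
  have "card {\<phi> \<in> \<Phi>. e \<in> bd \<phi> \<and> e' \<in> bd \<phi>} = 1"
    using corner_face[of v e e'] edge_subset E v ne by blast
  moreover have "{\<phi>, f} \<subseteq> {\<phi> \<in> \<Phi>. e \<in> bd \<phi> \<and> e' \<in> bd \<phi>}" using assms by blast
  ultimately have "card {\<phi>, f} \<le> 1"
    using card_mono[of "{\<phi> \<in> \<Phi>. e \<in> bd \<phi> \<and> e' \<in> bd \<phi>}" "{\<phi>, f}"] finite_faces by simp
  then show False using \<phi>(2) by simp
qed

text \<open>The neighbours of the triangle \<open>f\<close> are rerouted the long way around it.\<close>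

lemma triangle_removal:
  assumes f: "f \<in> \<Phi>" "card (bd f) = 3"
  shows "double_cover (\<Phi> - {f})
    (\<lambda>\<phi>. if bd \<phi> \<inter> bd f = {} then bd \<phi> else (bd \<phi> - bd f) \<union> (bd f - bd \<phi>))"
    (is "double_cover _ ?b")
  unfolding double_cover_def
proof (intro conjI ballI)
  note C = face_cycle[OF f(1)]
  show "finite (\<Phi> - {f})" using finite_faces by simp
  show "cycle_edges (?b \<phi>)" "?b \<phi> \<subseteq> E" if "\<phi> \<in> \<Phi> - {f}" for \<phi>
  proof -
    have \<phi>: "\<phi> \<in> \<Phi>" "\<phi> \<noteq> f" using that by auto
    show "?b \<phi> \<subseteq> E" using face_cycle[OF \<phi>(1)] C by auto
    show "cycle_edges (?b \<phi>)"
    proof (cases "bd \<phi> \<inter> bd f = {}")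
      case False
      then obtain e where "bd \<phi> \<inter> bd f = {e}" using triangle_shares[OF f \<phi>] by blast
      then show ?thesis using cycle_sum[OF face_cycle[OF \<phi>(1)] C] False by simp
    qed (use face_cycle[OF \<phi>(1)] in simp)
  qed
  show "card {\<phi> \<in> \<Phi> - {f}. e \<in> ?b \<phi>} = 2" if e: "e \<in> E" for e
  proof (cases "e \<in> bd f")
    case False
    then have "{\<phi> \<in> \<Phi> - {f}. e \<in> ?b \<phi>} = {\<phi> \<in> \<Phi>. e \<in> bd \<phi>}" by auto
    then show ?thesis using dc e by (simp add: double_cover_def)
  next
    case True
    \<comment> \<open>After rerouting, \<open>e\<close> is given up by the face across it and taken
      over by the faces \<open>A1\<close> and \<open>A2\<close> across the other two edges, so it is
      covered twice again.\<close>
    have "card (bd f - {e}) = 2" using f(2) True by simp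
    then obtain e1 e2 where e12: "bd f - {e} = {e1, e2}" "e1 \<noteq> e2" by (meson card_2_iff)
    have e1: "e1 \<in> bd f" "e1 \<noteq> e" and e2: "e2 \<in> bd f" "e2 \<noteq> e" using e12 by auto
    obtain A1 where A1: "A1 \<in> \<Phi>" "A1 \<noteq> f" "e1 \<in> bd A1" "{\<theta> \<in> \<Phi>. e1 \<in> bd \<theta>} = {f, A1}"
      using other_face[OF f(1) e1(1)] by blast
    obtain A2 where A2: "A2 \<in> \<Phi>" "A2 \<noteq> f" "e2 \<in> bd A2" "{\<theta> \<in> \<Phi>. e2 \<in> bd \<theta>} = {f, A2}"
      using other_face[OF f(1) e2(1)] by blast
    have "A1 \<noteq> A2" using triangle_shares[OF f A1(1,2) e1(1) e2(1) A1(3)] A2(3) e12(2) by blast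
    moreover have "e \<notin> bd A1" "e \<notin> bd A2"
      using triangle_shares[OF f A1(1,2) e1(1) True A1(3)] triangle_shares[OF f A2(1,2) e2(1) True A2(3)] e1 e2
      by blast+
    moreover have "\<phi> = A1 \<or> \<phi> = A2"
      if h: "\<phi> \<in> \<Phi>" "\<phi> \<noteq> f" "bd \<phi> \<inter> bd f \<noteq> {}" "e \<notin> bd \<phi>" for \<phi>
    proof -
      obtain x where x: "x \<in> bd \<phi>" "x \<in> bd f" using h(3) by blast
      then have "x \<in> bd f - {e}" using h(4) by blast
      then have "x = e1 \<or> x = e2" using e12(1) by simp
      moreover have "\<phi> \<in> {\<theta> \<in> \<Phi>. x \<in> bd \<theta>}" using h(1) x(1) by simp
      ultimately show ?thesis using A1(4) A2(4) h(2) by auto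
    qed
    ultimately have "{\<phi> \<in> \<Phi> - {f}. e \<in> ?b \<phi>} = {A1, A2}"
      using A1 A2 e1 e2 True by (auto split: if_splits)
    then show ?thesis using \<open>A1 \<noteq> A2\<close> by simp
  qed
qed

text \<open>
  The face \<open>f\<close> and all its neighbours are replaced by three cycles, one per colour: the sum of \<open>f\<close>
  and the neighbours of that colour. An edge of \<open>f\<close> then lies in the two cycles whose colour is not
  that of the neighbour across the edge.
\<close>

lemma good_face_recolour:
  fixes c :: "'f \<Rightarrow> nat"
  assumes f: "f \<in> \<Phi>"
    and good: "\<And>\<phi> e e'. \<lbrakk>\<phi> \<in> \<Phi>; \<phi> \<noteq> f; e \<in> bd \<phi> \<inter> bd f; e' \<in> bd \<phi> \<inter> bd f\<rbrakk> \<Longrightarrow> e = e'"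
    and c3: "\<And>\<phi>. \<phi> \<in> \<Phi> \<Longrightarrow> c \<phi> < 3"
    and col: "\<And>\<phi> \<psi>. \<lbrakk>\<phi> \<in> \<Phi>; \<psi> \<in> \<Phi>; \<phi> \<noteq> f; \<psi> \<noteq> f; \<phi> \<noteq> \<psi>; bd \<phi> \<inter> bd f \<noteq> {}; bd \<psi> \<inter> bd f \<noteq> {}; c \<phi> = c \<psi>\<rbrakk>
       \<Longrightarrow> bd \<phi> \<inter> bd \<psi> = {}"
  shows "\<exists>M. mset_cover M \<and> size M + card (bd f) = card \<Phi> + 2"
proof -
  note C = face_cycle[OF f]
  define N where "N = {\<phi> \<in> \<Phi> - {f}. bd \<phi> \<inter> bd f \<noteq> {}}"
  have NF: "N \<subseteq> \<Phi>" "f \<notin> N" "finite N" using finite_faces by (auto simp: N_def)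
  define U where "U X = \<Union>(bd ` X)" for X
  define B where "B j = (bd f - U {\<phi> \<in> N. c \<phi> = j}) \<union> (U {\<phi> \<in> N. c \<phi> = j} - bd f)" for j
  have UE: "U X \<subseteq> E" if "X \<subseteq> \<Phi>" for X using that face_cycle by (auto simp: U_def)
  have BE: "B j \<subseteq> E" for j using UE[of "{\<phi> \<in> N. c \<phi> = j}"] NF C by (auto simp: B_def)
  \<comment> \<open>Neighbours of one colour are added to \<open>bd f\<close> one at a time. Being
    disjoint from those already added, each meets the current sum only in its edge of
    \<open>f\<close>, so the sum stays a cycle. An empty colour class leaves \<open>f\<close>
    itself.\<close>
  have cyc: "cycle_edges ((bd f - U X) \<union> (U X - bd f))"
    if "finite X" "X \<subseteq> {\<phi> \<in> N. c \<phi> = j}" for X j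
    using that
  proof (induction X rule: finite_induct)
    case empty
    then show ?case using C by (simp add: U_def)
  next
    case (insert \<phi> X)
    let ?K = "(bd f - U X) \<union> (U X - bd f)"
    have \<phi>: "\<phi> \<in> \<Phi>" "\<phi> \<noteq> f" "bd \<phi> \<inter> bd f \<noteq> {}" "c \<phi> = j" using insert.prems by (auto simp: N_def)
    have dj: "bd \<phi> \<inter> U X = {}"
    proof -
      have "bd \<phi> \<inter> bd \<psi> = {}" if \<psi>: "\<psi> \<in> X" for \<psi>
      proof (rule col[OF \<phi>(1) _ \<phi>(2) _ _ \<phi>(3)])
        have "\<psi> \<in> {\<phi> \<in> N. c \<phi> = j}" using \<psi> insert.prems by blast
        then show "\<psi> \<in> \<Phi>" "\<psi> \<noteq> f" "bd \<psi> \<inter> bd f \<noteq> {}" "c \<phi> = c \<psi>"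
          using \<phi>(4) by (auto simp: N_def)
        show "\<phi> \<noteq> \<psi>" using \<psi> insert.hyps by blast
      qed
      then show ?thesis by (auto simp: U_def)
    qed
    obtain e where e: "bd \<phi> \<inter> bd f = {e}" using good[OF \<phi>(1,2)] \<phi>(3) by blast
    have "?K \<inter> bd \<phi> = {e}" using e dj by blast
    moreover have "?K \<subseteq> E" using UE[of X] insert.prems NF C by blast
    moreover have "cycle_edges ?K" using insert by simp
    ultimately have "cycle_edges ((?K - bd \<phi>) \<union> (bd \<phi> - ?K))"
      using cycle_sum face_cycle[OF \<phi>(1)] by blast
    moreover have "(?K - bd \<phi>) \<union> (bd \<phi> - ?K) = (bd f - U (insert \<phi> X)) \<union> (U (insert \<phi> X) - bd f)"
      using dj by (auto simp: U_def)
    ultimately show ?case by simp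
  qed
  have Bcyc: "cycle_edges (B j)" for j unfolding B_def using cyc[of _ j] NF by simp
  define M where "M = image_mset bd (mset_set (\<Phi> - {f} - N)) + image_mset B (mset_set {..<3})"
  have "mset_cover M"
    unfolding mset_cover_def
  proof (intro conjI ballI)
    fix K assume "K \<in># M"
    then have "(\<exists>\<phi>\<in>\<Phi>. K = bd \<phi>) \<or> (\<exists>j. K = B j)" using finite_faces by (auto simp: M_def)
    then show "cycle_edges K" "K \<subseteq> E" using face_cycle Bcyc BE by blast+
  next
    fix e assume e: "e \<in> E"
    have two: "card {\<phi> \<in> \<Phi>. e \<in> bd \<phi>} = 2" using dc e by (simp add: double_cover_def)
    have s: "size {#K \<in># M. e \<in> K#} = card {\<phi> \<in> \<Phi> - {f} - N. e \<in> bd \<phi>} + card {j \<in> {..<3}. e \<in> B j}"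
      unfolding M_def using finite_faces by (simp add: size_filter_image_mset_set)
    show "size {#K \<in># M. e \<in> K#} = 2"
    proof (cases "e \<in> bd f")
      case True
      obtain A where A: "A \<in> \<Phi>" "A \<noteq> f" "e \<in> bd A" "{\<theta> \<in> \<Phi>. e \<in> bd \<theta>} = {f, A}"
        using other_face[OF f True] by blast
      have AN: "A \<in> N" using A True by (auto simp: N_def)
      have "{\<phi> \<in> \<Phi> - {f} - N. e \<in> bd \<phi>} = {}" using A(4) AN by blast
      then have "card {\<phi> \<in> \<Phi> - {f} - N. e \<in> bd \<phi>} = 0" by (metis card.empty)
      moreover have "e \<in> B j \<longleftrightarrow> j \<noteq> c A" for j
      proof -
        have "e \<in> U {\<phi> \<in> N. c \<phi> = j} \<longleftrightarrow> j = c A"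
          using A(3,4) AN NF by (auto simp: U_def)
        then show ?thesis using True by (simp add: B_def)
      qed
      then have "{j \<in> {..<3}. e \<in> B j} = {..<3} - {c A}" by auto
      then have "card {j \<in> {..<3}. e \<in> B j} = 2" using c3[OF A(1)] by simp
      ultimately show ?thesis using s by linarith
    next
      case False
      \<comment> \<open>Two neighbours of \<open>f\<close> that share \<open>e\<close> have
        different colours, so \<open>e\<close> goes into one new cycle for each of them.\<close>
      have inj: "inj_on c {\<phi> \<in> N. e \<in> bd \<phi>}"
      proof (rule inj_onI, rule ccontr)
        fix x y assume h: "x \<in> {\<phi> \<in> N. e \<in> bd \<phi>}" "y \<in> {\<phi> \<in> N. e \<in> bd \<phi>}" "c x = c y" "x \<noteq> y"
        then have "bd x \<inter> bd y = {}" using col[of x y] by (simp add: N_def)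
        then show False using h by blast
      qed
      have "{j \<in> {..<3}. e \<in> B j} = c ` {\<phi> \<in> N. e \<in> bd \<phi>}"
        using False c3 NF by (auto simp: B_def U_def)
      then have "card {j \<in> {..<3}. e \<in> B j} = card {\<phi> \<in> N. e \<in> bd \<phi>}" using card_image[OF inj] by simp
      moreover have "{\<phi> \<in> \<Phi>. e \<in> bd \<phi>} = {\<phi> \<in> \<Phi> - {f} - N. e \<in> bd \<phi>} \<union> {\<phi> \<in> N. e \<in> bd \<phi>}"
        using False NF by auto
      then have "2 = card {\<phi> \<in> \<Phi> - {f} - N. e \<in> bd \<phi>} + card {\<phi> \<in> N. e \<in> bd \<phi>}"
        unfolding two[symmetric] using finite_faces NF(3) by (simp, subst card_Un_disjoint) auto
      ultimately show ?thesis using s by linarith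
    qed
  qed
  \<comment> \<open>Each edge of \<open>f\<close> has one neighbour across it, and the single-edge
    condition makes these neighbours distinct.\<close>
  moreover have "card N = card (bd f)"
  proof -
    have "\<exists>A. A \<in> N \<and> e \<in> bd A" if e: "e \<in> bd f" for e
    proof -
      obtain A where "A \<in> \<Phi>" "A \<noteq> f" "e \<in> bd A" using other_face[OF f e] by metis
      then show ?thesis using e by (auto simp: N_def)
    qed
    then obtain h where h: "\<And>e. e \<in> bd f \<Longrightarrow> h e \<in> N \<and> e \<in> bd (h e)" by metis
    have "inj_on h (bd f)"
    proof (rule inj_onI)
      fix x y assume "x \<in> bd f" "y \<in> bd f" "h x = h y"
      then show "x = y" using good[of "h x" x y] h[of x] h[of y] NF by auto
    qed
    moreover have "h ` bd f = N"
    proof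
      show "N \<subseteq> h ` bd f"
      proof
        fix A assume A: "A \<in> N"
        then obtain e where e: "e \<in> bd A" "e \<in> bd f" by (auto simp: N_def)
        have "A = h e"
        proof (rule ccontr)
          assume "A \<noteq> h e"
          then have "{\<theta> \<in> \<Phi>. e \<in> bd \<theta>} = {A, h e}"
            using two_faces[of A "h e" e] A h[OF e(2)] e NF by blast
          moreover have "f \<in> {\<theta> \<in> \<Phi>. e \<in> bd \<theta>}" using f e(2) by simp
          ultimately have "f = A \<or> f = h e" by simp
          then show False using A h[OF e(2)] NF(2) by auto
        qed
        then show "A \<in> h ` bd f" using e by blast
      qed
    qed (use h in blast)
    ultimately show ?thesis using card_image by fastforce
  qed
  moreover have "size M = card (\<Phi> - {f} - N) + 3" by (simp add: M_def)
  moreover have "card (\<Phi> - {f} - N) + card N + 1 = card \<Phi>"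
  proof -
    have "\<Phi> = insert f ((\<Phi> - {f} - N) \<union> N)" "f \<notin> (\<Phi> - {f} - N) \<union> N" using NF f by auto
    then have "card \<Phi> = Suc (card ((\<Phi> - {f} - N) \<union> N))"
      using finite_faces NF(3) by (metis card_insert_disjoint finite_Diff finite_Un)
    also have "card ((\<Phi> - {f} - N) \<union> N) = card (\<Phi> - {f} - N) + card N"
      using finite_faces NF(3) by (intro card_Un_disjoint) auto
    finally show ?thesis by simp
  qed
  ultimately show ?thesis by (intro exI[of _ M]) simp
qed

end

section \<open>Noncrossing relations and edge cuts\<close>

text \<open>Renames the colours of one interval so that they agree with the other interval at the
  gluing point and take a prescribed value at the far end.\<close>

lemma third_colour_permutation:
  fixes x y x' y' :: nat
  assumes "x < 3" "y < 3" "x \<noteq> y" "x' < 3" "y' < 3" "x' \<noteq> y'"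
  obtains \<pi> :: "nat \<Rightarrow> nat" where "\<pi> x = x'" "\<pi> y = y'"
    "\<And>z. z < 3 \<Longrightarrow> \<pi> z < 3" "\<And>z w. \<lbrakk>z < 3; w < 3; \<pi> z = \<pi> w\<rbrakk> \<Longrightarrow> z = w"
proof -
  \<comment> \<open>The colours 0, 1 and 2 add up to 3, so \<open>3 - x' - y'\<close> is the third
    colour.\<close>
  define \<pi> where "\<pi> z = (if z = x then x' else if z = y then y' else 3 - x' - y')" for z
  show thesis
  proof (rule that[of \<pi>])
    show "\<pi> x = x'" "\<pi> y = y'" using assms by (auto simp: \<pi>_def)
    show "\<pi> z < 3" if "z < 3" for z using assms that by (auto simp: \<pi>_def)
    have third: "z = 3 - x - y" if "z < 3" "z \<noteq> x" "z \<noteq> y" for z using assms that by arith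
    have "3 - x' - y' \<noteq> x'" "3 - x' - y' \<noteq> y'" using assms by arith+
    then show "z = w" if "z < 3" "w < 3" "\<pi> z = \<pi> w" for z w
      using that third[of z] third[of w] assms(6) by (auto simp: \<pi>_def split: if_splits)
  qed
qed

text \<open>
  The strengthening \<open>c a \<noteq> c b\<close> lets the colourings of two intervals be glued at the last neighbour
  of \<open>a\<close>.
\<close>

lemma noncrossing_3_colourable:
  fixes R :: "nat \<Rightarrow> nat \<Rightarrow> bool"
  assumes "\<And>i j k l. \<lbrakk>a \<le> i; i < j; j < k; k < l; l \<le> b; R i k; R j l\<rbrakk> \<Longrightarrow> False" "a \<le> b"
  shows "\<exists>c :: nat \<Rightarrow> nat. (\<forall>i. c i < 3) \<and> (\<forall>i j. a \<le> i \<and> i < j \<and> j \<le> b \<and> R i j \<longrightarrow> c i \<noteq> c j) \<and>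
    (a < b \<longrightarrow> c a \<noteq> c b)"
  using assms
proof (induction "b - a" arbitrary: a b rule: less_induct)
  case less
  note nc = less.prems(1)
  show ?case
  proof (cases "a = b")
    case True
    then show ?thesis by (intro exI[of _ "\<lambda>_. 0"]) auto
  next
    case False
    then have ab: "a < b" using less.prems(2) by simp
    \<comment> \<open>Neighbours of \<open>a\<close> strictly inside the interval; \<open>b\<close>
      is left out because the two ends receive different colours anyway.\<close>
    define Ms where "Ms = {m. a < m \<and> m < b \<and> R a m}"
    have fin: "finite Ms" by (rule finite_subset[of _ "{..b}"]) (auto simp: Ms_def)
    show ?thesis
    proof (cases "Ms = {}")
      case True
      have "\<exists>c :: nat \<Rightarrow> nat. (\<forall>i. c i < 3) \<and>
          (\<forall>i j. Suc a \<le> i \<and> i < j \<and> j \<le> b \<and> R i j \<longrightarrow> c i \<noteq> c j) \<and> (Suc a < b \<longrightarrow> c (Suc a) \<noteq> c b)"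
      proof (rule less.hyps)
        show "False" if "Suc a \<le> i" "i < j" "j < k" "k < l" "l \<le> b" "R i k" "R j l" for i j k l
          using nc[of i j k l] that by simp
      qed (use ab in auto)
      then obtain c :: "nat \<Rightarrow> nat" where c: "\<And>i. c i < 3"
        "\<And>i j. \<lbrakk>Suc a \<le> i; i < j; j \<le> b; R i j\<rbrakk> \<Longrightarrow> c i \<noteq> c j" by blast
      \<comment> \<open>Without inner neighbours, \<open>a\<close> only has to avoid the colour of
        \<open>b\<close>.\<close>
      define d where "d i = (if i = a then (if c b = 0 then 1 else 0) else c i)" for i
      have "d i \<noteq> d j" if h: "a \<le> i" "i < j" "j \<le> b" "R i j" for i j
      proof (cases "i = a")
        case True
        then have "j = b" using h \<open>Ms = {}\<close> by (auto simp: Ms_def le_less)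
        then show ?thesis using True h by (simp add: d_def)
      next
        case False
        then show ?thesis using c(2)[of i j] h by (simp add: d_def)
      qed
      moreover have "d i < 3" for i using c(1) by (simp add: d_def)
      moreover have "d a \<noteq> d b" using ab by (simp add: d_def)
      ultimately show ?thesis by (intro exI[of _ d]) simp
    next
      case False
      define m where "m = Max Ms"
      have "m \<in> Ms" using Max_in[OF fin False] by (simp add: m_def)
      then have m: "a < m" "m < b" "R a m" by (auto simp: Ms_def)
      have mmax: "j \<le> m" if "a < j" "j < b" "R a j" for j
        unfolding m_def using that fin by (intro Max_ge) (auto simp: Ms_def)
      have "\<exists>c :: nat \<Rightarrow> nat. (\<forall>i. c i < 3) \<and>
          (\<forall>i j. a \<le> i \<and> i < j \<and> j \<le> m \<and> R i j \<longrightarrow> c i \<noteq> c j) \<and> (a < m \<longrightarrow> c a \<noteq> c m)"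
      proof (rule less.hyps)
        show "False" if "a \<le> i" "i < j" "j < k" "k < l" "l \<le> m" "R i k" "R j l" for i j k l
          using nc[of i j k l] that m by simp
      qed (use m in auto)
      then obtain c1 :: "nat \<Rightarrow> nat" where c1: "\<And>i. c1 i < 3"
        "\<And>i j. \<lbrakk>a \<le> i; i < j; j \<le> m; R i j\<rbrakk> \<Longrightarrow> c1 i \<noteq> c1 j" "c1 a \<noteq> c1 m" using m(1) by blast
      have "\<exists>c :: nat \<Rightarrow> nat. (\<forall>i. c i < 3) \<and>
          (\<forall>i j. m \<le> i \<and> i < j \<and> j \<le> b \<and> R i j \<longrightarrow> c i \<noteq> c j) \<and> (m < b \<longrightarrow> c m \<noteq> c b)"
      proof (rule less.hyps)
        show "False" if "m \<le> i" "i < j" "j < k" "k < l" "l \<le> b" "R i k" "R j l" for i j k l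
          using nc[of i j k l] that m by simp
      qed (use m in auto)
      then obtain c2 :: "nat \<Rightarrow> nat" where c2: "\<And>i. c2 i < 3"
        "\<And>i j. \<lbrakk>m \<le> i; i < j; j \<le> b; R i j\<rbrakk> \<Longrightarrow> c2 i \<noteq> c2 j" "c2 m \<noteq> c2 b" using m(2) by blast
      \<comment> \<open>The third colour becomes that of \<open>b\<close>: different from
        \<open>c1 a\<close>, as the strengthened claim demands, and from \<open>c1 m\<close>, as the
        renaming of \<open>c2\<close> demands.\<close>
      define t where "t = 3 - c1 a - c1 m"
      have t: "t < 3" "c1 m \<noteq> t" "c1 a \<noteq> t" using c1(1)[of a] c1(1)[of m] c1(3) unfolding t_def by arith+
      obtain \<pi> where \<pi>: "\<pi> (c2 m) = c1 m" "\<pi> (c2 b) = t" "\<And>z. z < 3 \<Longrightarrow> \<pi> z < (3::nat)"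
        "\<And>z w. \<lbrakk>z < 3; w < 3; \<pi> z = \<pi> w\<rbrakk> \<Longrightarrow> z = w"
        using third_colour_permutation[OF c2(1) c2(1) c2(3) c1(1) t(1,2)] by metis
      define d where "d i = (if i \<le> m then c1 i else \<pi> (c2 i))" for i
      have d2: "d i = \<pi> (c2 i)" if "m \<le> i" for i using that \<pi>(1) by (auto simp: d_def)
      have dab: "d a \<noteq> d b" using d2[of b] m \<pi>(2) t(3) by (simp add: d_def)
      have "d i \<noteq> d j" if h: "a \<le> i" "i < j" "j \<le> b" "R i j" for i j
      proof -
        \<comment> \<open>Of the pairs that straddle \<open>m\<close>, those starting at
          \<open>a\<close> can only end at \<open>b\<close>, because \<open>m\<close> is the last
          inner neighbour, and those starting later would cross the pair of \<open>a\<close> and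
          \<open>m\<close>.\<close>
        consider "j \<le> m" | "m \<le> i" | "i = a" "m < j" | "a < i" "i < m" "m < j" using h m by linarith
        then show ?thesis
        proof cases
          case 1
          then show ?thesis using c1(2)[of i j] h by (simp add: d_def)
        next
          case 2
          then have "c2 i \<noteq> c2 j" using c2(2)[of i j] h by simp
          then show ?thesis using d2[of i] d2[of j] 2 h \<pi>(4)[OF c2(1) c2(1)] by auto
        next
          case 3
          then have "j = b" using mmax[of j] h m by fastforce
          then show ?thesis using dab 3 by simp
        next
          case 4
          then show ?thesis using nc[of a i m j] h m by blast
        qed
      qed
      moreover have "d i < 3" for i using c1(1) c2(1) \<pi>(3) by (simp add: d_def)
      ultimately show ?thesis using dab by (intro exI[of _ d]) simp
    qed
  qed
qed

section \<open>Edge cuts given by vertex sets\<close>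

definition crosses :: "'a set \<Rightarrow> 'a set \<Rightarrow> bool" where
  "crosses X e \<longleftrightarrow> e \<inter> X \<noteq> {} \<and> \<not> e \<subseteq> X"

lemma path_uniform:
  assumes "\<And>e. e \<in> path_edges p \<Longrightarrow> \<not> crosses X e" "x \<in> set p"
  shows "x \<in> X \<longleftrightarrow> hd p \<in> X"
  using assms
proof (induction p arbitrary: x rule: path_edges.induct)
  case (1 u v p)
  have "u \<in> X \<longleftrightarrow> v \<in> X" using "1.prems"(1)[of "{u, v}"] by (auto simp: crosses_def)
  moreover have "x \<in> X \<longleftrightarrow> v \<in> X" if "x \<noteq> u"
    using "1.IH"[of x] "1.prems" that by simp
  ultimately show ?case by auto
qed auto

text \<open>The rest of the cycle is a path between the ends of \<open>e\<close>, only one of which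
  is in \<open>X\<close>.\<close>

lemma cycle_crosses_twice:
  assumes K: "cycle_edges K" and e: "e \<in> K" "crosses X e"
  obtains e' where "e' \<in> K" "e' \<noteq> e" "crosses X e'"
proof -
  obtain u v where uv: "e = {u, v}" "u \<noteq> v" using cycle_edges_pair[OF K e(1)] by blast
  have uvK: "{u, v} \<in> K" using e(1) uv(1) by simp
  obtain p where p: "path_betw u p v" "K = insert {u, v} (path_edges p)" "{u, v} \<notin> path_edges p"
    using cycle_edges_remove[OF K uvK uv(2)] by metis
  have "\<exists>e' \<in> path_edges p. crosses X e'"
  proof (rule ccontr)
    assume "\<not> ?thesis"
    then have "v \<in> X \<longleftrightarrow> hd p \<in> X" using path_uniform[of p X v] path_betw_ends[OF p(1)] by blast
    then show False using e(2) uv p(1) by (auto simp: crosses_def path_betw_def)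
  qed
  with that p uv show thesis by blast
qed

lemma cycle_uniform:
  assumes K: "cycle_edges K" and nc: "\<And>e. e \<in> K \<Longrightarrow> \<not> crosses X e" and xy: "x \<in> \<Union>K" "y \<in> \<Union>K"
  shows "x \<in> X \<longleftrightarrow> y \<in> X"
proof (cases "x = y")
  case False
  then obtain p q where p: "path_betw x p y" "K = path_edges p \<union> path_edges q"
    using cycle_edges_split[OF K xy] by metis
  then show ?thesis using path_uniform[of p X y] nc path_betw_ends[OF p(1)] by (auto simp: path_betw_def)
qed simp

lemma path_edges_nth: "path_edges q = {{q ! i, q ! Suc i} |i. Suc i < length q}"
proof (induction q rule: path_edges.induct)
  case (1 x y xs)
  let ?q = "x # y # xs"
  have "{{?q ! i, ?q ! Suc i} |i. Suc i < length ?q} =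
      insert {x, y} {{?q ! Suc i, ?q ! Suc (Suc i)} |i. Suc (Suc i) < length ?q}" (is "?A = ?B")
  proof
    show "?A \<subseteq> ?B"
    proof
      fix e assume "e \<in> ?A"
      then obtain i where "e = {?q ! i, ?q ! Suc i}" "Suc i < length ?q" by blast
      then show "e \<in> ?B" by (cases i) auto
    qed
    show "?B \<subseteq> ?A"
    proof
      fix e assume "e \<in> ?B"
      then consider "e = {?q ! 0, ?q ! Suc 0}" | i where "e = {?q ! Suc i, ?q ! Suc (Suc i)}" "Suc (Suc i) < length ?q"
        by auto
      then show "e \<in> ?A"
      proof cases
        case 1
        then show ?thesis by (intro CollectI exI[of _ 0]) simp
      next
        case (2 i)
        then show ?thesis by (intro CollectI exI[of _ "Suc i"]) simp
      qed
    qed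
  qed
  then show ?case using 1 by simp
qed auto

context cubic_graph begin

text \<open>\<open>X\<close> consists of what an end of \<open>e\<close> reaches without edges of
  \<open>K\<close>. If it contained the other end, the path together with \<open>e\<close> would be
  a cycle meeting \<open>K\<close> only in \<open>e\<close>.\<close>

lemma cut_exists:
  assumes e: "e \<in> E" "e \<in> K"
    and Z: "\<And>Z. \<lbrakk>cycle_edges Z; Z \<subseteq> E; e \<in> Z\<rbrakk> \<Longrightarrow> \<exists>e' \<in> Z \<inter> K. e' \<noteq> e"
  shows "\<exists>X \<subseteq> V. crosses X e \<and> (\<forall>e' \<in> E. crosses X e' \<longrightarrow> e' \<in> K)"
proof -
  obtain u v where uv: "e = {u, v}" "u \<noteq> v" "u \<in> V" "v \<in> V" using edge_pair[OF e(1)] by blast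
  define R where "R = {(x, y). {x, y} \<in> E - K}"
  define X where "X = {x. (u, x) \<in> R\<^sup>*}"
  have "x \<in> V" if "(u, x) \<in> R\<^sup>*" for x
    using that by (induction rule: rtrancl_induct) (use uv edge_subset in \<open>auto simp: R_def\<close>)
  then have XV: "X \<subseteq> V" by (auto simp: X_def)
  have uX: "u \<in> X" by (simp add: X_def)
  have vX: "v \<notin> X"
  proof
    assume "v \<in> X"
    then have "(u, v) \<in> {(x, y). {x, y} \<in> E - K}\<^sup>*" by (simp add: X_def R_def)
    then obtain p where p: "path_betw u p v" "path_edges p \<subseteq> E - K" by (rule rtrancl_path_betw)
    have "path_betw u [u, v] v" using uv by (simp add: path_betw_def)
    moreover have "set p \<inter> set [u, v] = {u, v}" using path_betw_ends[OF p(1)] by auto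
    moreover have "path_edges p \<inter> path_edges [u, v] = {}" using p(2) e uv(1) by auto
    ultimately have "cycle_edges (path_edges p \<union> path_edges [u, v])"
      using cycle_edges_disjoint_betwI[OF p(1)] uv(2) by blast
    moreover have "path_edges p \<union> path_edges [u, v] \<subseteq> E" "e \<in> path_edges p \<union> path_edges [u, v]"
      using p(2) e(1) uv(1) by auto
    ultimately obtain e' where "e' \<in> path_edges p \<union> path_edges [u, v]" "e' \<in> K" "e' \<noteq> e" using Z by blast
    then show False using p(2) uv(1) by auto
  qed
  have "crosses X e" using uX vX uv(1) by (auto simp: crosses_def)
  moreover have "e' \<in> K" if e': "e' \<in> E" "crosses X e'" for e'
  proof (rule ccontr)
    assume n: "e' \<notin> K"
    obtain x where x: "x \<in> e'" "x \<in> X" using e'(2) by (auto simp: crosses_def)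
    obtain y where y: "e' = {x, y}" using edge_other[OF e'(1) x(1)] by blast
    then have "(x, y) \<in> R" using e'(1) n by (simp add: R_def)
    then have "y \<in> X" using x(2) unfolding X_def by (simp add: rtrancl_into_rtrancl)
    then show False using e'(2) y x by (auto simp: crosses_def)
  qed
  ultimately show ?thesis using XV by blast
qed

lemma crosses_complement: "e \<in> E \<Longrightarrow> crosses (V - X) e \<longleftrightarrow> crosses X e"
  using edge_subset[of e] edge_pair[of e] by (auto simp: crosses_def)

end

section \<open>Saving two faces\<close>

text \<open>All that remains of the drawing is \<open>span\<close>, by which every cycle is the sum
  modulo 2 of some faces. From here on the argument is combinatorial.\<close>

locale facial_cover = covered_cubic_graph V E \<Phi> bd
  for V :: "'a set" and E and \<Phi> :: "'f set" and bd +
  assumes span: "\<lbrakk>cycle_edges Z; Z \<subseteq> E\<rbrakk> \<Longrightarrow> \<exists>S \<subseteq> \<Phi>. \<forall>e \<in> E. e \<in> Z \<longleftrightarrow> card {\<phi> \<in> S. e \<in> bd \<phi>} = 1"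
begin

definition good :: "'f \<Rightarrow> bool" where
  "good f \<longleftrightarrow> (\<forall>\<phi>\<in>\<Phi>. \<phi> \<noteq> f \<longrightarrow> (\<forall>e\<in>bd \<phi> \<inter> bd f. \<forall>e'\<in>bd \<phi> \<inter> bd f. e = e'))"

section \<open>Sums of faces, 2-edge-cuts and good faces\<close>

lemma no_third_face:
  assumes "\<phi> \<in> \<Phi>" "\<psi> \<in> \<Phi>" "\<phi> \<noteq> \<psi>" "e \<in> bd \<phi>" "e \<in> bd \<psi>" "\<theta> \<in> \<Phi>" "\<theta> \<noteq> \<phi>" "\<theta> \<noteq> \<psi>"
  shows "e \<notin> bd \<theta>"
proof
  assume "e \<in> bd \<theta>"
  then have "\<theta> \<in> {\<theta> \<in> \<Phi>. e \<in> bd \<theta>}" using assms(6) by simp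
  then show False using two_faces[OF assms(1-5)] assms(7,8) by simp
qed

text \<open>The faces summing to \<open>Z\<close> play the role of one side of \<open>Z\<close>: an
  edge is counted once iff exactly one of its two faces is among them.\<close>

lemma cycle_sides:
  assumes "cycle_edges Z" "Z \<subseteq> E"
  obtains S where "\<And>e \<phi> \<psi>. \<lbrakk>\<phi> \<in> \<Phi>; \<psi> \<in> \<Phi>; \<phi> \<noteq> \<psi>; e \<in> bd \<phi>; e \<in> bd \<psi>\<rbrakk>
    \<Longrightarrow> e \<in> Z \<longleftrightarrow> \<not> (\<phi> \<in> S \<longleftrightarrow> \<psi> \<in> S)"
proof -
  obtain S where S: "S \<subseteq> \<Phi>" "\<And>e. e \<in> E \<Longrightarrow> e \<in> Z \<longleftrightarrow> card {\<phi> \<in> S. e \<in> bd \<phi>} = 1"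
    using span[OF assms] by metis
  show thesis
  proof (rule that[of S])
    fix e \<phi> \<psi> assume h: "\<phi> \<in> \<Phi>" "\<psi> \<in> \<Phi>" "\<phi> \<noteq> \<psi>" "e \<in> bd \<phi>" "e \<in> bd \<psi>"
    have "{\<theta> \<in> S. e \<in> bd \<theta>} = {\<theta> \<in> \<Phi>. e \<in> bd \<theta>} \<inter> S" using S(1) by blast
    also have "\<dots> = {\<phi>, \<psi>} \<inter> S" using two_faces[OF h] by simp
    finally have "card {\<theta> \<in> S. e \<in> bd \<theta>} = card ({\<phi>, \<psi>} \<inter> S)" by simp
    moreover have "e \<in> E" using face_cycle(2)[OF h(1)] h(4) by blast
    ultimately show "e \<in> Z \<longleftrightarrow> \<not> (\<phi> \<in> S \<longleftrightarrow> \<psi> \<in> S)"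
      using S(2)[of e] h(3) by (cases "\<phi> \<in> S"; cases "\<psi> \<in> S") (simp_all add: Int_insert_left)
  qed
qed

text \<open>A cycle through \<open>e1\<close> has \<open>A\<close> and \<open>B\<close> on different
  sides and therefore contains \<open>e2\<close> too, so some cut within \<open>{e1, e2}\<close>
  contains \<open>e1\<close>. The boundary of \<open>A\<close> crosses it a second time, so
  \<open>e2\<close> belongs to it as well.\<close>

lemma two_edge_cut:
  assumes AB: "A \<in> \<Phi>" "B \<in> \<Phi>" "A \<noteq> B" and e: "e1 \<in> bd A \<inter> bd B" "e2 \<in> bd A \<inter> bd B" "e1 \<noteq> e2"
  obtains X where "X \<subseteq> V" "\<And>e. e \<in> E \<Longrightarrow> crosses X e \<longleftrightarrow> e = e1 \<or> e = e2"
proof -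
  have E: "e1 \<in> E" "e2 \<in> E" using face_cycle(2)[OF AB(1)] e by auto
  have "\<exists>X \<subseteq> V. crosses X e1 \<and> (\<forall>e' \<in> E. crosses X e' \<longrightarrow> e' \<in> {e1, e2})"
  proof (rule cut_exists[OF E(1)])
    fix Z assume Z: "cycle_edges Z" "Z \<subseteq> E" "e1 \<in> Z"
    obtain S where S: "\<And>e \<phi> \<psi>. \<lbrakk>\<phi> \<in> \<Phi>; \<psi> \<in> \<Phi>; \<phi> \<noteq> \<psi>; e \<in> bd \<phi>; e \<in> bd \<psi>\<rbrakk>
      \<Longrightarrow> e \<in> Z \<longleftrightarrow> \<not> (\<phi> \<in> S \<longleftrightarrow> \<psi> \<in> S)" using cycle_sides[OF Z(1,2)] by metis
    have "e2 \<in> Z" using S[OF AB, of e1] S[OF AB, of e2] e Z(3) by simp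
    then show "\<exists>e'\<in>Z \<inter> {e1, e2}. e' \<noteq> e1" using e(3) by blast
  qed simp
  then obtain X where X: "X \<subseteq> V" "crosses X e1" "\<And>e'. \<lbrakk>e' \<in> E; crosses X e'\<rbrakk> \<Longrightarrow> e' = e1 \<or> e' = e2"
    by blast
  obtain e' where "e' \<in> bd A" "e' \<noteq> e1" "crosses X e'"
    using cycle_crosses_twice[OF face_cycle(1)[OF AB(1)] _ X(2)] e(1) by blast
  then have "crosses X e2" using X(3)[of e'] face_cycle(2)[OF AB(1)] by blast
  with that X show thesis by blast
qed

text \<open>A face in a minimal side of a 2-edge-cut is good, since a bad one would yield a smaller side.\<close>

lemma good_face_in_side:
  assumes "X \<subseteq> V" "A \<in> \<Phi>" "B \<in> \<Phi>" "A \<noteq> B" "e1 \<in> bd A \<inter> bd B" "e2 \<in> bd A \<inter> bd B" "e1 \<noteq> e2"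
    and "\<And>e. e \<in> E \<Longrightarrow> crosses X e \<longleftrightarrow> e = e1 \<or> e = e2"
  shows "\<exists>D \<in> \<Phi>. good D \<and> \<Union>(bd D) \<subseteq> X"
  using assms
proof (induction "card X" arbitrary: X A B e1 e2 rule: less_induct)
  case less
  note XV = less.prems(1) and AB = less.prems(2-4) and e = less.prems(5-7) and cr = less.prems(8)
  have E: "e1 \<in> E" "e2 \<in> E" using face_cycle(2)[OF AB(1)] e by auto
  have "crosses X e1" using cr[OF E(1)] by simp
  then obtain u where u: "u \<in> e1" "u \<in> X" by (auto simp: crosses_def)
  have uV: "u \<in> V" using u XV by blast
  \<comment> \<open>The face \<open>D\<close> chosen below lies in the corner of the two edges other
    than \<open>e1\<close> at the end \<open>u\<close> of \<open>e1\<close> in \<open>X\<close>. It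
    avoids \<open>e1\<close>, so it is neither \<open>A\<close> nor \<open>B\<close>, so it avoids
    \<open>e2\<close> too and cannot leave \<open>X\<close>.\<close>
  have "2 \<le> card ({x \<in> E. u \<in> x} - {e1})" using degree3[OF uV] E(1) u(1) by simp
  then obtain g1 g2 where g12: "g1 \<in> {x \<in> E. u \<in> x} - {e1}" "g2 \<in> {x \<in> E. u \<in> x} - {e1}" "g1 \<noteq> g2"
    by (auto simp: card_le_Suc_iff numeral_2_eq_2)
  have "card {\<phi> \<in> \<Phi>. g1 \<in> bd \<phi> \<and> g2 \<in> bd \<phi>} = 1"
    using corner_face[OF uV] g12 by simp
  then obtain D where "{\<phi> \<in> \<Phi>. g1 \<in> bd \<phi> \<and> g2 \<in> bd \<phi>} = {D}" using card_1_singletonE by blast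
  then have D: "D \<in> \<Phi>" "g1 \<in> bd D" "g2 \<in> bd D" by auto
  have st: "{x \<in> E. u \<in> x} = {e1, g1, g2}"
  proof (rule card_subset_eq[symmetric])
    show "finite {x \<in> E. u \<in> x}" using finite_E by simp
    show "{e1, g1, g2} \<subseteq> {x \<in> E. u \<in> x}" using g12 E(1) u(1) by auto
    have "e1 \<noteq> g1" "e1 \<noteq> g2" using g12 by auto
    then show "card {e1, g1, g2} = card {x \<in> E. u \<in> x}" using degree3[OF uV] g12(3) by simp
  qed
  have uD: "u \<in> \<Union>(bd D)" using D(2) g12(1) by auto
  have "e1 \<notin> bd D"
    using cycle_at[OF face_cycle[OF D(1)] uD st] D g12 by auto
  then have DAB: "D \<noteq> A" "D \<noteq> B" using e by auto
  have "e2 \<notin> bd D" using no_third_face[OF AB _ _ D(1) DAB] e(2) by blast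
  have "\<not> crosses X x" if "x \<in> bd D" for x
    using cr[of x] that face_cycle(2)[OF D(1)] \<open>e1 \<notin> bd D\<close> \<open>e2 \<notin> bd D\<close> by auto
  then have DX: "\<Union>(bd D) \<subseteq> X" using cycle_uniform[OF face_cycle(1)[OF D(1)], of X u] uD u(2) by blast
  show ?case
  proof (cases "good D")
    case True
    then show ?thesis using D(1) DX by blast
  next
    case False
    then obtain D2 g h where D2: "D2 \<in> \<Phi>" "D2 \<noteq> D" and gh: "g \<in> bd D \<inter> bd D2" "h \<in> bd D \<inter> bd D2" "g \<noteq> h"
      by (auto simp: good_def)
    obtain Z where Z: "Z \<subseteq> V" "\<And>e. e \<in> E \<Longrightarrow> crosses Z e \<longleftrightarrow> e = g \<or> e = h"
      using two_edge_cut[OF D(1) D2(1) _ gh] D2(2) by metis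
    \<comment> \<open>\<open>F\<close> is one of \<open>A\<close> and \<open>B\<close>, different
      from \<open>D2\<close>. It avoids \<open>g\<close> and \<open>h\<close>, so it lies on one
      side of the new cut, and \<open>Z1\<close> is the other side.\<close>
    obtain F where F: "F \<in> \<Phi>" "F \<noteq> D" "F \<noteq> D2" "e1 \<in> bd F" "e2 \<in> bd F"
      using AB DAB e by (cases "D2 = A") auto
    have gF: "g \<notin> bd F" "h \<notin> bd F"
      using no_third_face[OF D(1) D2(1) D2(2)[symmetric] _ _ F(1-3)] gh by blast+
    have uF: "u \<in> \<Union>(bd F)" using u(1) F(4) by blast
    define Z1 where "Z1 = (if u \<in> Z then V - Z else Z)"
    have Z1: "\<And>e. e \<in> E \<Longrightarrow> crosses Z1 e \<longleftrightarrow> e = g \<or> e = h" "u \<notin> Z1"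
      using Z(2) crosses_complement by (auto simp: Z1_def)
    have FZ: "x \<notin> Z1" if "x \<in> \<Union>(bd F)" for x
    proof -
      have "\<not> crosses Z1 y" if "y \<in> bd F" for y
        using Z1(1)[of y] that face_cycle(2)[OF F(1)] gF by blast
      then show ?thesis using cycle_uniform[OF face_cycle(1)[OF F(1)] _ uF that] Z1(2) by blast
    qed
    have ghE: "g \<in> E" "h \<in> E" using gh face_cycle(2)[OF D(1)] by auto
    \<comment> \<open>The edges \<open>e1\<close> and \<open>e2\<close> of the old cut lie on
      \<open>F\<close> and have no end in \<open>Z1\<close>, while \<open>g\<close> and
      \<open>h\<close> lie on \<open>D\<close> and thus inside \<open>X\<close>. So the intersection
      has just the new cut, and it is smaller than \<open>X\<close> because it misses
      \<open>u\<close>.\<close>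
    have cr': "crosses (X \<inter> Z1) x \<longleftrightarrow> x = g \<or> x = h" if x: "x \<in> E" for x
    proof
      assume c: "crosses (X \<inter> Z1) x"
      then obtain y where y: "y \<in> x" "y \<in> X" "y \<in> Z1" by (auto simp: crosses_def)
      obtain z where z: "x = {y, z}" using edge_other[OF x y(1)] by blast
      have "\<not> crosses X x"
      proof
        assume "crosses X x"
        then have "x \<in> bd F" using cr[OF x] F(4,5) by auto
        then show False using FZ[of y] y by blast
      qed
      then have "z \<in> X" using z y by (auto simp: crosses_def)
      then have "crosses Z1 x" using c z y by (auto simp: crosses_def)
      then show "x = g \<or> x = h" using Z1(1)[OF x] by simp
    next
      assume xgh: "x = g \<or> x = h"
      then have "crosses Z1 x" using Z1(1)[OF x] by simp
      moreover have "x \<subseteq> X" using xgh gh DX by blast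
      ultimately show "crosses (X \<inter> Z1) x" by (auto simp: crosses_def)
    qed
    have "X \<inter> Z1 \<subset> X" using u(2) Z1(2) by blast
    then have "card (X \<inter> Z1) < card X"
      using psubset_card_mono finite_subset[OF XV finite_V] by blast
    then have "\<exists>D' \<in> \<Phi>. good D' \<and> \<Union>(bd D') \<subseteq> X \<inter> Z1"
      by (rule less.hyps[OF _ _ D(1) D2(1) _ gh cr']) (use XV D2(2) in auto)
    then obtain D' where "D' \<in> \<Phi>" "good D'" "\<Union>(bd D') \<subseteq> X \<inter> Z1" by (elim bexE conjE)
    then show ?thesis using order_trans[OF _ Int_lower1] by (intro bexI[of _ D'] conjI)
  qed
qed

text \<open>
  If the faces across the \<open>i\<close>-th and \<open>k\<close>-th edge of \<open>f\<close> share an edge \<open>g\<close>, then these two edges and \<open>g\<close>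
  contain a cut of the graph, which separates the faces across the \<open>j\<close>-th and \<open>l\<close>-th edge.
\<close>

lemma neighbours_noncrossing:
  assumes f: "f \<in> \<Phi>" and q: "bd f = path_edges q" "hd q = last q"
    and A: "\<And>i. Suc i < length q \<Longrightarrow> A i \<in> \<Phi> \<and> A i \<noteq> f \<and> {q ! i, q ! Suc i} \<in> bd (A i)"
    and inj: "\<And>i j. \<lbrakk>Suc i < length q; Suc j < length q; A i = A j\<rbrakk> \<Longrightarrow> i = j"
    and ord: "i < j" "j < k" "k < l" "Suc l < length q"
    and R: "bd (A i) \<inter> bd (A k) \<noteq> {}" "bd (A j) \<inter> bd (A l) \<noteq> {}"
  shows False
proof -
  define ed where "ed m = {q ! m, q ! Suc m}" for m
  have edf: "ed m \<in> bd f" if "Suc m < length q" for m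
    using that unfolding q(1) path_edges_nth ed_def by blast
  have edA: "ed m \<in> bd (A m)" "A m \<in> \<Phi>" "A m \<noteq> f" if "Suc m < length q" for m
    using A[OF that] by (auto simp: ed_def)
  have edn: "ed m \<notin> bd (A m')" if m: "Suc m < length q" "Suc m' < length q" "m \<noteq> m'" for m m'
  proof (rule no_third_face[OF f edA(2)[OF m(1)] _ edf[OF m(1)] edA(1)[OF m(1)] edA(2)[OF m(2)] edA(3)[OF m(2)]])
    show "f \<noteq> A m" using edA(3)[OF m(1)] by blast
    show "A m' \<noteq> A m" using inj[OF m(2,1)] m(3) by blast
  qed
  have len: "Suc i < length q" "Suc j < length q" "Suc k < length q" using ord by auto
  obtain g where g: "g \<in> bd (A i)" "g \<in> bd (A k)" using R(1) by blast
  have Aik: "A i \<noteq> A k" using inj[OF len(1,3)] ord by auto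
  note fg = no_third_face[OF edA(2)[OF len(1)] edA(2)[OF len(3)] Aik g]
  have edE: "ed i \<in> E" using edf[OF len(1)] face_cycle(2)[OF f] by blast
  \<comment> \<open>Among the three pairs formed by \<open>A i\<close>, \<open>f\<close> and
    \<open>A k\<close>, a cycle separates an even number, so together with \<open>ed i\<close> it
    contains \<open>ed k\<close> or \<open>g\<close>.\<close>
  have "\<exists>X \<subseteq> V. crosses X (ed i) \<and> (\<forall>e' \<in> E. crosses X e' \<longrightarrow> e' \<in> {ed i, ed k, g})"
  proof (rule cut_exists[OF edE])
    fix Z assume Z: "cycle_edges Z" "Z \<subseteq> E" "ed i \<in> Z"
    obtain S where S: "\<And>e \<phi> \<psi>. \<lbrakk>\<phi> \<in> \<Phi>; \<psi> \<in> \<Phi>; \<phi> \<noteq> \<psi>; e \<in> bd \<phi>; e \<in> bd \<psi>\<rbrakk>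
      \<Longrightarrow> e \<in> Z \<longleftrightarrow> \<not> (\<phi> \<in> S \<longleftrightarrow> \<psi> \<in> S)" using cycle_sides[OF Z(1,2)] by metis
    have "ed i \<in> Z \<longleftrightarrow> \<not> (A i \<in> S \<longleftrightarrow> f \<in> S)"
      by (rule S) (use edA[OF len(1)] edf[OF len(1)] f in auto)
    moreover have "ed k \<in> Z \<longleftrightarrow> \<not> (A k \<in> S \<longleftrightarrow> f \<in> S)"
      by (rule S) (use edA[OF len(3)] edf[OF len(3)] f in auto)
    moreover have "g \<in> Z \<longleftrightarrow> \<not> (A i \<in> S \<longleftrightarrow> A k \<in> S)"
      by (rule S) (use edA(2)[OF len(1)] edA(2)[OF len(3)] Aik g in auto)
    ultimately have "ed k \<in> Z \<or> g \<in> Z" using Z(3) by blast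
    moreover have "ed k \<noteq> ed i" "g \<noteq> ed i"
      using edn[OF len(1,3)] edA(1)[OF len(3)] g(2) ord by auto
    ultimately show "\<exists>e'\<in>Z \<inter> {ed i, ed k, g}. e' \<noteq> ed i" by blast
  qed simp
  then obtain X where X: "crosses X (ed i)" "\<And>e'. \<lbrakk>e' \<in> E; crosses X e'\<rbrakk> \<Longrightarrow> e' \<in> {ed i, ed k, g}"
    by blast
  have gf: "g \<notin> bd f" using fg[OF f] edA(3)[OF len(1)] edA(3)[OF len(3)] by blast
  have ed_inj: "ed m \<noteq> ed m'" if m: "Suc m < length q" "Suc m' < length q" "m \<noteq> m'" for m m'
    using edn[OF m] edA(1)[OF m(2)] by metis
  \<comment> \<open>Along \<open>f\<close> the side of \<open>X\<close> can change only at
    \<open>ed i\<close> and \<open>ed k\<close>, and it does change at \<open>ed i\<close>, so the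
    two stretches between these edges, one with \<open>q ! j\<close> and one with
    \<open>q ! l\<close>, lie on opposite sides.\<close>
  have step: "q ! m \<in> X \<longleftrightarrow> q ! Suc m \<in> X" if m: "Suc m < length q" "m \<noteq> i" "m \<noteq> k" for m
  proof -
    have "ed m \<noteq> ed i" "ed m \<noteq> ed k" "ed m \<noteq> g"
      using ed_inj[OF m(1) len(1) m(2)] ed_inj[OF m(1) len(3) m(3)] gf edf[OF m(1)] by auto
    then have "\<not> crosses X (ed m)" using X(2)[of "ed m"] edf[OF m(1)] face_cycle(2)[OF f] by blast
    then show ?thesis by (auto simp: crosses_def ed_def)
  qed
  have seg: "q ! m \<in> X \<longleftrightarrow> q ! m' \<in> X" if "m \<le> m'" "m' < length q" "\<And>x. m \<le> x \<Longrightarrow> x < m' \<Longrightarrow> x \<noteq> i \<and> x \<noteq> k" for m m'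
    using that
  proof (induction m' rule: nat_induct_at_least[of m])
    case (Suc n)
    then show ?case using step[of n] by simp
  qed (use that in auto)
  have jX: "q ! j \<in> X \<longleftrightarrow> q ! Suc i \<in> X" using seg[of "Suc i" j] ord by auto
  have lX: "q ! l \<in> X \<longleftrightarrow> q ! (length q - 1) \<in> X" using seg[of l "length q - 1"] ord by auto
  have iX: "q ! 0 \<in> X \<longleftrightarrow> q ! i \<in> X" using seg[of 0 i] ord by auto
  have "q \<noteq> []" using ord by auto
  then have "q ! 0 = q ! (length q - 1)" using q(2) by (simp add: hd_conv_nth last_conv_nth)
  then have opp: "q ! j \<in> X \<longleftrightarrow> q ! l \<notin> X" using jX lX iX X(1) by (auto simp: crosses_def ed_def)
  \<comment> \<open>The faces across the other edges of \<open>f\<close> avoid all three edges that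
    may cross \<open>X\<close>, so each lies on one side as a whole.\<close>
  have unif: "x \<in> X \<longleftrightarrow> q ! m \<in> X"
    if m: "Suc m < length q" "m \<noteq> i" "m \<noteq> k" and x: "x \<in> \<Union>(bd (A m))" for m x
  proof (rule cycle_uniform[OF face_cycle(1)[OF edA(2)[OF m(1)]] _ x])
    show "q ! m \<in> \<Union>(bd (A m))" using edA(1)[OF m(1)] by (auto simp: ed_def)
    have ne: "A m \<noteq> A i" "A m \<noteq> A k" using inj[OF m(1) len(1)] inj[OF m(1) len(3)] m by auto
    have n: "ed i \<notin> bd (A m)" "ed k \<notin> bd (A m)" "g \<notin> bd (A m)"
      using edn[OF len(1) m(1)] edn[OF len(3) m(1)] fg[OF edA(2)[OF m(1)] ne] m(2,3) by auto
    show "\<not> crosses X e" if "e \<in> bd (A m)" for e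
      using X(2)[of e] that n face_cycle(2)[OF edA(2)[OF m(1)]] by blast
  qed
  obtain h where h: "h \<in> bd (A j)" "h \<in> bd (A l)" using R(2) by blast
  have "h \<in> E" using h face_cycle(2)[OF edA(2)[OF len(2)]] by blast
  then obtain x where "x \<in> h" using edge_pair by blast
  then have "x \<in> X \<longleftrightarrow> q ! j \<in> X" "x \<in> X \<longleftrightarrow> q ! l \<in> X"
    using unif[OF len(2), of x] unif[OF ord(4), of x] h ord by auto
  then show False using opp by blast
qed

lemma good_face_colouring:
  assumes f: "f \<in> \<Phi>" and good: "good f"
  obtains c :: "'f \<Rightarrow> nat" where "\<And>\<phi>. c \<phi> < 3"
    "\<And>\<phi> \<psi>. \<lbrakk>\<phi> \<in> \<Phi>; \<psi> \<in> \<Phi>; \<phi> \<noteq> f; \<psi> \<noteq> f; \<phi> \<noteq> \<psi>; bd \<phi> \<inter> bd f \<noteq> {}; bd \<psi> \<inter> bd f \<noteq> {}; c \<phi> = c \<psi>\<rbrakk>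
       \<Longrightarrow> bd \<phi> \<inter> bd \<psi> = {}"
proof -
  obtain p where p: "distinct p" "3 \<le> length p" "bd f = path_edges (p @ [hd p])"
    using face_cycle(1)[OF f] by (auto simp: cycle_edges_def)
  define q where "q = p @ [hd p]"
  have q: "bd f = path_edges q" "hd q = last q" "length q = Suc (length p)"
    using p by (auto simp: q_def hd_append)
  let ?n = "length p"
  define ed where "ed m = {q ! m, q ! Suc m}" for m
  have bdf: "bd f = ed ` {..<?n}" unfolding q(1) path_edges_nth ed_def using q(3) by auto
  have "card (bd f) = ?n"
  proof -
    have "\<Union>(bd f) = set q" unfolding q(1) using q(3) p(2) by (intro Union_path_edges) simp
    also have "\<dots> = set p" using p(2) by (cases p) (auto simp: q_def)
    finally show ?thesis using cycle_edges_card_Union(1)[OF face_cycle(1)[OF f]] distinct_card[OF p(1)] by simp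
  qed
  then have ed_inj: "inj_on ed {..<?n}" by (intro eq_card_imp_inj_on) (simp_all add: bdf)
  have "\<exists>A. A \<in> \<Phi> \<and> A \<noteq> f \<and> ed i \<in> bd A" if i: "i < ?n" for i
  proof -
    have "ed i \<in> bd f" using bdf i by blast
    then show ?thesis using other_face[OF f] by metis
  qed
  then obtain A where A: "\<And>i. i < ?n \<Longrightarrow> A i \<in> \<Phi> \<and> A i \<noteq> f \<and> ed i \<in> bd (A i)" by metis
  have inj: "i = j" if "i < ?n" "j < ?n" "A i = A j" for i j
  proof -
    have "ed i \<in> bd (A i)" "ed j \<in> bd (A i)" using A[OF that(1)] A[OF that(2)] that(3) by simp_all
    moreover have "ed i \<in> bd f" "ed j \<in> bd f" using bdf that by blast+
    ultimately have "ed i \<in> bd (A i) \<inter> bd f" "ed j \<in> bd (A i) \<inter> bd f" by blast+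
    then have "ed i = ed j" using good A[OF that(1)] unfolding good_def by blast
    then show ?thesis using ed_inj that by (auto simp: inj_on_def)
  qed
  define R where "R i j \<longleftrightarrow> bd (A i) \<inter> bd (A j) \<noteq> {}" for i j
  have "\<exists>c :: nat \<Rightarrow> nat. (\<forall>i. c i < 3) \<and> (\<forall>i j. 0 \<le> i \<and> i < j \<and> j \<le> ?n - 1 \<and> R i j \<longrightarrow> c i \<noteq> c j) \<and>
    (0 < ?n - 1 \<longrightarrow> c 0 \<noteq> c (?n - 1))"
  proof (rule noncrossing_3_colourable)
    fix i j k l assume h: "0 \<le> i" "i < j" "j < k" "k < l" "l \<le> ?n - 1" "R i k" "R j l"
    show False
    proof (rule neighbours_noncrossing[OF f q(1,2), of A i j k l])
      show "A i \<in> \<Phi> \<and> A i \<noteq> f \<and> {q ! i, q ! Suc i} \<in> bd (A i)" if "Suc i < length q" for i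
        using A[of i] that q(3) by (simp add: ed_def)
      show "i = j" if "Suc i < length q" "Suc j < length q" "A i = A j" for i j
        using inj[of i j] that q(3) by simp
    qed (use h p(2) q(3) in \<open>auto simp: R_def\<close>)
  qed simp
  then obtain c :: "nat \<Rightarrow> nat" where "\<forall>i. c i < 3"
    "\<forall>i j. 0 \<le> i \<and> i < j \<and> j \<le> ?n - 1 \<and> R i j \<longrightarrow> c i \<noteq> c j"
    by (elim exE conjE) (rule that)
  then have c: "\<And>i. c i < 3" "\<And>i j. \<lbrakk>i < j; j \<le> ?n - 1; R i j\<rbrakk> \<Longrightarrow> c i \<noteq> c j"
    by simp_all
  have c': "\<not> R i j" if "i < ?n" "j < ?n" "i \<noteq> j" "c i = c j" for i j
  proof -
    have "R i j \<longleftrightarrow> R j i" by (auto simp: R_def)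
    moreover have "i \<le> ?n - 1" "j \<le> ?n - 1" using that by linarith+
    ultimately show ?thesis using c(2)[of i j] c(2)[of j i] that(3,4) by (cases "i < j") auto
  qed
  \<comment> \<open>Colours pass from positions on \<open>f\<close> to the faces there. On other
    faces the value of \<open>inv_into\<close> is arbitrary, which is harmless because
    \<open>c\<close> is below 3 everywhere.\<close>
  define d where "d \<phi> = c (inv_into {..<?n} A \<phi>)" for \<phi>
  have injA: "inj_on A {..<?n}" by (rule inj_onI) (use inj in simp)
  have dA: "d (A i) = c i" if "i < ?n" for i using that injA by (simp add: d_def inv_into_f_f)
  have nbr: "\<exists>i < ?n. \<phi> = A i" if \<phi>: "\<phi> \<in> \<Phi>" "\<phi> \<noteq> f" "bd \<phi> \<inter> bd f \<noteq> {}" for \<phi>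
  proof -
    obtain i where i: "i < ?n" "ed i \<in> bd \<phi>" using \<phi>(3) bdf by auto
    have "ed i \<in> bd f" using bdf i(1) by blast
    then have "\<phi> = A i" using no_third_face[OF f, of "A i" "ed i" \<phi>] A[OF i(1)] \<phi> i(2) by metis
    then show ?thesis using i(1) by blast
  qed
  show thesis
  proof (rule that[of d])
    show "d \<phi> < 3" for \<phi> using c(1) by (simp add: d_def)
    fix \<phi> \<psi> assume h: "\<phi> \<in> \<Phi>" "\<psi> \<in> \<Phi>" "\<phi> \<noteq> f" "\<psi> \<noteq> f" "\<phi> \<noteq> \<psi>" "bd \<phi> \<inter> bd f \<noteq> {}" "bd \<psi> \<inter> bd f \<noteq> {}" "d \<phi> = d \<psi>"
    obtain i where i: "i < ?n" "\<phi> = A i" using nbr h by blast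
    obtain j where j: "j < ?n" "\<psi> = A j" using nbr h by blast
    have "\<not> R i j" using c'[OF i(1) j(1)] h(5,8) i j dA by auto
    then show "bd \<phi> \<inter> bd \<psi> = {}" using i j by (simp add: R_def)
  qed
qed

section \<open>Long good faces, disjoint triangles and the case distinction\<close>

lemma long_good_face:
  assumes f: "f \<in> \<Phi>" "good f" "4 \<le> card (bd f)"
  shows "\<exists>M. mset_cover M \<and> size M + 2 \<le> card \<Phi>"
proof -
  obtain c :: "'f \<Rightarrow> nat" where c: "\<And>\<phi>. c \<phi> < 3"
    "\<And>\<phi> \<psi>. \<lbrakk>\<phi> \<in> \<Phi>; \<psi> \<in> \<Phi>; \<phi> \<noteq> f; \<psi> \<noteq> f; \<phi> \<noteq> \<psi>; bd \<phi> \<inter> bd f \<noteq> {}; bd \<psi> \<inter> bd f \<noteq> {}; c \<phi> = c \<psi>\<rbrakk>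
       \<Longrightarrow> bd \<phi> \<inter> bd \<psi> = {}"
    using good_face_colouring[OF f(1,2)] by metis
  have "\<exists>M. mset_cover M \<and> size M + card (bd f) = card \<Phi> + 2"
  proof (rule good_face_recolour[OF f(1), of c])
    show "e = e'" if "\<phi> \<in> \<Phi>" "\<phi> \<noteq> f" "e \<in> bd \<phi> \<inter> bd f" "e' \<in> bd \<phi> \<inter> bd f" for \<phi> e e'
      using f(2) that unfolding good_def by blast
  qed (use c in auto)
  then show ?thesis using f(3) by fastforce
qed

text \<open>Each triangle saves one cycle. As \<open>g\<close> shares no edge with \<open>f\<close>,
  the first removal leaves it unchanged and it can be removed in turn.\<close>

lemma two_triangles:
  assumes f: "f \<in> \<Phi>" "card (bd f) = 3" and g: "g \<in> \<Phi>" "card (bd g) = 3" and fg: "bd f \<inter> bd g = {}"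
  shows "\<exists>M. mset_cover M \<and> size M + 2 \<le> card \<Phi>"
proof -
  define b where "b \<phi> = (if bd \<phi> \<inter> bd f = {} then bd \<phi> else (bd \<phi> - bd f) \<union> (bd f - bd \<phi>))" for \<phi>
  have dc1: "double_cover (\<Phi> - {f}) b" using triangle_removal[OF f] by (simp add: b_def[abs_def])
  interpret B: covered_cubic_graph V E "\<Phi> - {f}" b by unfold_locales (rule dc1)
  have "g \<noteq> f" using fg f(2) by auto
  moreover have "b g = bd g" using fg by (auto simp: b_def)
  ultimately obtain b' where dc2: "double_cover (\<Phi> - {f} - {g}) b'"
    using B.triangle_removal[of g] g by auto
  have "card (\<Phi> - {f} - {g}) + 2 = card \<Phi>"
    using f(1) g(1) \<open>g \<noteq> f\<close> finite_faces card_Suc_Diff1[of \<Phi> f] card_Suc_Diff1[of "\<Phi> - {f}" g] by simp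
  then show ?thesis using double_cover_mset[OF dc2] by (metis order_refl)
qed

lemma triangle_third_edge:
  assumes K: "cycle_edges K" "card K = 3" and e: "{v, a} \<in> K" "{v, b} \<in> K" and d: "a \<noteq> b" "v \<noteq> a" "v \<noteq> b"
  shows "{a, b} \<in> K"
proof -
  obtain p where p: "path_betw v p a" "K = insert {v, a} (path_edges p)" "{v, a} \<notin> path_edges p"
    using cycle_edges_remove[OF K(1) e(1) d(2)] by metis
  have "card (path_edges p) = 2" using K(2) p(2,3) by simp
  then have l: "length p = 3" using card_path_edges[of p] p(1) by (simp add: path_betw_def)
  obtain m where m: "p = v # m @ [a]" using path_betw_snoc_form[OF p(1) d(2)] by blast
  then obtain x where x: "p = [v, x, a]" using l by (cases m) auto
  have "{v, b} \<in> {{v, a}, {v, x}, {x, a}}" using e(2) p(2) x by simp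
  then have "b = x" using d by (auto simp: doubleton_eq_iff)
  then show ?thesis using p(2) x by (auto simp: insert_commute)
qed

text \<open>If all faces were triangles, the face in each corner would make any two neighbours of a
  vertex adjacent. A vertex and its at most three neighbours would then be closed under
  adjacency.\<close>

lemma long_face_exists:
  assumes n: "card V > 4"
  shows "\<exists>f \<in> \<Phi>. 4 \<le> card (bd f)"
proof (rule ccontr)
  assume "\<not> ?thesis"
  then have three: "card (bd f) = 3" if "f \<in> \<Phi>" for f
    using that cycle_edges_card_Union(3)[OF face_cycle(1)[OF that]] by force
  have tri: "{a, b} \<in> E" if e: "{v, a} \<in> E" "{v, b} \<in> E" "a \<noteq> b" "v \<noteq> a" "v \<noteq> b" for v a b
  proof -
    have "v \<in> V" using edge_subset[OF e(1)] by simp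
    then have "card {\<phi> \<in> \<Phi>. {v, a} \<in> bd \<phi> \<and> {v, b} \<in> bd \<phi>} = 1"
      using e by (intro corner_face) (auto simp: doubleton_eq_iff)
    then obtain \<phi> where \<phi>: "\<phi> \<in> \<Phi>" "{v, a} \<in> bd \<phi>" "{v, b} \<in> bd \<phi>"
      by (metis (mono_tags, lifting) card_1_singletonE insertI1 mem_Collect_eq)
    then show ?thesis
      using triangle_third_edge[OF face_cycle(1)[OF \<phi>(1)] three[OF \<phi>(1)] \<phi>(2,3)] face_cycle(2)[OF \<phi>(1)] e by blast
  qed
  obtain v where v: "v \<in> V" using V_nonempty by blast
  define W where "W = insert v {w. {v, w} \<in> E}"
  have WV: "W \<subseteq> V" using v edge_subset by (auto simp: W_def)
  have closed: "y \<in> W" if h: "x \<in> W" "{x, y} \<in> E" for x y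
  proof (rule ccontr)
    assume y: "y \<notin> W"
    have xv: "x \<noteq> v" using y h by (auto simp: W_def)
    then have vx: "{v, x} \<in> E" using h(1) by (simp add: W_def)
    have "x \<noteq> y" using y h by auto
    moreover have "v \<noteq> y" using y by (auto simp: W_def)
    ultimately have "{v, y} \<in> E" using tri[of x v y] vx h(2) xv by (simp add: insert_commute)
    then show False using y by (simp add: W_def)
  qed
  have "{w. {v, w} \<in> E} \<subseteq> (\<lambda>e. THE w. e = {v, w}) ` {e \<in> E. v \<in> e}"
  proof
    fix w assume "w \<in> {w. {v, w} \<in> E}"
    moreover have "(THE w'. {v, w} = {v, w'}) = w" by (rule the_equality) (auto simp: doubleton_eq_iff)
    ultimately show "w \<in> (\<lambda>e. THE w. e = {v, w}) ` {e \<in> E. v \<in> e}" by (intro image_eqI[of _ _ "{v, w}"]) auto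
  qed
  then have "card {w. {v, w} \<in> E} \<le> 3"
    using surj_card_le[of "{e \<in> E. v \<in> e}" "{w. {v, w} \<in> E}"] finite_E degree3[OF v] by simp
  then have cW: "card W \<le> 4" unfolding W_def using card_insert_le_m1[of 4] by simp
  \<comment> \<open>By \<open>card_E\<close> the order is even, so at least two vertices lie outside
    \<open>W\<close>: one to serve as \<open>a\<close> and one as \<open>z\<close> in
    \<open>nonseparating\<close>.\<close>
  have "card V \<noteq> 5" using card_E by presburger
  then have "2 \<le> card (V - W)" using n cW card_Diff_subset[OF finite_subset[OF WV finite_V] WV] by simp
  then obtain a z where "a \<in> V - W" "z \<in> V - W" "z \<noteq> a"
    by (auto simp: card_le_Suc_iff numeral_2_eq_2)
  then obtain w x where "w \<in> W" "x \<in> V - W" "{w, x} \<in> E"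
    using nonseparating[OF WV, of a z] by (auto simp: W_def)
  then show False using closed by blast
qed

theorem small_mset_cover:
  assumes n: "card V > 4"
  shows "\<exists>M. mset_cover M \<and> size M + 2 \<le> card \<Phi>"
proof (cases "\<forall>f \<in> \<Phi>. good f")
  case True
  then show ?thesis using long_face_exists[OF n] long_good_face by blast
next
  case False
  then obtain A B e1 e2 where AB: "A \<in> \<Phi>" "B \<in> \<Phi>" "A \<noteq> B"
    and e: "e1 \<in> bd A \<inter> bd B" "e2 \<in> bd A \<inter> bd B" "e1 \<noteq> e2"
    by (auto simp: good_def)
  obtain X where X: "X \<subseteq> V" "\<And>e. e \<in> E \<Longrightarrow> crosses X e \<longleftrightarrow> e = e1 \<or> e = e2"
    using two_edge_cut[OF AB e] by metis
  have "\<exists>D \<in> \<Phi>. good D \<and> \<Union>(bd D) \<subseteq> X"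
    by (rule good_face_in_side[OF X(1) AB e X(2)])
  then obtain D where D: "D \<in> \<Phi>" "good D" "\<Union>(bd D) \<subseteq> X" by (elim bexE conjE)
  have "\<exists>D' \<in> \<Phi>. good D' \<and> \<Union>(bd D') \<subseteq> V - X"
  proof (rule good_face_in_side[OF _ AB e])
    show "crosses (V - X) x \<longleftrightarrow> x = e1 \<or> x = e2" if "x \<in> E" for x
      using X(2)[OF that] crosses_complement[OF that] by simp
  qed auto
  then obtain D' where D': "D' \<in> \<Phi>" "good D'" "\<Union>(bd D') \<subseteq> V - X" by (elim bexE conjE)
  show ?thesis
  proof (cases "4 \<le> card (bd D) \<or> 4 \<le> card (bd D')")
    case True
    then show ?thesis using long_good_face D D' by blast
  next
    case False
    then have "card (bd D) = 3" "card (bd D') = 3"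
      using cycle_edges_card_Union(3)[OF face_cycle(1)[OF D(1)]] cycle_edges_card_Union(3)[OF face_cycle(1)[OF D'(1)]]
      by auto
    moreover have "bd D \<inter> bd D' = {}"
    proof (rule ccontr)
      assume "bd D \<inter> bd D' \<noteq> {}"
      then obtain x where x: "x \<in> bd D" "x \<in> bd D'" by blast
      then have "x \<in> E" using face_cycle(2)[OF D(1)] by blast
      then obtain y where "y \<in> x" using edge_pair by blast
      then show False using x D(3) D'(3) by blast
    qed
    ultimately show ?thesis using two_triangles D(1) D'(1) by blast
  qed
qed

end

section \<open>From digraphs to edge sets\<close>

lemma rtrancl_leaves:
  assumes "(w, z) \<in> r\<^sup>*" "w \<in> W" "z \<notin> W"
  shows "\<exists>x y. (x, y) \<in> r \<and> x \<in> W \<and> y \<notin> W"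
  using assms by (induction rule: rtrancl_induct) auto

definition undirected_edges :: "'a pair_pre_digraph \<Rightarrow> 'a set set" where
  "undirected_edges G = {{u, v} |u v. (u, v) \<in> parcs G}"

definition digraph_of :: "'a set set \<Rightarrow> 'a pair_pre_digraph" where
  "digraph_of K = \<lparr>pverts = \<Union>K, parcs = {(u, v). {u, v} \<in> K}\<rparr>"

lemma digraph_of_simps [simp]:
  "pverts (digraph_of K) = \<Union>K" "(u, v) \<in> parcs (digraph_of K) \<longleftrightarrow> {u, v} \<in> K"
  by (auto simp: digraph_of_def)

text \<open>Serves both directions of the translation: the degree condition on the given graph and
  the 2-regularity of the constructed cycles.\<close>

lemma out_degree_digraph_of:
  assumes "\<And>u v. (u, v) \<in> parcs G \<longleftrightarrow> {u, v} \<in> K" and pair: "\<And>e. e \<in> K \<Longrightarrow> \<exists>u v. e = {u, v} \<and> u \<noteq> v"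
  shows "out_degree (with_proj G) v = card {e \<in> K. v \<in> e}"
proof -
  have "bij_betw (\<lambda>a. {fst a, snd a}) (out_arcs (with_proj G) v) {e \<in> K. v \<in> e}"
    unfolding bij_betw_def
  proof
    show "inj_on (\<lambda>a. {fst a, snd a}) (out_arcs (with_proj G) v)"
      by (auto simp: inj_on_def out_arcs_def doubleton_eq_iff)
    show "(\<lambda>a. {fst a, snd a}) ` out_arcs (with_proj G) v = {e \<in> K. v \<in> e}"
    proof
      show "(\<lambda>a. {fst a, snd a}) ` out_arcs (with_proj G) v \<subseteq> {e \<in> K. v \<in> e}"
        using assms(1) by (auto simp: out_arcs_def)
      show "{e \<in> K. v \<in> e} \<subseteq> (\<lambda>a. {fst a, snd a}) ` out_arcs (with_proj G) v"
      proof
        fix e assume e: "e \<in> {e \<in> K. v \<in> e}"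
        then obtain u where u: "e = {v, u}" using pair[of e] by auto
        then have "(v, u) \<in> out_arcs (with_proj G) v" using e assms(1) by (auto simp: out_arcs_def)
        then show "e \<in> (\<lambda>a. {fst a, snd a}) ` out_arcs (with_proj G) v"
          using u by (intro image_eqI[of _ _ "(v, u)"]) auto
      qed
    qed
  qed
  then show ?thesis unfolding out_degree_def by (rule bij_betw_same_card)
qed

lemma cycle_graph_digraph_of:
  assumes K: "cycle_edges K"
  shows "cycle_graph (digraph_of K)"
proof -
  have pair: "\<exists>u v. e = {u, v} \<and> u \<noteq> v" if "e \<in> K" for e
    using cycle_edges_pair[OF K that] by metis
  have fin: "finite (\<Union>K)" using cycle_edges_card_Union[OF K] by simp
  have arcs_sub: "parcs (digraph_of K) \<subseteq> \<Union>K \<times> \<Union>K" by (auto simp: digraph_of_def)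
  have pg: "pair_graph (digraph_of K)"
  proof unfold_locales
    show "finite (pverts (digraph_of K))" using fin by simp
    show "finite (parcs (digraph_of K))" using arcs_sub fin by (meson finite_SigmaI finite_subset)
    show "fst e \<in> pverts (digraph_of K)" "snd e \<in> pverts (digraph_of K)" if "e \<in> parcs (digraph_of K)" for e
      using subsetD[OF arcs_sub that] by (simp_all add: mem_Times_iff)
    show "fst e \<noteq> snd e" if "e \<in> parcs (digraph_of K)" for e
    proof -
      have "{fst e, snd e} \<in> K" using that by (cases e) simp
      then show ?thesis using pair[of "{fst e, snd e}"] by (auto simp: doubleton_eq_iff)
    qed
    show "symmetric (with_proj (digraph_of K))"
      by (auto simp: symmetric_def sym_def insert_commute)
  qed
  interpret pair_graph "digraph_of K" by (rule pg)
  have reach: "reachable (with_proj (digraph_of K)) (hd p) (last p)"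
    if "p \<noteq> []" "hd p \<in> \<Union>K" "path_edges p \<subseteq> K" for p
    using that
  proof (induction p rule: path_edges.induct)
    case (1 x y xs)
    have "{x, y} \<in> K" using 1(4) by simp
    then have "(x, y) \<in> arcs_ends (with_proj (digraph_of K))" by simp
    moreover have "reachable (with_proj (digraph_of K)) y (last (y # xs))"
    proof -
      have "y \<in> \<Union>K" using \<open>{x, y} \<in> K\<close> by blast
      then show ?thesis using "1.IH" "1.prems"(3) by simp
    qed
    ultimately show ?case using adj_reachable_trans[of x y] by simp
  qed auto
  have "reachable (with_proj (mk_symmetric (with_proj (digraph_of K)))) u v"
    if uv: "u \<in> \<Union>K" "v \<in> \<Union>K" for u v
  proof (rule reachable_mk_symmetricI)
    show "reachable (with_proj (digraph_of K)) u v"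
    proof (cases "u = v")
      case False
      obtain p q where "path_betw u p v" "K = path_edges p \<union> path_edges q"
        using cycle_edges_split[OF K uv False] by metis
      then show ?thesis using reach[of p] uv by (auto simp: path_betw_def)
    qed (use uv in simp)
  qed
  moreover have "\<Union>K \<noteq> {}" using cycle_edges_nonempty[OF K] pair by blast
  ultimately have "Digraph_Component.connected (with_proj (digraph_of K))"
    unfolding Digraph_Component.connected_def strongly_connected_def by simp
  moreover have "regular_graph 2 (digraph_of K)"
    unfolding regular_graph_def
    using out_degree_digraph_of[of "digraph_of K" K] pair cycle_edges_degree[OF K] by simp
  ultimately show ?thesis using pg by (simp add: cycle_graph_def)
qed

section \<open>Translation of the given graph, its drawing and its cycles\<close>

context
  fixes G :: "'a pair_pre_digraph"
  assumes pg: "pair_graph G"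
begin

lemma undirected_iff: "{u, v} \<in> undirected_edges G \<longleftrightarrow> (u, v) \<in> parcs G"
proof -
  interpret pair_graph G by (rule pg)
  show ?thesis using graph_symmetric by (auto simp: undirected_edges_def doubleton_eq_iff)
qed

lemma undirected_pair:
  assumes "e \<in> undirected_edges G"
  obtains u v where "e = {u, v}" "(u, v) \<in> parcs G" "u \<noteq> v" "u \<in> pverts G" "v \<in> pverts G"
proof -
  interpret pair_graph G by (rule pg)
  obtain u v where uv: "e = {u, v}" "(u, v) \<in> parcs G" using assms by (auto simp: undirected_edges_def)
  with that in_arcsD1[OF uv(2)] in_arcsD2[OF uv(2)] no_loops'[OF uv(2)] show thesis by blast
qed

lemma cubic_graph_undirected:
  assumes "vertex_connected 2 G" "regular_graph 3 G"
  shows "cubic_graph (pverts G) (undirected_edges G)"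
proof -
  interpret pair_graph G by (rule pg)
  show ?thesis
  proof
    show "finite (pverts G)" by simp
    show "pverts G \<noteq> {}" using assms(1) by (auto simp: vertex_connected_def)
    show "\<exists>u v. e = {u, v} \<and> u \<noteq> v \<and> u \<in> pverts G \<and> v \<in> pverts G" if "e \<in> undirected_edges G" for e
      using undirected_pair[OF that] by metis
    show "card {e \<in> undirected_edges G. v \<in> e} = 3" if "v \<in> pverts G" for v
    proof -
      have "\<exists>u v. e = {u, v} \<and> u \<noteq> v" if "e \<in> undirected_edges G" for e
        using undirected_pair[OF that] by metis
      then show ?thesis
        using out_degree_digraph_of[of G "undirected_edges G" v] undirected_iff assms(2) that
        by (simp add: regular_graph_def)
    qed
    fix W a z assume W: "W \<subseteq> pverts G" "W \<noteq> {}" "a \<notin> W" "z \<in> pverts G - W" "z \<noteq> a"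
    \<comment> \<open>The locale admits any \<open>a\<close>. Outside the graph it makes
      \<open>X\<close> empty, which is covered because connectivity is known for all deleted sets of
      fewer than two vertices.\<close>
    define X where "X = pverts G \<inter> {a}"
    have "card X \<le> card {a}" unfolding X_def by (intro card_mono) auto
    then have "Digraph_Component.connected (induce_subgraph (with_proj G) (pverts G - X))"
      using assms(1) by (auto simp: vertex_connected_def X_def)
    moreover obtain w where w: "w \<in> W" using W(2) by blast
    moreover have "w \<in> pverts G - X" "z \<in> pverts G - X" using w W by (auto simp: X_def)
    ultimately have reach: "reachable (with_proj (mk_symmetric (induce_subgraph (with_proj G) (pverts G - X)))) w z"
      by (auto simp: Digraph_Component.connected_def strongly_connected_def)
    have "(w, z) \<in> (parcs (mk_symmetric (induce_subgraph (with_proj G) (pverts G - X))))\<^sup>*"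
      using rtrancl_on_rtranclI[OF reach[unfolded reachable_def]] by simp
    then obtain x y where xy: "(x, y) \<in> parcs (mk_symmetric (induce_subgraph (with_proj G) (pverts G - X)))"
      "x \<in> W" "y \<notin> W" using rtrancl_leaves[of w z _ W] w W(4) by blast
    then have "((x, y) \<in> parcs G \<or> (y, x) \<in> parcs G) \<and> y \<in> pverts G - X"
      by (auto simp: parcs_mk_symmetric)
    then have "{x, y} \<in> undirected_edges G" "y \<in> pverts G - W" "y \<noteq> a"
      using undirected_iff[of x y] undirected_iff[of y x] xy(3) by (auto simp: X_def insert_commute)
    then show "\<exists>w\<in>W. \<exists>x\<in>pverts G - W. x \<noteq> a \<and> {w, x} \<in> undirected_edges G" using xy(2) by blast
  qed
qed

lemma plane_cubic_graph_undirected: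
  assumes "vertex_connected 2 G" "regular_graph 3 G" and d: "plane_drawing G p \<gamma>"
  shows "plane_cubic_graph (pverts G) (undirected_edges G) p
    (\<lambda>e. \<Union>{path_image (\<gamma> (u, v)) |u v. (u, v) \<in> parcs G \<and> e = {u, v}})"
    (is "plane_cubic_graph _ _ _ ?img")
proof -
  have d1: "inj_on p (pverts G)"
    and d2: "\<And>u v. (u, v) \<in> parcs G \<Longrightarrow> arc (\<gamma> (u, v)) \<and> pathstart (\<gamma> (u, v)) = p u \<and>
      pathfinish (\<gamma> (u, v)) = p v \<and> \<gamma> (v, u) = reversepath (\<gamma> (u, v))"
    and d3: "\<And>u v. (u, v) \<in> parcs G \<Longrightarrow> path_image (\<gamma> (u, v)) \<inter> p ` pverts G = {p u, p v}"
    and d4: "\<And>u v x y. \<lbrakk>(u, v) \<in> parcs G; (x, y) \<in> parcs G; {u, v} \<noteq> {x, y}\<rbrakk> \<Longrightarrow>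
      path_image (\<gamma> (u, v)) \<inter> path_image (\<gamma> (x, y)) \<subseteq> p ` pverts G"
    using d unfolding plane_drawing_def by blast+
  \<comment> \<open>The union ranges over both orientations of an edge; their curves are reverses of
    each other and have the same image.\<close>
  have img: "?img {u, v} = path_image (\<gamma> (u, v))" if uv: "(u, v) \<in> parcs G" for u v
  proof -
    have "path_image (\<gamma> (x, y)) = path_image (\<gamma> (u, v))" if "{u, v} = {x, y}" for x y
      using that d2[OF uv] by (auto simp: doubleton_eq_iff)
    then show ?thesis using uv by blast
  qed
  interpret cubic_graph "pverts G" "undirected_edges G" by (rule cubic_graph_undirected[OF assms(1,2)])
  show ?thesis
  proof
    show "inj_on p (pverts G)" by (rule d1)
    show "\<exists>g. arc g \<and> path_image g = ?img {u, v} \<and> pathstart g = p u \<and> pathfinish g = p v"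
      if "{u, v} \<in> undirected_edges G" for u v
    proof -
      have uv: "(u, v) \<in> parcs G" using that undirected_iff by blast
      show ?thesis using d2[OF uv] unfolding img[OF uv] by blast
    qed
    show "?img e \<inter> p ` pverts G = p ` e" if e: "e \<in> undirected_edges G" for e
    proof -
      obtain u v where uv: "e = {u, v}" "(u, v) \<in> parcs G" using undirected_pair[OF e] by metis
      show ?thesis unfolding uv(1) img[OF uv(2)] using d3[OF uv(2)] by simp
    qed
    show "?img e \<inter> ?img e' \<subseteq> p ` pverts G"
      if h: "e \<in> undirected_edges G" "e' \<in> undirected_edges G" "e \<noteq> e'" for e e'
    proof -
      obtain u v where uv: "e = {u, v}" "(u, v) \<in> parcs G" using undirected_pair[OF h(1)] by metis
      obtain x y where xy: "e' = {x, y}" "(x, y) \<in> parcs G" using undirected_pair[OF h(2)] by metis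
      show ?thesis unfolding uv(1) xy(1) img[OF uv(2)] img[OF xy(2)]
        using d4[OF uv(2) xy(2)] h(3) uv(1) xy(1) by blast
    qed
  qed
qed

lemma cycle_double_cover_mset:
  assumes "\<And>K. K \<in># M \<Longrightarrow> cycle_edges K \<and> K \<subseteq> undirected_edges G"
    and two: "\<And>e. e \<in> undirected_edges G \<Longrightarrow> size {#K \<in># M. e \<in> K#} = 2"
  shows "cycle_double_cover G (image_mset digraph_of M)"
  unfolding cycle_double_cover_def
proof (intro conjI ballI)
  interpret G: pair_graph G by (rule pg)
  fix C assume "C \<in># image_mset digraph_of M"
  then obtain K where K: "K \<in># M" "C = digraph_of K" by auto
  show cg: "cycle_graph C" using cycle_graph_digraph_of assms(1)[OF K(1)] K(2) by blast
  interpret C: pair_graph C using cg by (simp add: cycle_graph_def)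
  have KE: "K \<subseteq> undirected_edges G" using assms(1)[OF K(1)] by blast
  have "parcs C \<subseteq> parcs G"
    using KE undirected_iff unfolding K(2) digraph_of_def by auto
  moreover have "\<Union>K \<subseteq> pverts G"
  proof
    fix x assume "x \<in> \<Union>K"
    then obtain e where "e \<in> undirected_edges G" "x \<in> e" using KE by blast
    then show "x \<in> pverts G" using undirected_pair by (metis insertE singletonD)
  qed
  ultimately show "subgraph (with_proj C) (with_proj G)"
    using K(2) G.wf_digraph_axioms C.wf_digraph_axioms by (auto simp: subgraph_def compatible_def)
next
  fix e assume "e \<in> parcs G"
  then obtain u v where uv: "e = (u, v)" "(u, v) \<in> parcs G" by (cases e) auto
  have "size {#C \<in># image_mset digraph_of M. e \<in> parcs C#} = size {#K \<in># M. {u, v} \<in> K#}"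
    by (simp add: filter_mset_image_mset uv(1))
  then show "size {#C \<in># image_mset digraph_of M. e \<in> parcs C#} = 2"
    using two[of "{u, v}"] undirected_iff uv(2) by simp
qed

end

theorem theorem4:
  fixes G :: "'a pair_pre_digraph" and n :: nat
  assumes "pair_graph G"
    and "planar G"
    and "vertex_connected 2 G"
    and "regular_graph 3 G"
    and "card (pverts G) = n"
    and "n > 4"
  shows "\<exists>M. cycle_double_cover G M \<and> real (size M) \<le> real n / 2"
proof -
  obtain p \<gamma> where d: "plane_drawing G p \<gamma>" using assms(2) by (auto simp: planar_def)
  interpret plane_cubic_graph "pverts G" "undirected_edges G" p
    "\<lambda>e. \<Union>{path_image (\<gamma> (u, v)) |u v. (u, v) \<in> parcs G \<and> e = {u, v}}"
    by (rule plane_cubic_graph_undirected[OF assms(1,3,4) d])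
  obtain \<Phi> :: "complex set set" and bd where F: "finite \<Phi>"
    "card \<Phi> + card (pverts G) = card (undirected_edges G) + 2"
    "\<And>R. R \<in> \<Phi> \<Longrightarrow> cycle_edges (bd R) \<and> bd R \<subseteq> undirected_edges G"
    "\<And>e. e \<in> undirected_edges G \<Longrightarrow> card {R \<in> \<Phi>. e \<in> bd R} = 2"
    "\<And>Z. \<lbrakk>cycle_edges Z; Z \<subseteq> undirected_edges G\<rbrakk> \<Longrightarrow>
      \<exists>S \<subseteq> \<Phi>. \<forall>e \<in> undirected_edges G. e \<in> Z \<longleftrightarrow> card {R \<in> S. e \<in> bd R} = 1"
    using facial_cycles by blast
  interpret facial_cover "pverts G" "undirected_edges G" \<Phi> bd
    by unfold_locales (use F in \<open>auto simp: double_cover_def\<close>)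
  obtain M where M: "mset_cover M" "size M + 2 \<le> card \<Phi>"
    using small_mset_cover assms(5,6) by blast
  have "cycle_double_cover G (image_mset digraph_of M)"
    using M(1) by (intro cycle_double_cover_mset[OF assms(1)]) (auto simp: mset_cover_def)
  \<comment> \<open>With m edges, 2 m = 3 n, so Euler's formula gives
    \<open>2 * card \<Phi> = n + 4\<close>; saving two cycles removes the 4.\<close>
  moreover have "2 * size M \<le> n" using M(2) F(2) card_E assms(5) by linarith
  ultimately show ?thesis by (intro exI[of _ "image_mset digraph_of M"]) simp
qed

end
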